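(* Let $N_1\subset L^+$ and $N_2\subset L^-$ be (embedded) Legendrian submanifolds of dimension $n-1$, let $R=(q^+)^{-1}(N_1)\cap(q^-)^{-1}(N_2)\subset\mathcal F$, and let $\mathbf n_1:N_1\to\mathcal V$, $\mathbf n_2:N_2\to\mathcal V$ be any smooth lifts of $\gamma^+|_{N_1}$, $\gamma^-|_{N_2}$ into the null cone. Let $\zeta:N_1\times N_2\to\mathbb C$ be $\zeta=\langle\mathbf n_1,\mathbf n_2\rangle_{\mathbb C}$, and let $U\subset N_1\times N_2$ be the open set where $\zeta\ne0$. Suppose there is a smooth function $\tau:U\to\mathbb C$ with $\tau^2=\dfrac{1-\mathrm i\tan\phi}{2\zeta}$. Then the map $$(p_1,p_2,\lambda)\longmapsto \mathsf z = r\left(-\mathrm i\,\lambda\,\overline{\tau}\,\mathbf n_1+\mathrm i\,\frac{\tau}{\lambda}\,\mathbf n_2\right),\qquad (p_1,p_2)\in U,\ \lambda\in\mathbb R,\ \lambda>0$$ (where $\tau$ is evaluated at $(p_1,p_2)$, $\mathbf n_1$ at $p_1$ and $\mathbf n_2$ at $p_2$) takes values in $Q$, and the image of its composition with the Hopf fibration $\pi:Q\to\mathbb{C}\mathrm H^n$ is exactly $M=\rho(R)$ (which is the Hopf hypersurface with Hopf principal curvature $\alpha$ determined by $N_1,N_2$ wherever $\omega^1\wedge\cdots\wedge\omega^{2n-1}|_R\neq0$).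
   Context: Let $n\ge1$, $r>0$. On $\mathbb C^{n+1}$ (coordinates $z_0,\dots,z_n$) let $\langle\mathsf z,\mathsf w\rangle_{\mathbb C}=-\overline{z_0}w_0+\overline{z_1}w_1+\cdots+\overline{z_n}w_n$ and $\langle\mathsf z,\mathsf w\rangle=\operatorname{Re}\langle\mathsf z,\mathsf w\rangle_{\mathbb C}$. Let $Q=\{\mathsf z:\langle\mathsf z,\mathsf z\rangle=-r^2\}$ and let $\pi:Q\to \mathbb{C}\mathrm H^n$ be the quotient by the circle action $\mathsf z\mapsto e^{\mathrm i\theta}\mathsf z$ (the Hopf fibration), with $\mathbb{C}\mathrm H^n$ given the metric making $\pi$ a semi-Riemannian submersion (holomorphic sectional curvature $-4/r^2$) and the induced complex structure $\mathrm J$. Frame bundle: $\rho:\mathcal F\to\mathbb{C}\mathrm H^n$ is the unitary frame bundle, whose points are orthonormal frames $(e_1,\dots,e_{2n})$ with $\mathrm Je_{2k-1}=e_{2k}$, $1\le k\le n$. Let $\omega^i,\omega^i_j$ be its canonical 1-forms and Levi-Civita connection 1-forms: for a local section $f=(e_i)$, the $f^*\omega^i$ form the dual coframe and $\nabla e_j=e_i\otimes f^*\omega^i_j$. Fix $\alpha$ with $|\alpha|<2/r$ and $\phi\in(-\pi/2,\pi/2)$ with $\alpha=(2/r)\sin\phi$. A Hopf hypersurface is a real hypersurface, with unit normal $\nu$, for which the tangent field $W$ with $\mathrm JW=\nu$ is a principal direction at each point; the corresponding principal curvature is the Hopf principal curvature. Put $\omega^{\overline{\jmath}}=\omega^{j+1}$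 for $j$ odd and $\omega^{\overline{\jmath}}=-\omega^{j-1}$ for $j$ even, and $$\kappa^\pm_0=\omega^{2n}_{2n-1}-\tfrac2r(\sin\phi\,\omega^{2n-1}\pm\cos\phi\,\omega^{2n}),\qquad \kappa^\pm_j=\omega^{2n}_j-\tfrac1r(\sin\phi\,\omega^j\pm\cos\phi\,\omega^{\overline{\jmath}}),\quad 1\le j\le 2n-2.$$ The Pfaffian systems $\mathcal K^\pm=\{\kappa^\pm_0,\dots,\kappa^\pm_{2n-2}\}$ on $\mathcal F$ are completely integrable; $L^\pm$ is the set of maximal connected leaves, a smooth manifold such that the quotient map $q^\pm:\mathcal F\to L^\pm$ is a smooth submersion. $L^\pm$ carries the contact distribution whose annihilator 1-forms pull back via $q^\pm$ to multiples of $\kappa_0^\pm$; Legendrian submanifolds are those tangent to it. Identification of $L^\pm$ with the projectivized null cone: an adapted unitary frame at $\mathsf z\in Q$ is an orthogonal basis $(\hat{\mathsf e}_0,\dots,\hat{\mathsf e}_{2n})$ of $T_{\mathsf z}Q$ with $\hat{\mathsf e}_0=\frac{\mathrm i}{r}\mathsf z$, $\hat{\mathsf e}_{2k}=\mathrm i\,\hat{\mathsf e}_{2k-1}$ ($1\le k\le n$), $\langle\hat{\mathsf e}_j,\hat{\mathsf e}_j\rangle=1$ for $1\le j\le 2n$; $\mathcal G$ is the bundle of these, and $\Pi:\mathcal G\to\mathcal F$ sends such a frame to $(\pi_*\hat{\mathsf e}_1,\dots,\pi_*\hat{\mathsf e}_{2n})$ at $\pi(\mathsf z)$. Let $\mathcal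 V\subset\mathbb C^{n+1}$ be the cone of nonzero null vectors of $\langle\,,\rangle$ and $\mathbb P\mathcal V$ (which is diffeomorphic to $S^{2n-1}$) the set of complex null lines. Define $\mathbf g^\pm:\mathcal G\to\mathcal V$ by $\mathbf g^\pm=\hat{\mathsf e}_0-(\sin\phi\,\hat{\mathsf e}_{2n-1}\pm\cos\phi\,\hat{\mathsf e}_{2n})$. There are diffeomorphisms $\gamma^\pm:L^\pm\to\mathbb P\mathcal V$ determined by $\gamma^\pm(q^\pm(\Pi(g)))=[\mathbf g^\pm(g)]$ for $g\in\mathcal G$. A lift $\mathbf n$ of $\gamma^\pm|_N$ is a map $\mathbf n:N\to\mathcal V$ whose class in $\mathbb P\mathcal V$ is $\gamma^\pm|_N$. *)

theory Defs
  imports "HOL-Analysis.Analysis" "HOL-Combinatorics.Permutations"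
begin

section \<open>Smooth maps and embedded submanifolds\<close>

primrec Ck_on :: "nat \<Rightarrow> ('a::real_normed_vector \<Rightarrow> 'b::real_normed_vector) \<Rightarrow> 'a set \<Rightarrow> bool" where
  "Ck_on 0 f S \<longleftrightarrow> continuous_on S f"
| "Ck_on (Suc k) f S \<longleftrightarrow>
     (\<forall>x\<in>S. f differentiable (at x)) \<and> (\<forall>v. Ck_on k (\<lambda>x. frechet_derivative f (at x) v) S)"

definition smooth_on :: "('a::real_normed_vector \<Rightarrow> 'b::real_normed_vector) \<Rightarrow> 'a set \<Rightarrow> bool" where
  "smooth_on f S \<longleftrightarrow> open S \<and> (\<forall>k. Ck_on k f S)"

text \<open>Smoothness on an arbitrary subset: local existence of smooth extensions.\<close>

definition smooth_within :: "('a::real_normed_vector \<Rightarrow> 'b::real_normed_vector) \<Rightarrow> 'a set \<Rightarrow> bool" where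
  "smooth_within f A \<longleftrightarrow>
     (\<forall>x\<in>A. \<exists>V h. x \<in> V \<and> smooth_on h V \<and> (\<forall>y\<in>V \<inter> A. h y = f y))"

definition tangent_space :: "'e::real_normed_vector set \<Rightarrow> 'e \<Rightarrow> 'e set" where
  "tangent_space P x =
     {X. \<exists>c :: real \<Rightarrow> 'e. (\<forall>t. c t \<in> P) \<and> c 0 = x \<and> (c has_vector_derivative X) (at 0)}"

text \<open>
  The manifolds that are not given as submanifolds of a Euclidean space (complex hyperbolic space,
  its frame bundle and the two leaf spaces) are all of the form \<open>p ` P\<close>, where \<open>P\<close> is a submanifold
  of a Euclidean space and \<open>p\<close> is a surjective submersion.  The smooth structure of \<open>p ` P\<close> is
  determined by this: it has the quotient topology, its tangent spaces are the quotients of those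
  of \<open>P\<close> by the kernels \<open>K x\<close> of the differential of \<open>p\<close>, and the smooth maps into it are those
  that locally have the form \<open>p \<circ> \<psi>\<close> with \<open>\<psi>\<close> a smooth map into \<open>P\<close>.
\<close>

definition quot_open :: "'e::real_normed_vector set \<Rightarrow> ('e \<Rightarrow> 'x) \<Rightarrow> 'x set \<Rightarrow> bool" where
  "quot_open P p A \<longleftrightarrow> A \<subseteq> p ` P \<and> openin (top_of_set P) {x \<in> P. p x \<in> A}"

text \<open>
  \<open>p \<circ> \<psi>\<close>, restricted to the open subset \<open>W \<inter> S\<close> of the \<open>d\<close>-dimensional linear space \<open>S\<close>, is an
  immersion and a homeomorphism onto an open subset of \<open>N\<close> (with the subspace topology).
\<close>

definition local_param ::
  "'e::real_normed_vector set \<Rightarrow> ('e \<Rightarrow> 'x) \<Rightarrow> ('e \<Rightarrow> 'e set) \<Rightarrow> nat \<Rightarrow> 'x set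
    \<Rightarrow> 'a::euclidean_space set \<Rightarrow> 'a set \<Rightarrow> ('a \<Rightarrow> 'e) \<Rightarrow> bool" where
  "local_param P p K d N W S \<psi> \<longleftrightarrow>
     subspace S \<and> dim S = d \<and> smooth_on \<psi> W \<and> \<psi> ` (W \<inter> S) \<subseteq> P \<and>
     inj_on (p \<circ> \<psi>) (W \<inter> S) \<and>
     (\<forall>V. open V \<and> V \<subseteq> W \<longrightarrow> (\<exists>A. quot_open P p A \<and> (p \<circ> \<psi>) ` (V \<inter> S) = N \<inter> A)) \<and>
     (\<forall>x\<in>W \<inter> S. \<forall>v\<in>S. frechet_derivative \<psi> (at x) v \<in> K (\<psi> x) \<longrightarrow> v = 0)"

section \<open>Hyperbolic Hermitian space\<close>

type_synonym 'n cvec = "complex \<times> (complex ^ 'n)"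

definition cscale :: "complex \<Rightarrow> 'n::finite cvec \<Rightarrow> 'n cvec" (infixr \<open>*\<^sub>C\<close> 75) where
  "c *\<^sub>C v = (c * fst v, c *s snd v)"

definition herm :: "'n::finite cvec \<Rightarrow> 'n cvec \<Rightarrow> complex" where
  "herm z w = - cnj (fst z) * fst w + (\<Sum>k\<in>UNIV. cnj (snd z $ k) * snd w $ k)"

definition ip :: "'n::finite cvec \<Rightarrow> 'n cvec \<Rightarrow> real" where
  "ip z w = Re (herm z w)"

definition Q :: "real \<Rightarrow> 'n::finite cvec set" where
  "Q r = {z. ip z z = - (r ^ 2)}"

definition null_cone :: "'n::finite cvec set" where
  "null_cone = {v. v \<noteq> 0 \<and> ip v v = 0}"

definition cline :: "'n::finite cvec \<Rightarrow> 'n cvec set" where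
  "cline v = range (\<lambda>c. c *\<^sub>C v)"

section \<open>Complex hyperbolic space\<close>

definition hopf :: "'n::finite cvec \<Rightarrow> 'n cvec set" where
  "hopf z = range (\<lambda>\<theta>. cis \<theta> *\<^sub>C z)"

definition CH :: "real \<Rightarrow> 'n::finite cvec set set" where
  "CH r = hopf ` Q r"

text \<open>
  The orthogonal projection of \<open>T\<^sub>zQ\<close>, and of the whole of \<open>\<complex>\<^sup>n\<^sup>+\<^sup>1\<close>, onto the horizontal space at
  \<open>z \<in> Q\<close>, which is the complex orthogonal complement of \<open>z\<close>.
\<close>

definition hor :: "real \<Rightarrow> 'n::finite cvec \<Rightarrow> 'n cvec \<Rightarrow> 'n cvec" where
  "hor r z v = v + (herm z v / of_real (r ^ 2)) *\<^sub>C z"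

text \<open>A tangent vector of \<open>CH\<close> is represented by the set of all pairs \<open>(z, v)\<close> such that \<open>v\<close> is its
  horizontal lift to the point \<open>z\<close> of \<open>Q\<close>.\<close>

type_synonym 'n tvec = "('n cvec \<times> 'n cvec) set"

definition push :: "real \<Rightarrow> 'n::finite cvec \<Rightarrow> 'n cvec \<Rightarrow> 'n tvec" where
  "push r z v = range (\<lambda>\<theta>. (cis \<theta> *\<^sub>C z, cis \<theta> *\<^sub>C hor r z v))"

definition TCH :: "real \<Rightarrow> 'n::finite cvec set \<Rightarrow> 'n tvec set" where
  "TCH r x = {push r z v | z v. z \<in> x \<and> ip z v = 0}"

definition tmetric :: "'n::finite tvec \<Rightarrow> 'n tvec \<Rightarrow> real" where
  "tmetric \<xi> \<eta> = (THE c. \<exists>z v w. (z, v) \<in> \<xi> \<and> (z, w) \<in> \<eta> \<and> c = ip v w)"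

definition tJ :: "'n::finite tvec \<Rightarrow> 'n tvec" where
  "tJ \<xi> = (\<lambda>(z, v). (z, \<i> *\<^sub>C v)) ` \<xi>"

text \<open>
  The Levi-Civita connection: for a curve in \<open>Q\<close> through \<open>z\<close> with velocity \<open>dz\<close> and a horizontal
  vector field along it with value \<open>v\<close> and derivative \<open>dv\<close> at \<open>z\<close>, \<open>cov r z dz v dv\<close> is the
  horizontal lift of the covariant derivative of the projected field along the projected curve.
  If the curve is horizontal this is the horizontal part of \<open>dv\<close> (O'Neill's formula).
  In general, \<open>dz\<close> has vertical part \<open>a \<i> z\<close> with \<open>a\<close> as below, and rotating the data by
  \<open>e\<^sup>-\<^sup>\<i>\<^sup>\<theta>\<close> with \<open>\<theta>' = a\<close> makes the curve horizontal, which accounts for the term \<open>a \<i> v\<close>.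
  That the result does not depend on the lift and that the connection is metric and torsion-free
  is proved below (\<open>cov_gauge\<close>, \<open>cov_metric\<close>, \<open>cov_torsion_free\<close>).
\<close>

definition cov ::
  "real \<Rightarrow> 'n::finite cvec \<Rightarrow> 'n cvec \<Rightarrow> 'n cvec \<Rightarrow> 'n cvec \<Rightarrow> 'n cvec" where
  "cov r z dz v dv =
     (let a = - ip (\<i> *\<^sub>C z) dz / r ^ 2 in hor r z (dv - (of_real a * \<i>) *\<^sub>C v))"

section \<open>The unitary frame bundle and its canonical and connection forms\<close>

text \<open>
  Frames of \<open>CH\<close> are indexed by \<open>'n + 'n\<close>: if \<open>k\<close> is the \<open>m\<close>-th element of \<open>'n\<close>, then \<open>Inl k\<close> stands
  for the index \<open>2m - 1\<close> and \<open>Inr k\<close> for the index \<open>2m\<close>.  In particular \<open>Inl last_index\<close> and \<open>Inr last_index\<close>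
  stand for \<open>2n - 1\<close> and \<open>2n\<close>.
\<close>

definition last_index :: "'n::{finite,linorder}" where
  "last_index = Max UNIV"

type_synonym 'n frame = "'n cvec set \<times> ('n + 'n \<Rightarrow> 'n tvec)"

definition frames :: "real \<Rightarrow> 'n::finite frame set" where
  "frames r = {(x, e). x \<in> CH r \<and> (\<forall>j. e j \<in> TCH r x) \<and>
     (\<forall>i j. tmetric (e i) (e j) = (if i = j then 1 else 0)) \<and>
     (\<forall>k. tJ (e (Inl k)) = e (Inr k))}"

definition base_point :: "'n::finite frame \<Rightarrow> 'n cvec set" where
  "base_point = fst"

text \<open>Adapted frames of \<open>T\<^sub>zQ\<close>; the vector with index 0, which is \<open>(\<i>/r) z\<close>, is not stored.\<close>

type_synonym 'n aframe = "'n cvec \<times> (('n cvec) ^ ('n + 'n))"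

definition e0 :: "real \<Rightarrow> 'n::finite aframe \<Rightarrow> 'n cvec" where
  "e0 r g = (\<i> / of_real r) *\<^sub>C fst g"

definition adapted_frames :: "real \<Rightarrow> 'n::finite aframe set" where
  "adapted_frames r = {g. fst g \<in> Q r \<and> (\<forall>j. ip (fst g) (snd g $ j) = 0) \<and>
     (\<forall>j. ip (e0 r g) (snd g $ j) = 0) \<and>
     (\<forall>i j. ip (snd g $ i) (snd g $ j) = (if i = j then 1 else 0)) \<and>
     (\<forall>k. snd g $ Inr k = \<i> *\<^sub>C (snd g $ Inl k))}"

definition frame_proj :: "real \<Rightarrow> 'n::finite aframe \<Rightarrow> 'n frame" where
  "frame_proj r g = (hopf (fst g), \<lambda>j. push r (fst g) (snd g $ j))"

text \<open>
  The pullbacks by \<open>frame_proj\<close> of the forms \<open>\<omega>\<^sup>i\<close> and \<open>\<omega>\<^sup>i\<^sub>j\<close>, at the adapted frame \<open>g\<close> and evaluated on the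
  tangent vector \<open>X\<close>: for the frame along a curve they give the components of the velocity of the
  base point and of the covariant derivative of the \<open>j\<close>-th frame vector.
\<close>

definition omega :: "real \<Rightarrow> 'n + 'n \<Rightarrow> 'n::finite aframe \<Rightarrow> 'n aframe \<Rightarrow> real" where
  "omega r i g X = ip (snd g $ i) (hor r (fst g) (fst X))"

definition conn :: "real \<Rightarrow> 'n + 'n \<Rightarrow> 'n + 'n \<Rightarrow> 'n::finite aframe \<Rightarrow> 'n aframe \<Rightarrow> real" where
  "conn r i j g X = ip (snd g $ i) (cov r (fst g) (fst X) (snd g $ j) (snd X $ j))"

definition omega_bar :: "real \<Rightarrow> 'n + 'n \<Rightarrow> 'n::finite aframe \<Rightarrow> 'n aframe \<Rightarrow> real" where
  "omega_bar r j g X = (case j of Inl k \<Rightarrow> omega r (Inr k) g X | Inr k \<Rightarrow> - omega r (Inl k) g X)"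

section \<open>The Pfaffian systems and their leaf spaces\<close>

text \<open>The superscripts plus and minus correspond to \<open>s = 1\<close> and \<open>s = -1\<close>.\<close>

definition kappa0 ::
  "real \<Rightarrow> real \<Rightarrow> real \<Rightarrow> 'n::{finite,linorder} aframe \<Rightarrow> 'n aframe \<Rightarrow> real" where
  "kappa0 r \<phi> s g X = conn r (Inr last_index) (Inl last_index) g X
     - (2 / r) * (sin \<phi> * omega r (Inl last_index) g X + s * cos \<phi> * omega r (Inr last_index) g X)"

definition kappa ::
  "real \<Rightarrow> real \<Rightarrow> real \<Rightarrow> 'n + 'n \<Rightarrow> 'n::{finite,linorder} aframe \<Rightarrow> 'n aframe \<Rightarrow> real" where
  "kappa r \<phi> s j g X = conn r (Inr last_index) j g X
     - (1 / r) * (sin \<phi> * omega r j g X + s * cos \<phi> * omega_bar r j g X)"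

definition annihilated ::
  "real \<Rightarrow> real \<Rightarrow> real \<Rightarrow> 'n::{finite,linorder} aframe \<Rightarrow> 'n aframe set" where
  "annihilated r \<phi> s g =
     {X. kappa0 r \<phi> s g X = 0 \<and> (\<forall>j. j \<noteq> Inl last_index \<and> j \<noteq> Inr last_index \<longrightarrow> kappa r \<phi> s j g X = 0)}"

text \<open>
  The maximal connected leaf through \<open>f\<close> consists of the end points of all piecewise continuously
  differentiable integral curves starting at \<open>f\<close>.  Curves in the frame bundle are given by lifts
  to adapted frames, which always exist as \<open>frame_proj\<close> is a principal circle bundle.
\<close>

definition integral_curve ::
  "real \<Rightarrow> real \<Rightarrow> real \<Rightarrow> (real \<Rightarrow> 'n::{finite,linorder} aframe) \<Rightarrow> bool" where
  "integral_curve r \<phi> s c \<longleftrightarrow> valid_path c \<and> c ` {0..1} \<subseteq> adapted_frames r \<and>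
     (\<forall>t\<in>{0<..<1}. \<forall>X. (c has_vector_derivative X) (at t) \<longrightarrow> X \<in> annihilated r \<phi> s (c t))"

definition leaf ::
  "real \<Rightarrow> real \<Rightarrow> real \<Rightarrow> 'n::{finite,linorder} frame \<Rightarrow> 'n frame set" where
  "leaf r \<phi> s f =
     {f'. \<exists>c. integral_curve r \<phi> s c \<and> frame_proj r (pathstart c) = f \<and> frame_proj r (pathfinish c) = f'}"

definition leaf_space :: "real \<Rightarrow> real \<Rightarrow> real \<Rightarrow> 'n::{finite,linorder} frame set set" where
  "leaf_space r \<phi> s = leaf r \<phi> s ` frames r"

definition leaf_param ::
  "real \<Rightarrow> real \<Rightarrow> real \<Rightarrow> nat \<Rightarrow> 'n::{finite,linorder} frame set set
    \<Rightarrow> 'n cvec set \<Rightarrow> 'n cvec set \<Rightarrow> ('n cvec \<Rightarrow> 'n aframe) \<Rightarrow> bool" where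
  "leaf_param r \<phi> s =
     local_param (adapted_frames r) (leaf r \<phi> s \<circ> frame_proj r) (annihilated r \<phi> s)"

definition leaf_submanifold ::
  "real \<Rightarrow> real \<Rightarrow> real \<Rightarrow> nat \<Rightarrow> 'n::{finite,linorder} frame set set \<Rightarrow> bool" where
  "leaf_submanifold r \<phi> s d N \<longleftrightarrow> N \<subseteq> leaf_space r \<phi> s \<and>
     (\<forall>l\<in>N. \<exists>W S \<psi>. leaf_param r \<phi> s d N W S \<psi> \<and> l \<in> (leaf r \<phi> s \<circ> frame_proj r \<circ> \<psi>) ` (W \<inter> S))"

definition legendrian ::
  "real \<Rightarrow> real \<Rightarrow> real \<Rightarrow> nat \<Rightarrow> 'n::{finite,linorder} frame set set \<Rightarrow> bool" where
  "legendrian r \<phi> s d N \<longleftrightarrow> leaf_submanifold r \<phi> s d N \<and>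
     (\<forall>W S \<psi>. leaf_param r \<phi> s d N W S \<psi> \<longrightarrow>
       (\<forall>x\<in>W \<inter> S. \<forall>v\<in>S. kappa0 r \<phi> s (\<psi> x) (frechet_derivative \<psi> (at x) v) = 0))"

definition gvec :: "real \<Rightarrow> real \<Rightarrow> real \<Rightarrow> 'n::{finite,linorder} aframe \<Rightarrow> 'n cvec" where
  "gvec r \<phi> s g = e0 r g - (sin \<phi> *\<^sub>R (snd g $ Inl last_index) + (s * cos \<phi>) *\<^sub>R (snd g $ Inr last_index))"

definition gamma :: "real \<Rightarrow> real \<Rightarrow> real \<Rightarrow> 'n::{finite,linorder} frame set \<Rightarrow> 'n cvec set" where
  "gamma r \<phi> s l = (THE P. \<forall>g\<in>adapted_frames r. leaf r \<phi> s (frame_proj r g) = l \<longrightarrow> cline (gvec r \<phi> s g) = P)"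

definition smooth_lift ::
  "real \<Rightarrow> real \<Rightarrow> real \<Rightarrow> nat \<Rightarrow> 'n::{finite,linorder} frame set set
    \<Rightarrow> ('n frame set \<Rightarrow> 'n cvec) \<Rightarrow> bool" where
  "smooth_lift r \<phi> s d N n \<longleftrightarrow> (\<forall>l\<in>N. n l \<in> null_cone \<and> cline (n l) = gamma r \<phi> s l) \<and>
     (\<forall>W S \<psi>. leaf_param r \<phi> s d N W S \<psi> \<longrightarrow>
       smooth_within (n \<circ> leaf r \<phi> s \<circ> frame_proj r \<circ> \<psi>) (W \<inter> S))"

text \<open>Smoothness of a complex function on an open subset \<open>U\<close> of the product of submanifolds \<open>N1\<close> and
  \<open>N2\<close> of the two leaf spaces.\<close>

definition smooth_on_product ::
  "real \<Rightarrow> real \<Rightarrow> nat \<Rightarrow> 'n::{finite,linorder} frame set set \<Rightarrow> 'n frame set set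
    \<Rightarrow> ('n frame set \<times> 'n frame set) set \<Rightarrow> ('n frame set \<times> 'n frame set \<Rightarrow> complex) \<Rightarrow> bool" where
  "smooth_on_product r \<phi> d N1 N2 U \<tau> \<longleftrightarrow>
     (\<forall>W1 S1 \<psi>1 W2 S2 \<psi>2.
        leaf_param r \<phi> 1 d N1 W1 S1 \<psi>1 \<and> leaf_param r \<phi> (-1) d N2 W2 S2 \<psi>2 \<longrightarrow>
        (let \<Psi> = map_prod (leaf r \<phi> 1 \<circ> frame_proj r \<circ> \<psi>1) (leaf r \<phi> (-1) \<circ> frame_proj r \<circ> \<psi>2)
         in smooth_within (\<tau> \<circ> \<Psi>) {y \<in> (W1 \<inter> S1) \<times> (W2 \<inter> S2). \<Psi> y \<in> U}))"

section \<open>Hopf hypersurfaces\<close>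

text \<open>
  The second conjunct of \<open>unit_normal\<close> says that \<open>\<nu> x\<close> is horizontal.  In \<open>hopf_hypersurface\<close>, all
  tangent vectors of \<open>CH\<close> are given by their horizontal lifts: \<open>hor r (\<psi> x) (D\<psi> v)\<close> is the tangent
  vector of the hypersurface in the direction \<open>v\<close>, the tangent field \<open>W\<close> with \<open>JW = \<nu>\<close> is \<open>-\<i>\<nu>\<close>,
  and the shape operator is the negative of the covariant derivative of \<open>\<nu>\<close>.
\<close>

definition unit_normal ::
  "'n::finite cvec set \<Rightarrow> 'n cvec set \<Rightarrow> ('n cvec \<Rightarrow> 'n cvec) \<Rightarrow> ('n cvec \<Rightarrow> 'n cvec) \<Rightarrow> bool" where
  "unit_normal W S \<psi> \<nu> \<longleftrightarrow> smooth_on \<nu> W \<and>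
     (\<forall>x\<in>W \<inter> S. herm (\<psi> x) (\<nu> x) = 0 \<and> ip (\<nu> x) (\<nu> x) = 1 \<and>
       (\<forall>v\<in>S. ip (\<nu> x) (frechet_derivative \<psi> (at x) v) = 0))"

definition hypersurface_param ::
  "real \<Rightarrow> 'n::finite cvec set set \<Rightarrow> 'n cvec set \<Rightarrow> 'n cvec set \<Rightarrow> ('n cvec \<Rightarrow> 'n cvec) \<Rightarrow> bool" where
  "hypersurface_param r = local_param (Q r) hopf (\<lambda>z. {X. hor r z X = 0}) (2 * CARD('n) - 1)"

definition hopf_hypersurface :: "real \<Rightarrow> real \<Rightarrow> 'n::finite cvec set set \<Rightarrow> bool" where
  "hopf_hypersurface r \<alpha> M \<longleftrightarrow> M \<subseteq> CH r \<and>
     (\<forall>y\<in>M. \<exists>W S \<psi> \<nu>. hypersurface_param r M W S \<psi> \<and> y \<in> (hopf \<circ> \<psi>) ` (W \<inter> S) \<and>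
       unit_normal W S \<psi> \<nu> \<and>
       (\<forall>x\<in>W \<inter> S. \<forall>v\<in>S.
          hor r (\<psi> x) (frechet_derivative \<psi> (at x) v) = (- \<i>) *\<^sub>C \<nu> x \<longrightarrow>
          - cov r (\<psi> x) (frechet_derivative \<psi> (at x) v) (\<nu> x) (frechet_derivative \<nu> (at x) v)
            = \<alpha> *\<^sub>R ((- \<i>) *\<^sub>C \<nu> x)))"

section \<open>The construction\<close>

definition R_set ::
  "real \<Rightarrow> real \<Rightarrow> 'n::{finite,linorder} frame set set \<Rightarrow> 'n frame set set \<Rightarrow> 'n frame set" where
  "R_set r \<phi> N1 N2 = {f \<in> frames r. leaf r \<phi> 1 f \<in> N1 \<and> leaf r \<phi> (-1) f \<in> N2}"

text \<open>
  The restriction to \<open>R\<close> of the wedge product of all \<open>\<omega>\<^sup>i\<close> with \<open>1 \<le> i \<le> 2n - 1\<close> does not vanish at the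
  point \<open>frame_proj r g\<close>; tangent vectors of \<open>R\<close> are represented by tangent vectors of its preimage under \<open>frame_proj\<close>.
\<close>

definition wedge_nonzero :: "real \<Rightarrow> 'n::{finite,linorder} frame set \<Rightarrow> 'n aframe \<Rightarrow> bool" where
  "wedge_nonzero r R g \<longleftrightarrow>
     (let I = UNIV - {Inr last_index} in
      \<exists>X. (\<forall>j\<in>I. X j \<in> tangent_space {h \<in> adapted_frames r. frame_proj r h \<in> R} g) \<and>
          (\<Sum>\<sigma> | \<sigma> permutes I. of_int (sign \<sigma>) * (\<Prod>i\<in>I. omega r i g (X (\<sigma> i)))) \<noteq> 0)"

definition hopf_lift ::
  "real \<Rightarrow> ('n::{finite,linorder} frame set \<Rightarrow> 'n cvec) \<Rightarrow> ('n frame set \<Rightarrow> 'n cvec)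
    \<Rightarrow> ('n frame set \<times> 'n frame set \<Rightarrow> complex) \<Rightarrow> 'n frame set \<times> 'n frame set \<Rightarrow> real \<Rightarrow> 'n cvec" where
  "hopf_lift r n1 n2 \<tau> p l = r *\<^sub>R
     ((- \<i> * of_real l * cnj (\<tau> p)) *\<^sub>C n1 (fst p) + (\<i> * (\<tau> p / of_real l)) *\<^sub>C n2 (snd p))"

section \<open>Properties of the connection\<close>

lemma cscale_simps [simp]:
  "fst (c *\<^sub>C v) = c * fst v" "snd (c *\<^sub>C v) $ k = c * snd v $ k"
  by (simp_all add: cscale_def)

lemma cvec_eqI: "fst v = fst w \<Longrightarrow> (\<And>k. snd v $ k = snd w $ k) \<Longrightarrow> v = (w :: 'n::finite cvec)"
  by (simp add: prod_eq_iff vec_eq_iff)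

lemma herm_add: "herm (u + v) w = herm u w + herm v w" "herm u (v + w) = herm u v + herm u w"
  by (simp_all add: herm_def algebra_simps sum.distrib)

lemma herm_diff: "herm (u - v) w = herm u w - herm v w" "herm u (v - w) = herm u v - herm u w"
  by (simp_all add: herm_def algebra_simps sum_subtractf)

lemma herm_cscale: "herm (c *\<^sub>C u) w = cnj c * herm u w" "herm u (c *\<^sub>C w) = c * herm u w"
  by (simp_all add: herm_def algebra_simps sum_distrib_left)

lemma herm_scaleR: "herm (c *\<^sub>R u) w = of_real c * herm u w" "herm u (c *\<^sub>R w) = of_real c * herm u w"
  by (simp_all add: herm_def algebra_simps sum_distrib_left scaleR_conv_of_real[where 'a=complex])

lemma cnj_herm: "cnj (herm u w) = herm w u"
  by (simp add: herm_def mult.commute)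

lemma cscale_assoc: "a *\<^sub>C b *\<^sub>C v = (a * b) *\<^sub>C v"
  by (rule cvec_eqI) simp_all

lemma cscale_distrib: "a *\<^sub>C (v + w) = a *\<^sub>C v + a *\<^sub>C w" "(a + b) *\<^sub>C v = a *\<^sub>C v + b *\<^sub>C v"
  "a *\<^sub>C (v - w) = a *\<^sub>C v - a *\<^sub>C w" "(a - b) *\<^sub>C v = a *\<^sub>C v - b *\<^sub>C v"
  by (rule cvec_eqI; simp add: algebra_simps)+

lemma herm_Q: "z \<in> Q r \<Longrightarrow> herm z z = - of_real (r ^ 2)"
  using cnj_herm[of z z] by (auto simp: Q_def ip_def complex_eq_iff)

lemma cov_gauge:
  assumes "z \<in> Q r" "r > 0"
  shows "cov r (cis \<theta> *\<^sub>C z) (cis \<theta> *\<^sub>C (dz + (of_real b * \<i>) *\<^sub>C z))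
             (cis \<theta> *\<^sub>C v) (cis \<theta> *\<^sub>C (dv + (of_real b * \<i>) *\<^sub>C v))
         = cis \<theta> *\<^sub>C cov r z dz v dv"
proof -
  have c: "cnj (cis \<theta>) * (cis \<theta> * x) = x" for x
    by (simp add: cis_cnj cis_mult flip: mult.assoc)
  let ?a = "- ip (\<i> *\<^sub>C z) dz / r ^ 2"
  have a: "- ip (\<i> *\<^sub>C (cis \<theta> *\<^sub>C z)) (cis \<theta> *\<^sub>C (dz + (of_real b * \<i>) *\<^sub>C z)) / r ^ 2 = ?a + b"
  proof -
    have *: "ip (\<i> *\<^sub>C (cis \<theta> *\<^sub>C z)) (cis \<theta> *\<^sub>C w) = Im (herm z w)" for w
    proof -
      have "herm (\<i> *\<^sub>C (cis \<theta> *\<^sub>C z)) (cis \<theta> *\<^sub>C w) = - \<i> * (cnj (cis \<theta>) * (cis \<theta> * herm z w))"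
        by (simp only: herm_cscale complex_cnj_i mult_ac)
      then show ?thesis
        by (simp only: c ip_def) simp
    qed
    show ?thesis
      unfolding * using assms by (simp add: ip_def herm_cscale herm_add herm_Q field_simps)
  qed
  have "herm (cis \<theta> *\<^sub>C z) (cis \<theta> *\<^sub>C w) = herm z w" for w
  proof -
    have "herm (cis \<theta> *\<^sub>C z) (cis \<theta> *\<^sub>C w) = cnj (cis \<theta>) * (cis \<theta> * herm z w)"
      by (simp only: herm_cscale mult_ac)
    then show ?thesis
      by (simp only: c)
  qed
  then have "hor r (cis \<theta> *\<^sub>C z) (cis \<theta> *\<^sub>C w) = cis \<theta> *\<^sub>C hor r z w" for w
    by (simp add: hor_def cscale_distrib cscale_assoc mult.commute)
  moreover have "cis \<theta> *\<^sub>C (dv + (of_real b * \<i>) *\<^sub>C v) - (of_real (?a + b) * \<i>) *\<^sub>C (cis \<theta> *\<^sub>C v)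
      = cis \<theta> *\<^sub>C (dv - (of_real ?a * \<i>) *\<^sub>C v)"
    by (rule cvec_eqI) (simp_all add: algebra_simps)
  ultimately show ?thesis
    unfolding cov_def Let_def a by simp
qed

lemma cov_metric:
  assumes "herm z v = 0" "herm z w = 0"
  shows "ip dv w + ip v dw = ip (cov r z dz v dv) w + ip v (cov r z dz w dw)"
proof -
  have "herm v z = 0" "herm w z = 0"
    using assms cnj_herm by (metis complex_cnj_zero)+
  then show ?thesis
    using assms
    by (simp add: ip_def cov_def Let_def hor_def herm_add herm_diff herm_cscale)
qed

lemma bounded_bilinear_cscale: "bounded_bilinear ((*\<^sub>C) :: complex \<Rightarrow> 'n::finite cvec \<Rightarrow> _)"
proof (rule bilinear_conv_bounded_bilinear[THEN iffD1])
  show "bilinear ((*\<^sub>C) :: complex \<Rightarrow> 'n::finite cvec \<Rightarrow> _)"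
    by (auto simp: bilinear_def intro!: linearI cvec_eqI simp: algebra_simps)
qed

lemma bounded_bilinear_herm: "bounded_bilinear (herm :: 'n::finite cvec \<Rightarrow> _)"
proof (rule bilinear_conv_bounded_bilinear[THEN iffD1])
  show "bilinear (herm :: 'n::finite cvec \<Rightarrow> _)"
    unfolding bilinear_def
    by (intro conjI allI linearI) (simp_all only: herm_add herm_scaleR scaleR_conv_of_real)
qed

text \<open>
  For a map \<open>z\<close> of two real variables \<open>s, t\<close> into \<open>Q\<close> with partial derivatives \<open>zs\<close>, \<open>zt\<close> and mixed
  second derivative \<open>m\<close>: the covariant \<open>t\<close>-derivative of the projection of \<open>zs\<close> is the covariant
  \<open>s\<close>-derivative of the projection of \<open>zt\<close>.
\<close>

lemma cov_torsion_free:
  fixes z zs zt :: "real \<Rightarrow> real \<Rightarrow> 'n::finite cvec"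
  assumes "z s t \<in> Q r" "r > 0"
    and "((\<lambda>s. z s t) has_vector_derivative zs s t) (at s)"
    and "((\<lambda>t. z s t) has_vector_derivative zt s t) (at t)"
    and "((\<lambda>t. zs s t) has_vector_derivative m) (at t)"
    and "((\<lambda>s. zt s t) has_vector_derivative m) (at s)"
    and ds: "((\<lambda>t. hor r (z s t) (zs s t)) has_vector_derivative ds) (at t)"
    and dt: "((\<lambda>s. hor r (z s t) (zt s t)) has_vector_derivative dt) (at s)"
    and tan: "ip (z s t) (zs s t) = 0" "ip (z s t) (zt s t) = 0"
  shows "cov r (z s t) (zt s t) (hor r (z s t) (zs s t)) ds
       = cov r (z s t) (zs s t) (hor r (z s t) (zt s t)) dt"
proof -
  note d = has_vector_derivative_add bounded_bilinear.has_vector_derivative[OF bounded_bilinear_cscale]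
    bounded_bilinear.has_vector_derivative[OF bounded_bilinear_herm]
    has_vector_derivative_divide
  let ?z = "z s t" let ?u = "zs s t" let ?v = "zt s t"
  let ?q = "complex_of_real (r ^ 2)"
  have ds': "ds = m + ((herm ?z ?u / ?q) *\<^sub>C ?v + ((herm ?z m + herm ?v ?u) / ?q) *\<^sub>C ?z)"
    by (rule vector_derivative_unique_at[OF ds], unfold hor_def, intro d assms)
  have dt': "dt = m + ((herm ?z ?v / ?q) *\<^sub>C ?u + ((herm ?z m + herm ?u ?v) / ?q) *\<^sub>C ?z)"
    by (rule vector_derivative_unique_at[OF dt], unfold hor_def, intro d assms)
  define a where "a = - ip (\<i> *\<^sub>C ?z) ?u / r ^ 2"
  define b where "b = - ip (\<i> *\<^sub>C ?z) ?v / r ^ 2"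
  have q: "?q \<noteq> 0" using \<open>r > 0\<close> by simp
  have hu: "herm ?z ?u / ?q = - of_real a * \<i>" and hv: "herm ?z ?v / ?q = - of_real b * \<i>"
    using tan q by (simp_all add: a_def b_def ip_def herm_cscale complex_eq_iff)
  have hor_z: "hor r ?z (c *\<^sub>C ?z) = 0" for c
    using q by (simp add: hor_def herm_cscale herm_Q[OF assms(1)] cscale_assoc flip: cscale_distrib)
       (simp add: cscale_def zero_prod_def)
  have hor_add: "hor r ?z (x + y) = hor r ?z x + hor r ?z y" for x y
    by (simp add: hor_def herm_add add_divide_distrib cscale_distrib)
  let ?w = "m - ((of_real a * \<i>) *\<^sub>C ?v + (of_real b * \<i>) *\<^sub>C ?u)"
  have 1: "ds - (of_real b * \<i>) *\<^sub>C hor r ?z ?u =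
      ?w + ((herm ?z m + herm ?v ?u) / ?q - of_real a * of_real b) *\<^sub>C ?z"
    unfolding ds' hor_def hu by (rule cvec_eqI) (simp_all add: algebra_simps)
  have 2: "dt - (of_real a * \<i>) *\<^sub>C hor r ?z ?v =
      ?w + ((herm ?z m + herm ?u ?v) / ?q - of_real a * of_real b) *\<^sub>C ?z"
    unfolding dt' hor_def hv by (rule cvec_eqI) (simp_all add: algebra_simps)
  show ?thesis
    unfolding cov_def Let_def a_def[symmetric] b_def[symmetric] 1 2 hor_add hor_z by simp
qed

end

theory Submission
  imports Defs
begin

text \<open>
  An adapted frame \<open>g\<close> at \<open>z\<close> amounts to a unitary basis consisting of \<open>z\<close> and the vectors
  \<open>e\<^sub>1, e\<^sub>3, \<dots>, e\<^sub>2\<^sub>n\<^sub>-\<^sub>1\<close>.  Write \<open>u = e\<^sub>2\<^sub>n\<^sub>-\<^sub>1\<close> and \<open>c = sin \<phi> + s \<i> cos \<phi>\<close>, so that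
  \<open>gvec g = (\<i>/r) z - c u\<close> is a null vector.  The forms of the Pfaffian system with sign \<open>s\<close> are the
  components of the derivative of \<open>gvec\<close> transversal to the complex line of \<open>gvec\<close>
  (\<open>annihilated_iff\<close>).  Hence a curve of frames is integral iff this null line is constant along it
  (\<open>integral_curve_iff\<close>), and since the stabiliser of a null line in the unitary group is path
  connected, frames with the same null line are joined by an integral curve (\<open>reach_iff\<close>).  So
  leaves are the same thing as null lines (\<open>leaf_eq_iff\<close>).

  A frame thus gives two null lines, one for each sign.  They have representatives \<open>N1\<close>, \<open>N2\<close> with
  Hermitian product \<open>e\<^sup>-\<^sup>\<i>\<^sup>\<phi> / (2 cos \<phi>)\<close>, and linear algebra recovers
  \<open>z = \<i> r (N2 - N1)\<close> and \<open>u = \<i> (e\<^sup>-\<^sup>\<i>\<^sup>\<phi> N1 + e\<^sup>\<i>\<^sup>\<phi> N2)\<close>; conversely every such pair of null vectors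
  comes from a frame (\<open>Zvec_Uvec_unitary\<close>, \<open>null_pair_of_frame\<close>).  The only freedom is to replace
  \<open>N1, N2\<close> by \<open>A N1, N2 / cnj A\<close>.  The phase of \<open>A\<close> is forgotten by the Hopf fibration, and its
  modulus is the parameter of the map in the theorem, in which \<open>\<tau>\<close> gives the chosen lifts the right
  product.  This proves that the map takes values in \<open>Q\<close> and has the stated image
  (\<open>hopf_lift_image\<close>).

  Near a point of \<open>R\<close>, charts of \<open>N\<^sub>1\<close> and \<open>N\<^sub>2\<close> and the modulus \<open>l\<close> are \<open>2n - 1\<close> real parameters for
  \<open>z\<close>.  If the wedge product does not vanish then tangent vectors of \<open>R\<close> project onto a space of
  this dimension, so that the derivative of the projected map is injective (\<open>immersion_of_wedge\<close>), and
  the map is locally an embedding (\<open>immersion_lower_bound\<close>).  The Legendrian condition says that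
  the null representatives are orthogonal to their own derivatives; with the constancy of their
  product this implies that \<open>\<i> u\<close> is normal to the image (\<open>Uvec_normal\<close>).  Finally, when only \<open>l\<close>
  varies, \<open>z\<close> and \<open>u\<close> move within a fixed complex plane, and the projected curve has the direction
  \<open>u\<close>.  Therefore \<open>u\<close> is a principal direction, and its principal curvature comes out as
  \<open>(2/r) sin \<phi>\<close> (\<open>hopf_direction\<close>).
\<close>

section \<open>Hermitian algebra in hyperbolic space\<close>

lemma cscale_triv [simp]:
  "1 *\<^sub>C v = v" "0 *\<^sub>C v = 0" "c *\<^sub>C (0 :: 'n::finite cvec) = 0" "(-c) *\<^sub>C v = - (c *\<^sub>C v)" "c *\<^sub>C (- v) = - (c *\<^sub>C v)"
  by (rule cvec_eqI; simp)+

lemma cscale_of_real: "of_real x *\<^sub>C v = x *\<^sub>R v"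
  by (rule cvec_eqI) (simp_all add: scaleR_conv_of_real[where 'a=complex])

lemma herm_simps [simp]:
  "herm 0 v = 0" "herm v 0 = 0" "herm (- u) v = - herm u v" "herm u (- v) = - herm u v"
  by (simp_all add: herm_def sum_negf)

lemma herm_sum: "herm v (\<Sum>k\<in>A. f k) = (\<Sum>k\<in>A. herm v (f k))"
  by (induction A rule: infinite_finite_induct) (simp_all add: herm_add)

lemma herm_sym_zero: "herm u v = 0 \<longleftrightarrow> herm v u = 0"
  using cnj_herm by (metis complex_cnj_zero)

lemma herm_self: "herm v v = of_real (ip v v)"
  using cnj_herm[of v v] by (auto simp: ip_def complex_eq_iff)

lemma herm_self_diff: "herm (p - q) (p - q) = herm p p + herm q q - of_real (2 * Re (herm q p))"
  using cnj_herm[of q p] by (simp add: herm_diff complex_eq_iff)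

lemma Q_iff: "z \<in> Q r \<longleftrightarrow> herm z z = - of_real (r ^ 2)"
  using herm_Q[of z r] by (auto simp: Q_def ip_def)

lemma null_cone_iff: "v \<in> null_cone \<longleftrightarrow> v \<noteq> 0 \<and> herm v v = 0"
  by (simp add: null_cone_def herm_self)

lemma herm_spacelike: "fst y = 0 \<Longrightarrow> herm y y = of_real (\<Sum>k\<in>UNIV. (cmod (snd y $ k))\<^sup>2)"
  by (simp only: herm_def of_real_sum) (simp add: complex_mult_cnj cmod_power2 mult.commute)

text \<open>
  Subtracting the multiple of \<open>g\<close> that kills the time coordinate of \<open>x\<close> turns \<open>herm x x\<close> into a sum
  of squares; this is the reversed Cauchy-Schwarz inequality, and it covers both time-like and null
  \<open>g\<close>.
\<close>

lemma herm_orth_nonneg: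
  assumes g: "fst g \<noteq> 0" "herm g g = - of_real q" "q \<ge> 0" and x: "herm g x = 0"
  obtains p where "p \<ge> 0" "herm x x = of_real p"
    "p = 0 \<longrightarrow> x = (fst x / fst g) *\<^sub>C g \<and> (q > 0 \<longrightarrow> x = 0)"
proof -
  define c where "c = fst x / fst g"
  define y where "y = x - c *\<^sub>C g"
  have xy: "x = y + c *\<^sub>C g" by (simp add: y_def)
  have "fst y = 0" using g by (simp add: y_def c_def)
  define S where "S = (\<Sum>k\<in>UNIV. (cmod (snd y $ k))\<^sup>2)"
  have yy: "herm y y = of_real S" unfolding S_def by (rule herm_spacelike) fact
  have "S \<ge> 0" by (simp add: S_def sum_nonneg)
  have gy: "herm g y = c * of_real q" using x g by (simp add: y_def herm_diff herm_cscale)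
  then have yg: "herm y g = cnj c * of_real q" using cnj_herm[of g y] by simp
  have "herm x x = of_real (S + q * (cmod c)\<^sup>2)"
  proof -
    have cc: "of_real ((cmod c)\<^sup>2) = c * cnj c" by (rule complex_norm_square)
    show ?thesis
      unfolding xy of_real_add of_real_mult cc by (simp add: herm_add herm_cscale yy gy yg g algebra_simps)
  qed
  moreover have "x = c *\<^sub>C g \<and> (q > 0 \<longrightarrow> x = 0)" if "S + q * (cmod c)\<^sup>2 = 0"
  proof -
    have "q * (cmod c)\<^sup>2 \<ge> 0" using g by simp
    then have "S = 0" "q * (cmod c)\<^sup>2 = 0" using \<open>S \<ge> 0\<close> that by linarith+
    then have "\<forall>k. snd y $ k = 0"
      unfolding S_def by (subst (asm) sum_nonneg_eq_0_iff) auto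
    then have "y = 0" using \<open>fst y = 0\<close> by (intro cvec_eqI) auto
    then show ?thesis using xy \<open>q * (cmod c)\<^sup>2 = 0\<close> by auto
  qed
  ultimately show thesis
    using that[of "S + q * (cmod c)\<^sup>2"] \<open>S \<ge> 0\<close> g(3) unfolding c_def[symmetric] by auto
qed

lemma null_fst: "herm v v = 0 \<Longrightarrow> v \<noteq> 0 \<Longrightarrow> fst v \<noteq> 0"
proof
  assume v: "herm v v = 0" "v \<noteq> 0" "fst v = 0"
  then have "(\<Sum>k\<in>UNIV. (cmod (snd v $ k))\<^sup>2) = 0"
    using herm_spacelike[of v] by (metis of_real_eq_0_iff)
  then have "\<forall>k. snd v $ k = 0" by (subst (asm) sum_nonneg_eq_0_iff) auto
  then show False using v by (auto simp: prod_eq_iff vec_eq_iff)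
qed

lemma Q_fst:
  assumes "z \<in> Q r" "r > 0"
  shows "fst z \<noteq> 0" and "cmod (fst z) \<ge> r" and "cmod (fst z) = r \<Longrightarrow> snd z = 0"
proof -
  define S where "S = (\<Sum>k\<in>UNIV. (cmod (snd z $ k))\<^sup>2)"
  have "herm z z = of_real (S - (cmod (fst z))\<^sup>2)"
  proof -
    have cc: "of_real ((cmod (fst z))\<^sup>2) = fst z * cnj (fst z)" by (rule complex_norm_square)
    show ?thesis
      using herm_spacelike[of "(0, snd z)"] unfolding of_real_diff cc by (simp add: herm_def S_def mult.commute)
  qed
  then have "complex_of_real (S - (cmod (fst z))\<^sup>2) = of_real (- (r^2))" using herm_Q[OF assms(1)] by simp
  then have S: "(cmod (fst z))\<^sup>2 = S + r^2" by (simp only: of_real_eq_iff)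
  have "S \<ge> 0" by (simp add: S_def sum_nonneg)
  then show ge: "cmod (fst z) \<ge> r" using S assms by (auto intro: power2_le_imp_le[OF _ norm_ge_zero])
  then show "fst z \<noteq> 0" using assms by auto
  show "snd z = 0" if "cmod (fst z) = r"
  proof -
    have "S = 0" using S that by simp
    then have "\<forall>k. snd z $ k = 0" unfolding S_def by (subst (asm) sum_nonneg_eq_0_iff) auto
    then show ?thesis by (simp add: vec_eq_iff)
  qed
qed

text \<open>
  Points of the unit ball (for the complex hyperbolic space) and of its boundary sphere (for the
  null lines): the affine chart of projective space in which the time coordinate is 1.
\<close>

definition dehom :: "'n::finite cvec \<Rightarrow> 'n cvec" where
  "dehom v = inverse (fst v) *\<^sub>C v"

lemma fst_dehom [simp]: "fst v \<noteq> 0 \<Longrightarrow> fst (dehom v) = 1"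
  by (simp add: dehom_def)

lemma dehom_cscale [simp]: "c \<noteq> 0 \<Longrightarrow> dehom (c *\<^sub>C v) = dehom v"
  by (simp add: dehom_def cscale_assoc field_simps)

lemma dehom_uminus [simp]: "dehom (- v) = dehom v"
  using dehom_cscale[of "-1" v] by (simp del: dehom_cscale)

lemma cscale_dehom: "fst v \<noteq> 0 \<Longrightarrow> fst v *\<^sub>C dehom v = v"
  by (simp add: dehom_def cscale_assoc)

lemma dehom_eq_iff:
  assumes "fst v \<noteq> 0" "fst w \<noteq> 0"
  shows "dehom v = dehom w \<longleftrightarrow> w = (fst w / fst v) *\<^sub>C v"
proof
  assume "dehom v = dehom w"
  then have "w = fst w *\<^sub>C dehom v" using cscale_dehom[OF assms(2)] by simp
  then show "w = (fst w / fst v) *\<^sub>C v"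
    by (simp add: dehom_def cscale_assoc divide_inverse)
next
  assume "w = (fst w / fst v) *\<^sub>C v"
  then show "dehom v = dehom w" using assms by (metis dehom_cscale divide_eq_0_iff)
qed

lemma cline_eq_iff:
  assumes "fst v \<noteq> 0" "fst w \<noteq> 0"
  shows "cline v = cline w \<longleftrightarrow> dehom v = dehom w"
proof
  assume "cline v = cline w"
  then have "w \<in> cline v" unfolding cline_def by (metis cscale_triv(1) rangeI)
  then obtain c where "w = c *\<^sub>C v" by (auto simp: cline_def)
  then show "dehom v = dehom w" using assms by auto
next
  assume d: "dehom v = dehom w"
  have l: "cline x = cline (dehom x)" if "fst x \<noteq> 0" for x :: "'a cvec"
  proof -
    have "c *\<^sub>C x = (c * fst x) *\<^sub>C dehom x" "c *\<^sub>C dehom x = (c / fst x) *\<^sub>C x" for c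
      using that by (simp_all add: dehom_def cscale_assoc field_simps)
    then have "c *\<^sub>C x \<in> cline (dehom x)" "c *\<^sub>C dehom x \<in> cline x" for c
      unfolding cline_def by (metis rangeI)+
    then show ?thesis unfolding cline_def by blast
  qed
  show "cline v = cline w" using l[OF assms(1)] l[OF assms(2)] d by simp
qed

lemma hopf_eq_iff:
  assumes "z \<in> Q r" "w \<in> Q r" "r > 0"
  shows "hopf z = hopf w \<longleftrightarrow> dehom z = dehom w" and "dehom z = dehom w \<longleftrightarrow> (\<exists>\<theta>. w = cis \<theta> *\<^sub>C z)"
proof -
  have 1: "(\<exists>\<theta>. w = cis \<theta> *\<^sub>C z)" if "hopf z = hopf w"
    using that unfolding hopf_def by (metis (mono_tags, lifting) UNIV_I cis_zero cscale_triv(1) imageE image_eqI)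
  have 2: "hopf z = hopf w" if ex: "(\<exists>\<theta>. w = cis \<theta> *\<^sub>C z)"
  proof -
    obtain \<theta> where w: "w = cis \<theta> *\<^sub>C z" using ex by blast
    have "cis t *\<^sub>C w = cis (t + \<theta>) *\<^sub>C z" "cis t *\<^sub>C z = cis (t - \<theta>) *\<^sub>C w" for t
      by (simp_all add: w cscale_assoc cis_mult)
    then have "cis t *\<^sub>C w \<in> hopf z" "cis t *\<^sub>C z \<in> hopf w" for t
      unfolding hopf_def by (metis rangeI)+
    then show ?thesis unfolding hopf_def by blast
  qed
  have 3: "dehom z = dehom w" if "(\<exists>\<theta>. w = cis \<theta> *\<^sub>C z)" using that by (auto simp: cis_neq_zero)
  have 4: "\<exists>\<theta>. w = cis \<theta> *\<^sub>C z" if d: "dehom z = dehom w"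
  proof -
    define c where "c = fst w / fst z"
    have w: "w = c *\<^sub>C z" using dehom_eq_iff Q_fst(1) assms d c_def by metis
    have "cnj c * c * of_real (r^2) = of_real (r^2)"
      using herm_Q[OF assms(2)] herm_Q[OF assms(1)] by (simp add: w herm_cscale mult.commute)
    then have "c * cnj c = 1" using assms by (simp add: mult.commute)
    then have "cmod c = 1" by (metis complex_norm_square norm_ge_zero of_real_eq_1_iff power2_eq_1_iff not_one_le_zero neg_0_le_iff_le zero_neq_neg_one neg_le_0_iff_le)
    then obtain \<theta> where "c = cis \<theta>" using rcis_cmod_Arg[of c] unfolding rcis_def by (metis mult_1 of_real_1)
    then show ?thesis using w by auto
  qed
  show "hopf z = hopf w \<longleftrightarrow> dehom z = dehom w" using 1 2 3 4 by blast
  show "dehom z = dehom w \<longleftrightarrow> (\<exists>\<theta>. w = cis \<theta> *\<^sub>C z)" using 3 4 by blast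
qed

section \<open>Adapted frames as unitary frames\<close>

lemma ip_eq_zero_iff: "herm v w = 0 \<longleftrightarrow> ip v w = 0 \<and> ip (\<i> *\<^sub>C v) w = 0"
  by (auto simp: ip_def herm_cscale complex_eq_iff)

lemma adapted_iff:
  fixes g :: "'n::finite aframe"
  assumes "r > 0"
  shows "g \<in> adapted_frames r \<longleftrightarrow> herm (fst g) (fst g) = - of_real (r ^ 2) \<and>
    (\<forall>k. herm (fst g) (snd g $ Inl k) = 0) \<and>
    (\<forall>k l. herm (snd g $ Inl k) (snd g $ Inl l) = of_bool (k = l)) \<and>
    (\<forall>k. snd g $ Inr k = \<i> *\<^sub>C (snd g $ Inl k))" (is "_ \<longleftrightarrow> ?R")
proof -
  have e0: "ip (e0 r g) v = 0 \<longleftrightarrow> ip (\<i> *\<^sub>C fst g) v = 0" for v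
    using assms by (simp add: e0_def ip_def herm_cscale)
  show ?thesis
  proof
    assume g: "g \<in> adapted_frames r"
    have inr: "snd g $ Inr k = \<i> *\<^sub>C (snd g $ Inl k)" for k using g by (simp add: adapted_frames_def)
    have o: "ip (snd g $ i) (snd g $ j) = (if i = j then 1 else 0)" for i j
      using g by (simp add: adapted_frames_def)
    have "herm (snd g $ Inl k) (snd g $ Inl l) = of_bool (k = l)" for k l
      using o[of "Inl k" "Inl l"] o[of "Inl k" "Inr l"] by (simp add: ip_def inr herm_cscale complex_eq_iff)
    then show ?R using g e0 by (auto simp: adapted_frames_def Q_iff ip_eq_zero_iff)
  next
    assume R: ?R
    have "ip (snd g $ i) (snd g $ j) = (if i = j then 1 else 0)" for i j
      using R by (cases i; cases j) (auto simp: ip_def herm_cscale)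
    moreover have "herm (fst g) (snd g $ j) = 0" for j using R by (cases j) (auto simp: herm_cscale)
    ultimately show "g \<in> adapted_frames r"
      using R e0 by (auto simp: adapted_frames_def Q_iff ip_eq_zero_iff)
  qed
qed

lemma adaptedD:
  assumes "g \<in> adapted_frames r" "r > 0"
  shows "fst g \<in> Q r" "herm (fst g) (fst g) = - of_real (r ^ 2)"
    "herm (fst g) (snd g $ Inl k) = 0" "herm (snd g $ Inl k) (fst g) = 0"
    "herm (snd g $ Inl k) (snd g $ Inl l) = of_bool (k = l)"
    "snd g $ Inr k = \<i> *\<^sub>C (snd g $ Inl k)"
  using assms adapted_iff[of r g] herm_sym_zero[of "fst g"] by (auto simp: Q_iff)

text \<open>
  An adapted frame is a basis: the coordinate map it defines preserves the Hermitian form up to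
  the factor \<open>r\<^sup>2\<close> in one coordinate, hence is injective, hence surjective.
\<close>

lemma frame_expansion:
  fixes g :: "'n::finite aframe"
  assumes "g \<in> adapted_frames r" "r > 0"
  shows "w = (- herm (fst g) w / of_real (r ^ 2)) *\<^sub>C fst g + (\<Sum>k\<in>UNIV. herm (snd g $ Inl k) w *\<^sub>C (snd g $ Inl k))"
proof -
  note a = adaptedD[OF assms]
  define \<Phi> where "\<Phi> v = fst v *\<^sub>C fst g + (\<Sum>k\<in>UNIV. snd v $ k *\<^sub>C (snd g $ Inl k))" for v :: "'n cvec"
  have z: "herm (fst g) (\<Phi> v) = - fst v * of_real (r^2)" for v
    by (simp add: \<Phi>_def herm_add herm_cscale herm_sum a del: of_real_power)
  have e: "herm (snd g $ Inl k) (\<Phi> v) = snd v $ k" for v k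
    by (simp add: \<Phi>_def herm_add herm_cscale herm_sum a of_bool_def if_distrib cong: if_cong)
  have "linear \<Phi>"
  proof (rule linearI)
    show "\<Phi> (v + w) = \<Phi> v + \<Phi> w" for v w
      by (simp add: \<Phi>_def cscale_distrib sum.distrib)
    have "(x *\<^sub>R c) *\<^sub>C v = x *\<^sub>R (c *\<^sub>C v)" for x c and v :: "'n cvec"
      by (rule cvec_eqI) simp_all
    then show "\<Phi> (x *\<^sub>R v) = x *\<^sub>R \<Phi> v" for x v
      by (simp add: \<Phi>_def scaleR_add_right scaleR_sum_right)
  qed
  moreover have "inj \<Phi>"
  proof (rule injI)
    fix v w assume "\<Phi> v = \<Phi> w"
    then show "v = w" using z[of v] z[of w] e[of _ v] e[of _ w] assms(2) by (intro cvec_eqI) (metis mult_cancel_right neg_equal_iff_equal mult_minus_left of_real_eq_0_iff power_not_zero less_irrefl)+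
  qed
  ultimately have "surj \<Phi>" by (rule linear_inj_imp_surj)
  then obtain v where v: "w = \<Phi> v" by blast
  show ?thesis
    unfolding v z e using assms(2) by (simp add: \<Phi>_def del: of_real_power)
qed

section \<open>The map into the null cone\<close>

text \<open>The coefficient \<open>c\<close> in \<open>gvec g = (\<i>/r) z - c u\<close>.\<close>

definition gcoef :: "real \<Rightarrow> real \<Rightarrow> complex" where
  "gcoef \<phi> s = Complex (sin \<phi>) (s * cos \<phi>)"

lemma gcoef_unit: "s\<^sup>2 = 1 \<Longrightarrow> cnj (gcoef \<phi> s) * gcoef \<phi> s = 1"
proof -
  assume s: "s\<^sup>2 = 1"
  have "(sin \<phi>)\<^sup>2 + (s * cos \<phi>)\<^sup>2 = 1" by (simp add: power_mult_distrib s)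
  then show ?thesis by (simp add: gcoef_def complex_eq_iff power2_eq_square)
qed

lemma gvec_eq:
  assumes "\<And>k. snd g $ Inr k = \<i> *\<^sub>C (snd g $ Inl k)"
  shows "gvec r \<phi> s g = (\<i> / of_real r) *\<^sub>C fst g - gcoef \<phi> s *\<^sub>C (snd g $ Inl last_index)"
  unfolding gvec_def e0_def assms
  by (rule cvec_eqI) (simp_all add: gcoef_def complex_eq_iff algebra_simps)

lemma linear_gvec: "linear (gvec r \<phi> s)"
  by (rule linearI; rule cvec_eqI) (simp_all add: gvec_def e0_def algebra_simps)

lemma bounded_linear_gvec: "bounded_linear (gvec r \<phi> s :: 'n::{finite,linorder} aframe \<Rightarrow> _)"
  using linear_gvec linear_conv_bounded_linear by blast

lemma gvec_adapted:
  assumes "g \<in> adapted_frames r" "r > 0"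
  shows "gvec r \<phi> s g = (\<i> / of_real r) *\<^sub>C fst g - gcoef \<phi> s *\<^sub>C (snd g $ Inl last_index)"
  using assms by (intro gvec_eq adaptedD(6))

lemma herm_gvec:
  fixes g :: "'n::{finite,linorder} aframe"
  assumes g: "g \<in> adapted_frames r" "r > 0"
  shows "herm (fst g) (gvec r \<phi> s g) = - \<i> * of_real r"
    and "herm (snd g $ Inl last_index) (gvec r \<phi> s g) = - gcoef \<phi> s"
    and "k \<noteq> last_index \<Longrightarrow> herm (snd g $ Inl k) (gvec r \<phi> s g) = 0"
    and "s\<^sup>2 = 1 \<Longrightarrow> herm (gvec r \<phi> s g) (gvec r \<phi> s g) = 0"
    and "s\<^sup>2 = 1 \<Longrightarrow> fst (gvec r \<phi> s g) \<noteq> 0"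
proof -
  note a = adaptedD[OF g] and e = gvec_adapted[OF g]
  show 1: "herm (fst g) (gvec r \<phi> s g) = - \<i> * of_real r"
    using g(2) by (simp add: e herm_diff herm_cscale a power2_eq_square)
  show "herm (snd g $ Inl last_index) (gvec r \<phi> s g) = - gcoef \<phi> s"
    and "k \<noteq> last_index \<Longrightarrow> herm (snd g $ Inl k) (gvec r \<phi> s g) = 0"
    by (simp_all add: e herm_diff herm_cscale a)
  show 2: "herm (gvec r \<phi> s g) (gvec r \<phi> s g) = 0" if "s\<^sup>2 = 1"
    using g(2) gcoef_unit[OF that] by (simp add: e herm_diff herm_cscale a power2_eq_square mult.commute)
  have "gvec r \<phi> s g \<noteq> 0" using 1 g(2) by (metis herm_simps(2) complex_i_not_zero mult_eq_0_iff neg_equal_0_iff_equal of_real_eq_0_iff less_irrefl)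
  then show "fst (gvec r \<phi> s g) \<noteq> 0" if "s\<^sup>2 = 1" using 2 that null_fst by blast
qed

text \<open>The vectors \<open>X\<close> that satisfy the linearised equations of an adapted frame at \<open>g\<close>.\<close>

definition inf_frame :: "'n::finite aframe \<Rightarrow> 'n aframe \<Rightarrow> bool" where
  "inf_frame g X \<longleftrightarrow>
     herm (fst g) (fst X) + herm (fst X) (fst g) = 0 \<and>
     (\<forall>k. herm (fst g) (snd X $ Inl k) + herm (fst X) (snd g $ Inl k) = 0) \<and>
     (\<forall>k l. herm (snd g $ Inl k) (snd X $ Inl l) + herm (snd X $ Inl k) (snd g $ Inl l) = 0) \<and>
     (\<forall>k. snd X $ Inr k = \<i> *\<^sub>C (snd X $ Inl k))"

lemma const_derivative:
  assumes "(f has_vector_derivative d) (at t)" "open S" "t \<in> S" "\<And>x. x \<in> S \<Longrightarrow> f x = k"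
  shows "d = 0"
proof -
  have "((\<lambda>x. k) has_vector_derivative d) (at t)"
    by (rule has_vector_derivative_transform_within_open[OF assms(1-3)]) (use assms(4) in auto)
  then show ?thesis using vector_derivative_unique_at[OF _ has_vector_derivative_const] by blast
qed

lemma inf_frame_of_curve:
  fixes c :: "real \<Rightarrow> 'n::finite aframe"
  assumes r: "r > 0" and d: "(c has_vector_derivative X) (at t)"
    and S: "open S" "t \<in> S" "\<And>x. x \<in> S \<Longrightarrow> c x \<in> adapted_frames r"
  shows "inf_frame (c t) X"
proof -
  have z: "((\<lambda>x. fst (c x)) has_vector_derivative fst X) (at t)"
    using bounded_linear.has_vector_derivative[OF bounded_linear_fst d] .
  have e: "((\<lambda>x. snd (c x) $ j) has_vector_derivative snd X $ j) (at t)" for j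
    using bounded_linear.has_vector_derivative[OF bounded_linear_vec_nth bounded_linear.has_vector_derivative[OF bounded_linear_snd d]] .
  note h = bounded_bilinear.has_vector_derivative[OF bounded_bilinear_herm]
  note a = adaptedD[OF S(3) r]
  have "herm (fst (c t)) (fst X) + herm (fst X) (fst (c t)) = 0"
    by (rule const_derivative[OF h[OF z z] S(1,2)]) (rule a)
  moreover have "herm (fst (c t)) (snd X $ Inl k) + herm (fst X) (snd (c t) $ Inl k) = 0" for k
    by (rule const_derivative[OF h[OF z e] S(1,2)]) (rule a)
  moreover have "herm (snd (c t) $ Inl k) (snd X $ Inl l) + herm (snd X $ Inl k) (snd (c t) $ Inl l) = 0" for k l
    by (rule const_derivative[OF h[OF e e] S(1,2)]) (rule a)
  moreover have "snd X $ Inr k = \<i> *\<^sub>C (snd X $ Inl k)" for k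
  proof -
    have "((\<lambda>x. snd (c x) $ Inr k - \<i> *\<^sub>C (snd (c x) $ Inl k)) has_vector_derivative
        snd X $ Inr k - \<i> *\<^sub>C (snd X $ Inl k)) (at t)"
      by (intro has_vector_derivative_diff e
        bounded_linear.has_vector_derivative[OF bounded_bilinear.bounded_linear_right[OF bounded_bilinear_cscale]])
    then have "snd X $ Inr k - \<i> *\<^sub>C (snd X $ Inl k) = 0"
      by (rule const_derivative[OF _ S(1,2)]) (simp add: a(6))
    then show ?thesis by simp
  qed
  ultimately show ?thesis by (simp add: inf_frame_def)
qed

lemma hor_pairing: "herm z v = 0 \<Longrightarrow> ip v (hor r z w) = Re (herm v w)"
  using herm_sym_zero[of z v] by (simp add: ip_def hor_def herm_add herm_cscale)

context
  fixes r \<phi> s :: real and g X :: "'n::{finite,linorder} aframe"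
  assumes r: "r > 0" and g: "g \<in> adapted_frames r" and X: "inf_frame g X"
begin

lemma omega_eq: "omega r (Inl k) g X = Re (herm (snd g $ Inl k) (fst X))"
  "omega r (Inr k) g X = Im (herm (snd g $ Inl k) (fst X))"
  using adaptedD[OF g r] by (simp_all add: omega_def hor_pairing herm_cscale)

lemma conn_eq: "conn r (Inr last_index) j g X = Im (herm (snd g $ Inl last_index) (snd X $ j)) +
   Im (herm (fst g) (fst X)) / r\<^sup>2 * Re (herm (snd g $ Inl last_index) (snd g $ j))"
proof -
  note a = adaptedD[OF g r]
  define t where "t = - Im (herm (fst g) (fst X)) / r\<^sup>2"
  have "ip (\<i> *\<^sub>C fst g) (fst X) = Im (herm (fst g) (fst X))"
    by (simp add: ip_def herm_cscale)
  then have "conn r (Inr last_index) j g X = ip (snd g $ Inr last_index) (hor r (fst g) (snd X $ j - (of_real t * \<i>) *\<^sub>C (snd g $ j)))"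
    by (simp only: conn_def cov_def Let_def t_def)
  also have "\<dots> = Re (herm (snd g $ Inr last_index) (snd X $ j - (of_real t * \<i>) *\<^sub>C (snd g $ j)))"
    by (rule hor_pairing) (simp add: a herm_cscale)
  also have "\<dots> = Im (herm (snd g $ Inl last_index) (snd X $ j)) - t * Re (herm (snd g $ Inl last_index) (snd g $ j))"
    by (simp add: a(6) herm_cscale herm_diff algebra_simps)
  finally show ?thesis by (simp add: t_def)
qed

text \<open>
  In terms of the vector \<open>gvec\<close>, the forms of the Pfaffian systems say that its derivative is
  Hermitian orthogonal to \<open>gvec\<close> itself and to all frame vectors except \<open>e\<^sub>2\<^sub>n\<^sub>-\<^sub>1\<close> and \<open>e\<^sub>2\<^sub>n\<close>.
\<close>

lemma kappa0_eq:
  assumes s: "s\<^sup>2 = 1"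
  shows "herm (gvec r \<phi> s g) (gvec r \<phi> s X) = \<i> * of_real (kappa0 r \<phi> s g X)"
proof -
  define p where "p = herm (snd g $ Inl last_index) (fst X)"
  define c where "c = gcoef \<phi> s"
  have zu: "herm (fst g) (snd X $ Inl last_index) = - cnj p"
    using X unfolding inf_frame_def p_def cnj_herm by (metis add_eq_0_iff2)
  have zz: "Re (herm (fst g) (fst X)) = 0"
  proof -
    have "herm (fst g) (fst X) + cnj (herm (fst g) (fst X)) = 0" using X unfolding inf_frame_def cnj_herm by blast
    then show ?thesis by (simp add: complex_eq_iff)
  qed
  have uu: "Re (herm (snd g $ Inl last_index) (snd X $ Inl last_index)) = 0"
  proof -
    have "herm (snd g $ Inl last_index) (snd X $ Inl last_index) + cnj (herm (snd g $ Inl last_index) (snd X $ Inl last_index)) = 0"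
      using X unfolding inf_frame_def cnj_herm by blast
    then show ?thesis by (simp add: complex_eq_iff)
  qed
  have gX: "gvec r \<phi> s X = (\<i> / of_real r) *\<^sub>C fst X - c *\<^sub>C (snd X $ Inl last_index)"
    unfolding c_def using X by (intro gvec_eq) (simp add: inf_frame_def)
  have gg: "gvec r \<phi> s g = (\<i> / of_real r) *\<^sub>C fst g - c *\<^sub>C (snd g $ Inl last_index)"
    unfolding c_def by (rule gvec_adapted[OF g r])
  have k: "kappa0 r \<phi> s g X = Im (herm (snd g $ Inl last_index) (snd X $ Inl last_index)) + Im (herm (fst g) (fst X)) / r\<^sup>2
     - 2 / r * Re (cnj c * p)"
    using adaptedD[OF g r] by (simp add: kappa0_def conn_eq omega_eq c_def gcoef_def p_def herm_cscale)
  have "herm (gvec r \<phi> s g) (gvec r \<phi> s X) = herm (fst g) (fst X) / of_real (r\<^sup>2)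
      + herm (snd g $ Inl last_index) (snd X $ Inl last_index) - \<i> / of_real r * (c * cnj p + cnj c * p)"
  proof -
    have cc: "cnj c * c = 1" unfolding c_def by (rule gcoef_unit[OF s])
    have "herm (gvec r \<phi> s g) (gvec r \<phi> s X) = (cnj (\<i> / of_real r) * (\<i> / of_real r)) * herm (fst g) (fst X)
        + (cnj c * c) * herm (snd g $ Inl last_index) (snd X $ Inl last_index)
        + (cnj (\<i> / of_real r) * c * cnj p - \<i> / of_real r * (cnj c * p))"
      unfolding gg gX by (simp add: herm_diff herm_cscale zu algebra_simps flip: p_def)
    then show ?thesis unfolding cc using r by (simp add: field_simps power2_eq_square)
  qed
  moreover have "c * cnj p + cnj c * p = of_real (2 * Re (cnj c * p))" by (simp add: complex_eq_iff)
  ultimately show ?thesis unfolding k by (simp add: complex_eq_iff zz uu)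
qed

lemma kappa_eq:
  assumes k: "k \<noteq> last_index" and s: "s\<^sup>2 = 1"
  shows "kappa r \<phi> s (Inl k) g X = - Im (cnj (gcoef \<phi> s) * herm (snd g $ Inl k) (gvec r \<phi> s X))"
    and "kappa r \<phi> s (Inr k) g X = Re (cnj (gcoef \<phi> s) * herm (snd g $ Inl k) (gvec r \<phi> s X))"
proof -
  define q where "q = herm (snd g $ Inl k) (fst X)"
  define m where "m = herm (snd g $ Inl k) (snd X $ Inl last_index)"
  define c where "c = gcoef \<phi> s"
  have um: "herm (snd g $ Inl last_index) (snd X $ Inl k) = - cnj m"
    using X unfolding inf_frame_def m_def cnj_herm by (metis add_eq_0_iff2)
  have i: "snd X $ Inr k = \<i> *\<^sub>C (snd X $ Inl k)" "snd X $ Inr last_index = \<i> *\<^sub>C (snd X $ Inl last_index)"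
    using X by (auto simp: inf_frame_def)
  have gX: "gvec r \<phi> s X = (\<i> / of_real r) *\<^sub>C fst X - c *\<^sub>C (snd X $ Inl last_index)"
    unfolding c_def using X by (intro gvec_eq) (simp add: inf_frame_def)
  have cc: "cnj c * c = 1" unfolding c_def by (rule gcoef_unit[OF s])
  have h: "cnj c * herm (snd g $ Inl k) (gvec r \<phi> s X) = \<i> * (cnj c * q) / of_real r - m"
    unfolding gX by (simp add: herm_diff herm_cscale algebra_simps flip: q_def m_def) (simp add: cc cc[unfolded mult.commute[of "cnj c"]])
  show "kappa r \<phi> s (Inl k) g X = - Im (cnj (gcoef \<phi> s) * herm (snd g $ Inl k) (gvec r \<phi> s X))"
    using adaptedD[OF g r] k unfolding h[unfolded c_def]
    by (simp add: kappa_def conn_eq omega_eq omega_bar_def gcoef_def um flip: q_def)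
  show "kappa r \<phi> s (Inr k) g X = Re (cnj (gcoef \<phi> s) * herm (snd g $ Inl k) (gvec r \<phi> s X))"
    using adaptedD[OF g r] k unfolding h[unfolded c_def]
    by (simp add: kappa_def conn_eq omega_eq omega_bar_def gcoef_def um i herm_cscale algebra_simps diff_divide_distrib flip: q_def)
qed

text \<open>The orthogonal complement of the null vector \<open>gvec\<close> and of \<open>e\<^sub>1, \<dots>, e\<^sub>2\<^sub>n\<^sub>-\<^sub>2\<close> is the
  complex line of \<open>gvec\<close>.\<close>

lemma annihilated_iff:
  assumes s: "s\<^sup>2 = 1"
  shows "X \<in> annihilated r \<phi> s g \<longleftrightarrow> (\<exists>\<mu>. gvec r \<phi> s X = \<mu> *\<^sub>C gvec r \<phi> s g)"
proof -
  let ?u = "snd g $ Inl last_index"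
  define c where "c = gcoef \<phi> s"
  define w where "w = gvec r \<phi> s X"
  have cc: "cnj c * c = 1" unfolding c_def by (rule gcoef_unit[OF s])
  then have c0: "c \<noteq> 0" by auto
  have "X \<in> annihilated r \<phi> s g \<longleftrightarrow> kappa0 r \<phi> s g X = 0 \<and>
     (\<forall>k. k \<noteq> last_index \<longrightarrow> kappa r \<phi> s (Inl k) g X = 0 \<and> kappa r \<phi> s (Inr k) g X = 0)"
    unfolding annihilated_def
    by (auto split: sum.splits) (metis (full_types) sum.exhaust_sel sum.collapse)
  also have "\<dots> \<longleftrightarrow> herm (gvec r \<phi> s g) w = 0 \<and> (\<forall>k. k \<noteq> last_index \<longrightarrow> herm (snd g $ Inl k) w = 0)"
  proof -
    have "kappa r \<phi> s (Inl k) g X = 0 \<and> kappa r \<phi> s (Inr k) g X = 0 \<longleftrightarrow> herm (snd g $ Inl k) w = 0" if "k \<noteq> last_index" for k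
    proof -
      have "cnj c * herm (snd g $ Inl k) w = 0 \<longleftrightarrow> herm (snd g $ Inl k) w = 0" using c0 by simp
      then show ?thesis using kappa_eq[OF that s] by (auto simp: complex_eq_iff c_def w_def)
    qed
    moreover have "kappa0 r \<phi> s g X = 0 \<longleftrightarrow> herm (gvec r \<phi> s g) w = 0"
      using kappa0_eq[OF s] by (simp add: w_def)
    ultimately show ?thesis by blast
  qed
  also have "\<dots> \<longleftrightarrow> (\<exists>\<mu>. w = \<mu> *\<^sub>C gvec r \<phi> s g)"
  proof
    assume h: "herm (gvec r \<phi> s g) w = 0 \<and> (\<forall>k. k \<noteq> last_index \<longrightarrow> herm (snd g $ Inl k) w = 0)"
    define a where "a = - herm (fst g) w / of_real (r^2)"
    define b where "b = herm ?u w"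
    have "(\<Sum>k\<in>UNIV. herm (snd g $ Inl k) w *\<^sub>C (snd g $ Inl k)) = (\<Sum>k\<in>UNIV. if k = (last_index :: 'n) then b *\<^sub>C ?u else 0)"
      by (intro sum.cong) (use h in \<open>auto simp: b_def\<close>)
    then have w: "w = a *\<^sub>C fst g + b *\<^sub>C ?u"
      using frame_expansion[OF g r, of w] by (simp add: a_def)
    have "herm (gvec r \<phi> s g) w = \<i> * of_real r * a - cnj c * b"
      using cnj_herm[of "fst g" "gvec r \<phi> s g"] cnj_herm[of ?u "gvec r \<phi> s g"] herm_gvec(1,2)[OF g r, of \<phi> s]
      unfolding w by (simp add: herm_add herm_cscale c_def) (metis complex_cnj_minus mult.commute mult_minus_left add_uminus_conv_diff)
    then have "cnj c * b = \<i> * of_real r * a" using h by simp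
    then have "b = c * (\<i> * of_real r * a)" using cc by (metis mult.assoc mult.commute mult.right_neutral)
    then have "w = (a * of_real r / \<i>) *\<^sub>C gvec r \<phi> s g"
      unfolding w gvec_adapted[OF g r] c_def[symmetric] using r by (intro cvec_eqI) (simp_all add: field_simps)
    then show "\<exists>\<mu>. w = \<mu> *\<^sub>C gvec r \<phi> s g" ..
  next
    assume "\<exists>\<mu>. w = \<mu> *\<^sub>C gvec r \<phi> s g"
    then show "herm (gvec r \<phi> s g) w = 0 \<and> (\<forall>k. k \<noteq> last_index \<longrightarrow> herm (snd g $ Inl k) w = 0)"
      using herm_gvec(3,4)[OF g r] s by (auto simp: herm_cscale)
  qed
  finally show ?thesis by (simp add: w_def)
qed

end

section \<open>Derivative of the affine chart\<close>

definition ddehom :: "'n::finite cvec \<Rightarrow> 'n cvec \<Rightarrow> 'n cvec" where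
  "ddehom v w = inverse (fst v) *\<^sub>C w - (inverse (fst v) * fst w * inverse (fst v)) *\<^sub>C v"

lemma has_derivative_dehom:
  assumes "fst v \<noteq> 0"
  shows "(dehom has_derivative ddehom v) (at v)"
proof -
  have "((\<lambda>v. inverse (fst v)) has_derivative (\<lambda>w. - (inverse (fst v) * fst w * inverse (fst v)))) (at v)"
    by (rule Deriv.has_derivative_inverse[OF assms bounded_linear_imp_has_derivative[OF bounded_linear_fst]])
  from bounded_bilinear.FDERIV[OF bounded_bilinear_cscale this has_derivative_ident]
  have "((\<lambda>v. inverse (fst v) *\<^sub>C v) has_derivative (\<lambda>w. inverse (fst v) *\<^sub>C w + (- (inverse (fst v) * fst w * inverse (fst v))) *\<^sub>C v)) (at v)" .
  moreover have "ddehom v = (\<lambda>w. inverse (fst v) *\<^sub>C w + (- (inverse (fst v) * fst w * inverse (fst v))) *\<^sub>C v)"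
    by (rule ext) (simp only: ddehom_def cscale_triv(4) diff_conv_add_uminus)
  ultimately show ?thesis unfolding dehom_def[abs_def] by simp
qed

lemma ddehom_eq_0_iff:
  assumes "fst v \<noteq> 0"
  shows "ddehom v w = 0 \<longleftrightarrow> (\<exists>\<mu>. w = \<mu> *\<^sub>C v)"
proof
  assume "ddehom v w = 0"
  then have "fst v *\<^sub>C (inverse (fst v) *\<^sub>C w) = fst v *\<^sub>C ((inverse (fst v) * fst w * inverse (fst v)) *\<^sub>C v)"
    by (simp add: ddehom_def)
  then have "w = (fst v * (inverse (fst v) * fst w * inverse (fst v))) *\<^sub>C v" using assms by (simp only: cscale_assoc right_inverse cscale_triv not_False_eq_True)
  then show "\<exists>\<mu>. w = \<mu> *\<^sub>C v" ..
next
  assume "\<exists>\<mu>. w = \<mu> *\<^sub>C v"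
  then show "ddehom v w = 0" using assms by (auto simp: ddehom_def cscale_assoc field_simps)
qed

lemma linear_ddehom: "linear (ddehom v)"
  unfolding ddehom_def
  by (rule linearI; rule cvec_eqI) (simp_all add: algebra_simps)

lemma has_vector_derivative_dehom:
  assumes "(f has_vector_derivative d) (at t)" "fst (f t) \<noteq> 0"
  shows "((\<lambda>x. dehom (f x)) has_vector_derivative ddehom (f t) d) (at t)"
  using diff_chain_at[OF assms(1)[unfolded has_vector_derivative_def] has_derivative_dehom[OF assms(2)]]
  by (simp add: has_vector_derivative_def o_def linear_cmul[OF linear_ddehom])

(* Vectors are pairs, but quantifiers over them are not to be split into components. *)
declare split_paired_All [simp del] split_paired_Ex [simp del]

section \<open>Integral curves\<close>

lemma gvec_curve_derivative:
  fixes c :: "real \<Rightarrow> 'n::{finite,linorder} aframe"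
  assumes r: "r > 0" and s: "s\<^sup>2 = 1" and d: "(c has_vector_derivative X) (at t)" and c: "c t \<in> adapted_frames r"
  shows "((\<lambda>t. dehom (gvec r \<phi> s (c t))) has_vector_derivative ddehom (gvec r \<phi> s (c t)) (gvec r \<phi> s X)) (at t)"
  by (rule has_vector_derivative_dehom[OF bounded_linear.has_vector_derivative[OF bounded_linear_gvec d] herm_gvec(5)[OF c r s]])

text \<open>
  A curve is integral iff the null line of \<open>gvec\<close> is constant along it: both conditions say that
  the derivative of the affine coordinates of this line vanishes.
\<close>

lemma integral_curve_iff:
  fixes c :: "real \<Rightarrow> 'n::{finite,linorder} aframe"
  assumes r: "r > 0" and s: "s\<^sup>2 = 1"
  shows "integral_curve r \<phi> s c \<longleftrightarrow> valid_path c \<and> c ` {0..1} \<subseteq> adapted_frames r \<and>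
    (\<forall>t\<in>{0..1}. dehom (gvec r \<phi> s (c t)) = dehom (gvec r \<phi> s (c 0)))" (is "_ \<longleftrightarrow> ?R")
proof (cases "valid_path c \<and> c ` {0..1} \<subseteq> adapted_frames r")
  case True
  then have ad: "c t \<in> adapted_frames r" if "t \<in> {0..1}" for t using that by auto
  let ?f = "\<lambda>t. dehom (gvec r \<phi> s (c t))"
  have iff: "X \<in> annihilated r \<phi> s (c t) \<longleftrightarrow> ddehom (gvec r \<phi> s (c t)) (gvec r \<phi> s X) = 0"
    if t: "t \<in> {0<..<1}" and d: "(c has_vector_derivative X) (at t)" for t X
  proof -
    have "inf_frame (c t) X"
      by (rule inf_frame_of_curve[OF r d open_greaterThanLessThan t]) (use ad in auto)
    moreover have "c t \<in> adapted_frames r" using t ad by auto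
    ultimately show ?thesis using annihilated_iff[OF r _ _ s] ddehom_eq_0_iff herm_gvec(5)[OF _ r s] by blast
  qed
  show ?thesis
  proof
    assume ic: "integral_curve r \<phi> s c"
    obtain S where S: "finite S" "c C1_differentiable_on ({0..1} - S)" and cont: "continuous_on {0..1} c"
      using True by (auto simp: valid_path_def piecewise_C1_differentiable_on_def)
    have "?f t = ?f 0" if t: "t \<in> {0..1}" for t
    proof (rule has_derivative_zero_unique_strong_interval[where k = "S \<union> {0, 1}", OF _ _ refl _ t])
      show "finite (S \<union> {0,1})" using S by simp
      have "continuous_on {0..1} (\<lambda>t. gvec r \<phi> s (c t))"
        using bounded_linear.continuous_on[OF bounded_linear_gvec cont] .
      then show "continuous_on {0..1} ?f"
        unfolding dehom_def using herm_gvec(5)[OF ad r s]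
        by (intro bounded_bilinear.continuous_on[OF bounded_bilinear_cscale] continuous_intros) auto
      fix x assume x: "x \<in> {0..1} - (S \<union> {0,1})"
      then obtain X where d: "(c has_vector_derivative X) (at x)" using S(2) unfolding C1_differentiable_on_def by blast
      have "X \<in> annihilated r \<phi> s (c x)" using ic x d unfolding integral_curve_def by (simp add: less_le)
      moreover have "x \<in> {0<..<1}" using x by auto
      ultimately have "ddehom (gvec r \<phi> s (c x)) (gvec r \<phi> s X) = 0" using iff d by blast
      moreover have "c x \<in> adapted_frames r" using ad x by auto
      ultimately have "(?f has_vector_derivative 0) (at x)" using gvec_curve_derivative[OF r s d] by metis
      then show "(?f has_derivative (\<lambda>h. 0)) (at x within {0..1})"
        by (auto simp: has_vector_derivative_def intro: has_derivative_at_withinI)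
    qed
    then show ?R using True by blast
  next
    assume R: ?R
    have "X \<in> annihilated r \<phi> s (c t)" if t: "t \<in> {0<..<1}" and d: "(c has_vector_derivative X) (at t)" for t X
    proof -
      have "c t \<in> adapted_frames r" using ad t by auto
      from gvec_curve_derivative[OF r s d this]
      have "ddehom (gvec r \<phi> s (c t)) (gvec r \<phi> s X) = 0"
      proof (rule const_derivative[OF _ open_greaterThanLessThan t])
        show "?f x = ?f 0" if "x \<in> {0<..<1}" for x
        proof -
          have "x \<in> {0..1}" using that by auto
          then show ?thesis using R by blast
        qed
      qed
      then show ?thesis using iff[OF t d] by simp
    qed
    then show "integral_curve r \<phi> s c" using True by (simp add: integral_curve_def)
  qed
next
  case False
  then show ?thesis by (auto simp: integral_curve_def)
qed

definition reach :: "real \<Rightarrow> real \<Rightarrow> real \<Rightarrow> 'n::{finite,linorder} aframe \<Rightarrow> 'n aframe \<Rightarrow> bool" where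
  "reach r \<phi> s g g' \<longleftrightarrow> (\<exists>c. integral_curve r \<phi> s c \<and> pathstart c = g \<and> pathfinish c = g')"

lemma reachD:
  assumes "r > 0" "s\<^sup>2 = 1" "reach r \<phi> s g g'"
  shows "g \<in> adapted_frames r" "g' \<in> adapted_frames r" "dehom (gvec r \<phi> s g') = dehom (gvec r \<phi> s g)"
proof -
  obtain c where "integral_curve r \<phi> s c" "c 0 = g" "c 1 = g'"
    using assms(3) unfolding reach_def pathstart_def pathfinish_def by blast
  then show "g \<in> adapted_frames r" "g' \<in> adapted_frames r" "dehom (gvec r \<phi> s g') = dehom (gvec r \<phi> s g)"
    using integral_curve_iff[OF assms(1,2), of \<phi> c] by (metis atLeastAtMost_iff image_subset_iff order_refl zero_le_one)+
qed

text \<open>As integrality means that a null line is constant, nothing has to be checked at the corner.\<close>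

lemma reach_trans:
  assumes rs: "r > 0" "s\<^sup>2 = 1" and "reach r \<phi> s g h" "reach r \<phi> s h k"
  shows "reach r \<phi> s g k"
proof -
  obtain c d where cd: "integral_curve r \<phi> s c" "pathstart c = g" "pathfinish c = h"
     "integral_curve r \<phi> s d" "pathstart d = h" "pathfinish d = k"
    using assms(3,4) unfolding reach_def by blast
  let ?P = "\<lambda>f. f \<in> adapted_frames r \<and> dehom (gvec r \<phi> s f) = dehom (gvec r \<phi> s g)"
  have c: "?P (c t)" "?P (d t)" if "t \<in> {0..1}" for t
  proof -
    have "c 0 = g" "d 0 = h" using cd by (simp_all add: pathstart_def)
    then show "?P (c t)" "?P (d t)"
      using cd(1,4) that reachD(3)[OF rs assms(3)] unfolding integral_curve_iff[OF rs] image_subset_iff by simp_all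
  qed
  have "?P ((c +++ d) t)" if "t \<in> {0..1}" for t
    using c[of "2 * t"] c[of "2 * t - 1"] that by (auto simp: joinpaths_def)
  moreover have "(c +++ d) 0 = g" using cd by (simp add: joinpaths_def pathstart_def)
  ultimately have "integral_curve r \<phi> s (c +++ d)"
    unfolding integral_curve_iff[OF rs] image_subset_iff using cd
    by (metis valid_path_join integral_curve_def)
  then show ?thesis unfolding reach_def using cd by (intro exI[of _ "c +++ d"]) simp
qed

section \<open>Unitary transformations\<close>

definition cisom :: "('n::finite cvec \<Rightarrow> 'n cvec) \<Rightarrow> bool" where
  "cisom T \<longleftrightarrow> (\<forall>v w. T (v + w) = T v + T w) \<and> (\<forall>c v. T (c *\<^sub>C v) = c *\<^sub>C T v) \<and>
     (\<forall>v w. herm (T v) (T w) = herm v w)"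

definition act :: "('n::finite cvec \<Rightarrow> 'n cvec) \<Rightarrow> 'n aframe \<Rightarrow> 'n aframe" where
  "act T g = (T (fst g), \<chi> j. T (snd g $ j))"

lemma act_simps [simp]: "fst (act T g) = T (fst g)" "snd (act T g) $ j = T (snd g $ j)"
  by (simp_all add: act_def)

lemma cisomD:
  assumes "cisom T"
  shows "T (v + w) = T v + T w" "T (v - w) = T v - T w" "T (c *\<^sub>C v) = c *\<^sub>C T v" "herm (T v) (T w) = herm v w"
proof -
  show *: "T (v + w) = T v + T w" "T (c *\<^sub>C v) = c *\<^sub>C T v" "herm (T v) (T w) = herm v w" for v w
    using assms by (simp_all add: cisom_def)
  show "T (v - w) = T v - T w" using *(1)[of "v - w" w] by simp
qed

lemma act_adapted: "cisom T \<Longrightarrow> g \<in> adapted_frames r \<Longrightarrow> r > 0 \<Longrightarrow> act T g \<in> adapted_frames r"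
  by (simp add: adapted_iff cisomD)

lemma gvec_act:
  assumes "cisom T" "g \<in> adapted_frames r" "r > 0"
  shows "gvec r \<phi> s (act T g) = T (gvec r \<phi> s g)"
  using assms act_adapted[OF assms] by (simp add: gvec_adapted cisomD)

lemma has_vector_derivative_vec:
  fixes f :: "'m::finite \<Rightarrow> real \<Rightarrow> 'a::euclidean_space"
  assumes "\<And>j. (f j has_vector_derivative d j) (at t)"
  shows "((\<lambda>x. \<chi> j. f j x) has_vector_derivative (\<chi> j. d j)) (at t)"
proof -
  define emb :: "'m \<Rightarrow> 'a \<Rightarrow> 'a ^ 'm" where "emb j w = (\<chi> i. if i = j then w else 0)" for j w
  have "linear (emb j)" for j
    by (rule linearI) (simp_all add: emb_def vec_eq_iff)
  then have bl: "bounded_linear (emb j)" for j using linear_conv_bounded_linear by blast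
  have "((\<lambda>x. \<Sum>j\<in>UNIV. emb j (f j x)) has_vector_derivative (\<Sum>j\<in>UNIV. emb j (d j))) (at t)"
    by (rule has_vector_derivative_sum) (rule bounded_linear.has_vector_derivative[OF bl assms])
  moreover have "(\<Sum>j\<in>UNIV. emb j (w j)) = (\<chi> j. w j)" for w
    by (simp add: emb_def vec_eq_iff)
  ultimately show ?thesis by simp
qed

lemma has_vector_derivative_cscale_left:
  "(f has_vector_derivative f') (at t) \<Longrightarrow> ((\<lambda>t. f t *\<^sub>C y) has_vector_derivative f' *\<^sub>C y) (at t)"
  by (rule bounded_linear.has_vector_derivative[OF bounded_bilinear.bounded_linear_left[OF bounded_bilinear_cscale]])

text \<open>
  All the curves that are needed move a frame by a one-parameter family of unitary transformations
  that preserve the null line of \<open>gvec\<close>.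
\<close>

lemma reach_path:
  fixes g :: "'n::{finite,linorder} aframe"
  assumes rs: "r > 0" "s\<^sup>2 = 1" and g: "g \<in> adapted_frames r"
    and T: "\<And>t. cisom (T t)" "\<And>t v. T t v = v + f t *\<^sub>C A v + k t *\<^sub>C B v"
    and f: "\<And>t. (f has_vector_derivative f' t) (at t)" "continuous_on UNIV f'"
    and k: "\<And>t. (k has_vector_derivative k' t) (at t)" "continuous_on UNIV k'"
    and line: "\<And>t. \<exists>c. T t (gvec r \<phi> s g) = c *\<^sub>C gvec r \<phi> s g"
  shows "reach r \<phi> s (act (T 0) g) (act (T 1) g)"
proof -
  let ?c = "\<lambda>t. act (T t) g"
  define D where "D t v = f' t *\<^sub>C A v + k' t *\<^sub>C B v" for t and v :: "'n cvec"
  have TD: "((\<lambda>t. T t v) has_vector_derivative D t v) (at t)" for t v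
  proof -
    have "((\<lambda>t. v + f t *\<^sub>C A v + k t *\<^sub>C B v) has_vector_derivative 0 + f' t *\<^sub>C A v + k' t *\<^sub>C B v) (at t)"
      by (intro has_vector_derivative_add has_vector_derivative_const has_vector_derivative_cscale_left f k)
    then show ?thesis by (simp add: D_def T(2)[abs_def])
  qed
  have Dc: "continuous_on UNIV (\<lambda>t. D t v)" for v
    unfolding D_def by (intro continuous_on_add bounded_bilinear.continuous_on[OF bounded_bilinear_cscale] continuous_on_const f k)
  have "(?c has_vector_derivative (D t (fst g), \<chi> j. D t (snd g $ j))) (at t)" for t
    unfolding act_def by (intro has_vector_derivative_Pair has_vector_derivative_vec TD)
  moreover have "continuous_on UNIV (\<lambda>t. (D t (fst g), \<chi> j. D t (snd g $ j)))"
    by (intro continuous_on_Pair continuous_on_vec_lambda Dc)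
  ultimately have "?c C1_differentiable_on {0..1}"
    unfolding C1_differentiable_on_def
    by (intro exI[of _ "\<lambda>t. (D t (fst g), \<chi> j. D t (snd g $ j))"] conjI ballI)
       (blast, rule continuous_on_subset[OF _ subset_UNIV])
  then have "valid_path ?c" by (simp add: valid_path_def C1_differentiable_imp_piecewise)
  moreover have ad: "?c t \<in> adapted_frames r" for t by (rule act_adapted[OF T(1) g rs(1)])
  moreover have "dehom (gvec r \<phi> s (?c t)) = dehom (gvec r \<phi> s g)" for t
  proof -
    obtain c where c: "T t (gvec r \<phi> s g) = c *\<^sub>C gvec r \<phi> s g" using line by blast
    have "fst (gvec r \<phi> s (?c t)) \<noteq> 0" by (rule herm_gvec(5)[OF ad rs])
    then have "c \<noteq> 0" by (auto simp: gvec_act[OF T(1) g rs(1)] c)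
    then show ?thesis by (simp add: gvec_act[OF T(1) g rs(1)] c)
  qed
  ultimately have "integral_curve r \<phi> s ?c" unfolding integral_curve_iff[OF rs] by auto
  then show ?thesis unfolding reach_def by (intro exI[of _ ?c]) (simp add: pathstart_def pathfinish_def)
qed

lemma reach_path1:
  fixes g :: "'n::{finite,linorder} aframe"
  assumes rs: "r > 0" "s\<^sup>2 = 1" and g: "g \<in> adapted_frames r"
    and T: "\<And>t. cisom (T t)" "\<And>t v. T t v = v + f t *\<^sub>C A v"
    and f: "\<And>t. (f has_vector_derivative f' t) (at t)" "continuous_on UNIV f'"
    and line: "\<And>t. \<exists>c. T t (gvec r \<phi> s g) = c *\<^sub>C gvec r \<phi> s g"
  shows "reach r \<phi> s (act (T 0) g) (act (T 1) g)"
  by (rule reach_path[where B = "\<lambda>_. 0" and k = "\<lambda>_. 0" and k' = "\<lambda>_. 0", OF rs g T(1) _ f _ _ line])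
     (simp_all add: T(2))

text \<open>The complex reflections along \<open>x\<close> if \<open>x\<close> is not isotropic, and the transvections along \<open>x\<close> if it is.\<close>

definition transvect :: "complex \<Rightarrow> 'n::finite cvec \<Rightarrow> 'n cvec \<Rightarrow> 'n cvec" where
  "transvect a x v = v + a *\<^sub>C (herm x v *\<^sub>C x)"

lemma cisom_transvect:
  assumes "a + cnj a + cnj a * a * herm x x = 0"
  shows "cisom (transvect a x)"
proof -
  have "herm (transvect a x v) (transvect a x w) = herm v w" for v w
  proof -
    have "herm (transvect a x v) (transvect a x w) = herm v w + (a + cnj a + cnj a * a * herm x x) * (herm v x * herm x w)"
      unfolding transvect_def by (simp add: herm_add herm_cscale cnj_herm algebra_simps)
    then show ?thesis using assms by simp
  qed
  then show ?thesis unfolding cisom_def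
    by (simp add: transvect_def herm_add herm_cscale cscale_distrib cscale_assoc mult_ac)
qed

lemma has_vector_derivative_cis: "((\<lambda>t. cis (t * \<theta>)) has_vector_derivative (\<i> * of_real \<theta> * cis (t * \<theta>))) (at t)"
  unfolding has_vector_derivative_def
  by (rule derivative_eq_intros refl | simp add: fun_eq_iff scaleR_conv_of_real)+

text \<open>
  The complex reflection along \<open>p - q\<close> that takes \<open>p\<close> to \<open>q\<close> lies on a circle of reflections
  fixing the orthogonal complement of \<open>p - q\<close>.
\<close>

lemma reflection_exists:
  fixes p q :: "'n::{finite,linorder} cvec"
  assumes pq: "herm p p = herm q q" and x: "herm (p - q) (p - q) \<noteq> 0"
  obtains T where "cisom T" "T p = q" "\<And>v. herm (p - q) v = 0 \<Longrightarrow> T v = v"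
    "\<And>r \<phi> s g. r > 0 \<Longrightarrow> s\<^sup>2 = 1 \<Longrightarrow> g \<in> adapted_frames r \<Longrightarrow> herm (p - q) (gvec r \<phi> s g) = 0 \<Longrightarrow> reach r \<phi> s g (act T g)"
proof -
  define x where "x = p - q"
  define h where "h = herm x p"
  have hh: "herm x x = h + cnj h"
  proof -
    have "h = herm p p - herm q p" by (simp add: h_def x_def herm_diff)
    moreover have "cnj h = herm p p - herm p q" unfolding h_def cnj_herm by (simp add: x_def herm_diff)
    moreover have "herm x x = herm p p - herm q p - (herm p q - herm q q)" by (simp add: x_def herm_diff)
    ultimately show ?thesis using pq by simp
  qed
  have h0: "h \<noteq> 0" and hh0: "h + cnj h \<noteq> 0" using x hh by (auto simp: x_def)
  have "cmod (- cnj h / h) = 1" using h0 by (simp add: norm_divide)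
  then obtain \<theta> where \<theta>: "cis \<theta> = - cnj h / h"
    using rcis_cmod_Arg[of "- cnj h / h"] unfolding rcis_def by (metis mult_1 of_real_1)
  define a where "a t = (cis (t * \<theta>) - 1) / herm x x" for t
  define T where "T t = transvect (a t) x" for t
  have iso: "cisom (T t)" for t
  proof -
    have c: "cnj (herm x x) = herm x x" by (rule cnj_herm)
    have "cnj (cis (t * \<theta>)) * cis (t * \<theta>) = 1" by (simp add: cis_cnj cis_mult)
    moreover have "herm x x \<noteq> 0" using hh hh0 by simp
    ultimately have "a t + cnj (a t) + cnj (a t) * a t * herm x x = 0"
      unfolding a_def complex_cnj_divide c by (simp add: field_simps)
    then show ?thesis unfolding T_def by (rule cisom_transvect)
  qed
  have a1: "a 1 * h = -1"
  proof -
    have "(cis \<theta> - 1) * h = - (h + cnj h)" using h0 by (simp add: \<theta> algebra_simps)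
    then have "a 1 * h = - (h + cnj h) / (h + cnj h)" by (simp add: a_def hh)
    then show ?thesis using hh0 by (simp add: divide_eq_minus_1_iff)
  qed
  show thesis
  proof (rule that[of "T 1"])
    show "cisom (T 1)" by (rule iso)
    have "a 1 *\<^sub>C (h *\<^sub>C x) = - x" by (simp add: cscale_assoc a1)
    then show "T 1 p = q" by (simp add: T_def transvect_def flip: h_def) (simp add: x_def)
    show "T 1 v = v" if "herm (p - q) v = 0" for v
      using that by (simp add: T_def transvect_def flip: x_def)
    show "reach r \<phi> s g (act (T 1) g)"
      if "r > 0" "s\<^sup>2 = 1" "g \<in> adapted_frames r" "herm (p - q) (gvec r \<phi> s g) = 0" for r \<phi> s g
    proof -
      have "reach r \<phi> s (act (T 0) g) (act (T 1) g)"
      proof (rule reach_path1[where f = a and f' = "\<lambda>t. (\<i> * of_real \<theta> * cis (t * \<theta>)) / herm x x" and A = "\<lambda>v. herm x v *\<^sub>C x", OF that(1-3) iso])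
        show "T t v = v + a t *\<^sub>C herm x v *\<^sub>C x" for t v by (simp add: T_def transvect_def)
        have "(a has_vector_derivative (\<i> * of_real \<theta> * cis (t * \<theta>) - 0) / herm x x) (at t)" for t
          unfolding a_def by (intro has_vector_derivative_divide has_vector_derivative_diff has_vector_derivative_cis has_vector_derivative_const)
        then show "(a has_vector_derivative \<i> * of_real \<theta> * cis (t * \<theta>) / herm x x) (at t)" for t by simp
        show "continuous_on UNIV (\<lambda>t. (\<i> * of_real \<theta> * cis (t * \<theta>)) / herm x x)"
          using hh0 hh by (intro continuous_intros) auto
        show "\<exists>c. T t (gvec r \<phi> s g) = c *\<^sub>C gvec r \<phi> s g" for t
          using that(4) by (intro exI[of _ 1]) (simp add: T_def transvect_def flip: x_def)
      qed
      moreover have "act (T 0) g = g"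
        by (simp add: act_def T_def transvect_def a_def prod_eq_iff vec_eq_iff)
      ultimately show ?thesis by simp
    qed
  qed
qed

section \<open>The leaves are the fibres of the map into the null lines\<close>

lemma cisom_phase: "cisom (\<lambda>v. cis \<theta> *\<^sub>C v)"
proof -
  have "cnj (cis \<theta>) * (cis \<theta> * x) = x" for x
    by (simp add: cis_cnj cis_mult flip: mult.assoc)
  then show ?thesis by (simp add: cisom_def cscale_distrib cscale_assoc herm_cscale mult_ac)
qed

context
  fixes r \<phi> s :: real
  assumes rs: "r > 0" "s\<^sup>2 = 1"
begin

lemma reach_refl:
  assumes "g \<in> adapted_frames r"
  shows "reach r \<phi> s g (g :: 'n::{finite,linorder} aframe)"
proof -
  have "cisom (\<lambda>v :: 'n cvec. v)" by (simp add: cisom_def)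
  moreover have "act (\<lambda>v. v) g = g" by (simp add: act_def)
  ultimately show ?thesis
    using reach_path1[OF rs assms, of "\<lambda>t v. v" "\<lambda>_. 0" "\<lambda>_. 0" "\<lambda>_. 0" \<phi>]
    by (simp add: exI[of _ 1])
qed

text \<open>The stabiliser of the null line contains a copy of the multiplicative group of complex numbers,
  which stretches the null vector; a second null vector is multiplied by the inverse conjugate factors.\<close>

lemma reach_boost:
  fixes g :: "'n::{finite,linorder} aframe"
  assumes g: "g \<in> adapted_frames r"
  obtains h where "reach r \<phi> s g h" "gvec r \<phi> s h = exp w *\<^sub>C gvec r \<phi> s g"
proof -
  define y where "y = gvec r \<phi> s g"
  have y0: "fst y \<noteq> 0" and yy: "herm y y = 0" unfolding y_def using herm_gvec[OF g rs(1)] rs by blast+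
  \<comment> \<open>the mirror image of \<open>y\<close> under time reversal, normalised to have product 1 with \<open>y\<close>\<close>
  define y' where "y' = (- inverse (2 * of_real ((cmod (fst y))\<^sup>2))) *\<^sub>C (fst y, - snd y)"
  have n: "fst y * cnj (fst y) = of_real ((cmod (fst y))\<^sup>2)" by (simp only: complex_norm_square)
  have S: "(\<Sum>k\<in>UNIV. cnj (snd y $ k) * snd y $ k) = of_real ((cmod (fst y))\<^sup>2)"
    using yy n by (simp add: herm_def mult.commute)
  have "herm y (fst y, - snd y) = - 2 * of_real ((cmod (fst y))\<^sup>2)"
    using S n by (simp add: herm_def sum_negf mult.commute)
  then have p: "herm y y' = 1" using y0 by (simp add: y'_def herm_cscale)
  then have p': "herm y' y = 1" using cnj_herm[of y y'] by simp
  have "herm (fst y, - snd y) (fst y, - snd y) = herm y y" by (simp add: herm_def)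
  then have y'y': "herm y' y' = 0" by (simp add: y'_def herm_cscale yy)
  define f where "f t = exp (of_real t * w) - 1" for t
  define k where "k t = exp (- of_real t * cnj w) - 1" for t
  define T where "T t v = v + f t *\<^sub>C (herm y' v *\<^sub>C y) + k t *\<^sub>C (herm y v *\<^sub>C y')" for t and v :: "'n cvec"
  have iso: "cisom (T t)" for t
  proof -
    have "(f t + 1) * (cnj (k t) + 1) = 1" by (simp add: f_def k_def exp_cnj flip: exp_add)
    then have fk: "f t + cnj (k t) + f t * cnj (k t) = 0" by (simp add: algebra_simps)
    then have "cnj (f t + cnj (k t) + f t * cnj (k t)) = 0" by simp
    then have fk': "cnj (f t) + k t + cnj (f t) * k t = 0" by simp
    have "herm (T t v) (T t w) = herm v w" for v w
    proof -
      have "herm (T t v) (T t w) = herm v w + (f t + cnj (k t) + f t * cnj (k t)) * (herm v y * herm y' w)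
          + (cnj (f t) + k t + cnj (f t) * k t) * (herm v y' * herm y w)"
        unfolding T_def by (simp add: herm_add herm_cscale cnj_herm yy y'y' p p' algebra_simps)
      then show ?thesis by (simp add: fk fk')
    qed
    then show ?thesis unfolding cisom_def
      by (simp add: T_def herm_add herm_cscale cscale_distrib cscale_assoc mult_ac)
  qed
  have Ty: "T t y = exp (of_real t * w) *\<^sub>C y" for t
    by (simp add: T_def yy p' f_def cscale_distrib)
  have ex: "((\<lambda>t. exp (of_real t * z) - 1) has_vector_derivative z * exp (of_real t * z)) (at t)" for z :: complex and t
  proof -
    have "((\<lambda>x. exp (x * z) - 1) has_field_derivative z * exp (of_real t * z)) (at (of_real t))"
      by (rule derivative_eq_intros refl | simp)+
    from has_vector_derivative_real_field[OF this] show ?thesis .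
  qed
  have "reach r \<phi> s (act (T 0) g) (act (T 1) g)"
  proof (rule reach_path[OF rs g iso T_def])
    show "(f has_vector_derivative w * exp (of_real t * w)) (at t)" for t
      unfolding f_def[abs_def] by (rule ex)
    show "(k has_vector_derivative - cnj w * exp (- of_real t * cnj w)) (at t)" for t
      using ex[of "- cnj w" t] by (simp add: k_def[abs_def])
    show "continuous_on UNIV (\<lambda>t. w * exp (of_real t * w))" "continuous_on UNIV (\<lambda>t. - cnj w * exp (- of_real t * cnj w))"
      by (intro continuous_intros)+
    show "\<exists>c. T t (gvec r \<phi> s g) = c *\<^sub>C gvec r \<phi> s g" for t using Ty by (auto simp: y_def)
  qed
  moreover have "act (T 0) g = g" by (simp add: act_def T_def f_def k_def)
  moreover have "gvec r \<phi> s (act (T 1) g) = exp w *\<^sub>C y"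
    using gvec_act[OF iso g rs(1)] Ty[of 1] by (simp add: y_def)
  ultimately show thesis using that by (simp add: y_def)
qed

text \<open>Points of \<open>Q\<close> with the same product with a null vector differ by a vector orthogonal to it.  As the
  form is nonnegative on the orthogonal complement, a complex reflection along the difference
  exists unless the difference is isotropic.\<close>

lemma reach_base_point:
  fixes g h :: "'n::{finite,linorder} aframe"
  assumes g: "g \<in> adapted_frames r" and h: "h \<in> adapted_frames r" and eq: "gvec r \<phi> s g = gvec r \<phi> s h"
  obtains k where "reach r \<phi> s g k" "gvec r \<phi> s k = gvec r \<phi> s h" "fst k = fst h"
proof -
  define y where "y = gvec r \<phi> s g"
  have y0: "fst y \<noteq> 0" and yy: "herm y y = 0" unfolding y_def using herm_gvec[OF g rs(1)] rs by blast+
  define p where "p = fst g"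
  define q where "q = fst h"
  have py: "herm p y = - \<i> * of_real r" and qy: "herm q y = - \<i> * of_real r"
    using herm_gvec(1)[OF g rs(1), of \<phi> s] herm_gvec(1)[OF h rs(1), of \<phi> s] eq by (simp_all add: p_def q_def y_def)
  have yp: "herm y p = \<i> * of_real r" using cnj_herm[of p y] py by simp
  have pq: "herm p p = herm q q" using adaptedD(2)[OF g rs(1)] adaptedD(2)[OF h rs(1)] by (simp add: p_def q_def)
  have xy: "herm (p - q) y = 0" by (simp add: herm_diff py qy)
  show thesis
  proof (cases "herm (p - q) (p - q) = 0")
    case False
    from reflection_exists[OF pq False] obtain T where T: "cisom T" "T p = q" "\<And>v. herm (p - q) v = 0 \<Longrightarrow> T v = v"
      "reach r \<phi> s g (act T g)" using rs g xy by (metis y_def)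
    have "gvec r \<phi> s (act T g) = y" using gvec_act[OF T(1) g rs(1)] T(3)[OF xy] by (simp add: y_def)
    then show thesis using that[OF T(4)] T(2) eq by (simp add: y_def p_def q_def)
  next
    case True
    \<comment> \<open>The difference is then a multiple of the null vector, and the two frames differ by an
      element of the centre of the Heisenberg group.\<close>
    have "herm y (p - q) = 0" using xy herm_sym_zero by blast
    then obtain \<mu> where \<mu>: "p - q = \<mu> *\<^sub>C y"
      using herm_orth_nonneg[of y 0 "p - q"] y0 yy True by (metis order_refl minus_zero of_real_0 of_real_eq_0_iff)
    then have q: "q = p - \<mu> *\<^sub>C y" by (metis diff_diff_eq2 add_diff_cancel_left' diff_add_cancel)
    have "herm q q = herm p p - \<mu> * herm p y - cnj \<mu> * herm y p"
      unfolding q by (simp add: herm_diff herm_cscale yy)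
    then have "\<mu> * \<i> * of_real r = cnj \<mu> * \<i> * of_real r" using pq py yp by simp
    then have \<mu>': "cnj \<mu> = \<mu>" using rs by simp
    define a where "a = - \<mu> / (\<i> * of_real r)"
    have a: "a + cnj a = 0" using \<mu>' by (simp add: a_def)
    define T where "T t = transvect (of_real t * a) y" for t
    have iso: "cisom (T t)" for t
      unfolding T_def
    proof (rule cisom_transvect)
      have "of_real t * (a + cnj a) = 0" using a by simp
      then show "of_real t * a + cnj (of_real t * a) + cnj (of_real t * a) * (of_real t * a) * herm y y = 0"
        by (simp add: yy algebra_simps)
    qed
    have "reach r \<phi> s (act (T 0) g) (act (T 1) g)"
    proof (rule reach_path1[where A = "\<lambda>v. herm y v *\<^sub>C y" and f = "\<lambda>t. of_real t * a" and f' = "\<lambda>_. a", OF rs g iso])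
      show "T t v = v + (of_real t * a) *\<^sub>C herm y v *\<^sub>C y" for t v by (simp add: T_def transvect_def)
      have "((\<lambda>t. t *\<^sub>R a) has_vector_derivative 1 *\<^sub>R a) (at t)" for t
        by (rule bounded_linear.has_vector_derivative[OF bounded_linear_scaleR_left has_vector_derivative_id])
      then show "((\<lambda>t. of_real t * a) has_vector_derivative a) (at t)" for t by (simp add: scaleR_conv_of_real)
      show "\<exists>c. T t (gvec r \<phi> s g) = c *\<^sub>C gvec r \<phi> s g" for t
        by (intro exI[of _ 1]) (simp add: T_def transvect_def yy flip: y_def)
    qed simp
    moreover have "act (T 0) g = g" by (simp add: act_def T_def transvect_def)
    moreover have "gvec r \<phi> s (act (T 1) g) = y"
      using gvec_act[OF iso[of 1] g rs(1), of \<phi> s] by (simp add: T_def transvect_def yy flip: y_def)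
    moreover have "T 1 p = q"
    proof -
      have "T 1 p = p + (a * (\<i> * of_real r)) *\<^sub>C y" by (simp add: T_def transvect_def yp cscale_assoc)
      also have "a * (\<i> * of_real r) = - \<mu>" using rs by (simp add: a_def)
      finally show ?thesis by (simp add: q)
    qed
    ultimately show thesis using that[of "act (T 1) g"] eq by (simp add: y_def p_def q_def)
  qed
qed

lemma adapted_eqI:
  assumes "g \<in> adapted_frames r" "h \<in> adapted_frames r" "fst g = fst h" "\<And>k. snd g $ Inl k = snd h $ Inl k"
  shows "g = (h :: 'n::{finite,linorder} aframe)"
proof -
  have "snd g $ j = snd h $ j" for j
    using assms(4) adaptedD(6)[OF assms(1) rs(1)] adaptedD(6)[OF assms(2) rs(1)] by (cases j) simp_all
  then show ?thesis using assms(3) by (simp add: prod_eq_iff vec_eq_iff)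
qed

lemma gcoef_nonzero: "gcoef \<phi> s \<noteq> 0"
  using gcoef_unit[OF rs(2), of \<phi>] by auto

text \<open>The frame vectors are moved to their places one after the other by complex reflections
  that fix those already in place.\<close>

lemma reach_frame:
  fixes g h :: "'n::{finite,linorder} aframe"
  assumes g: "g \<in> adapted_frames r" and h: "h \<in> adapted_frames r"
    and eq: "gvec r \<phi> s g = gvec r \<phi> s h" "fst g = fst h"
  shows "reach r \<phi> s g h"
proof -
  have last: "snd k $ Inl last_index = snd h $ Inl last_index"
    if "k \<in> adapted_frames r" "gvec r \<phi> s k = gvec r \<phi> s h" "fst k = fst h" for k
  proof -
    have "gcoef \<phi> s *\<^sub>C (snd k $ Inl last_index) = gcoef \<phi> s *\<^sub>C (snd h $ Inl last_index)"
      using that(2,3) unfolding gvec_adapted[OF that(1) rs(1)] gvec_adapted[OF h rs(1)] by simp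
    then have "inverse (gcoef \<phi> s) *\<^sub>C gcoef \<phi> s *\<^sub>C (snd k $ Inl last_index) = inverse (gcoef \<phi> s) *\<^sub>C gcoef \<phi> s *\<^sub>C (snd h $ Inl last_index)"
      by simp
    then show ?thesis using gcoef_nonzero by (simp add: cscale_assoc)
  qed
  have "finite A \<Longrightarrow> \<exists>k. reach r \<phi> s g k \<and> gvec r \<phi> s k = gvec r \<phi> s h \<and> fst k = fst h \<and>
      (\<forall>i\<in>A. snd k $ Inl i = snd h $ Inl i)" for A :: "'n set"
  proof (induction A rule: finite_induct)
    case empty
    then show ?case using reach_refl[OF g] eq by auto
  next
    case (insert j A)
    then obtain k where k: "reach r \<phi> s g k" "gvec r \<phi> s k = gvec r \<phi> s h" "fst k = fst h"
      "\<forall>i\<in>A. snd k $ Inl i = snd h $ Inl i" by blast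
    have ka: "k \<in> adapted_frames r" using reachD[OF rs k(1)] by simp
    note kd = adaptedD[OF ka rs(1)] and hd = adaptedD[OF h rs(1)]
    let ?p = "snd k $ Inl j" and ?q = "snd h $ Inl j"
    show ?case
    proof (cases "?p = ?q")
      case True
      then show ?thesis using k by auto
    next
      case False
      have "j \<noteq> last_index" using last[OF ka k(2,3)] False by auto
      have pz: "herm (?p - ?q) (fst h) = 0" using kd(4) hd(4) k(3) by (simp add: herm_diff)
      have "herm (?p - ?q) (?p - ?q) \<noteq> 0"
      proof
        assume "herm (?p - ?q) (?p - ?q) = 0"
        moreover have "herm (fst h) (?p - ?q) = 0" using pz herm_sym_zero by blast
        ultimately have "?p - ?q = 0"
          using herm_orth_nonneg[of "fst h" "r\<^sup>2" "?p - ?q"] hd(2) Q_fst(1)[OF hd(1) rs(1)] rs(1)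
          by (metis of_real_eq_0_iff zero_less_power zero_le_power less_imp_le)
        then show False using False by simp
      qed
      moreover have "herm ?p ?p = herm ?q ?q" using kd(5) hd(5) by simp
      ultimately obtain T where T: "cisom T" "T ?p = ?q" "\<And>v. herm (?p - ?q) v = 0 \<Longrightarrow> T v = v"
        "\<And>g. g \<in> adapted_frames r \<Longrightarrow> herm (?p - ?q) (gvec r \<phi> s g) = 0 \<Longrightarrow> reach r \<phi> s g (act T g)"
        using reflection_exists[of ?p ?q] rs by metis
      have pe: "herm (?p - ?q) (snd k $ Inl i) = 0" if "i \<in> A" for i
      proof -
        have "i \<noteq> j" using that insert by auto
        then show ?thesis using kd(5)[of j i] hd(5)[of j i] k(4) that by (simp add: herm_diff)
      qed
      have py: "herm (?p - ?q) (gvec r \<phi> s k) = 0"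
        using herm_gvec(3)[OF ka rs(1) \<open>j \<noteq> last_index\<close>, of \<phi> s] herm_gvec(3)[OF h rs(1) \<open>j \<noteq> last_index\<close>, of \<phi> s] k(2)
        by (simp add: herm_diff)
      have "reach r \<phi> s g (act T k)" using reach_trans[OF rs k(1) T(4)[OF ka py]] .
      moreover have "gvec r \<phi> s (act T k) = gvec r \<phi> s h" using gvec_act[OF T(1) ka rs(1)] T(3)[OF py] k(2) by simp
      moreover have "fst (act T k) = fst h" using T(3) pz k(3) by simp
      moreover have "\<forall>i\<in>insert j A. snd (act T k) $ Inl i = snd h $ Inl i"
        using T(2) T(3)[OF pe] k(4) by auto
      ultimately show ?thesis by blast
    qed
  qed
  from this[of UNIV, OF finite] obtain k where k: "reach r \<phi> s g k" "fst k = fst h" "\<forall>i. snd k $ Inl i = snd h $ Inl i" by blast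
  then have "k = h" using adapted_eqI[of k h] reachD(2)[OF rs k(1)] h by blast
  then show ?thesis using k(1) by simp
qed

text \<open>Stretching adjusts the representative of the null line; it remains to adjust the base point and
  the other frame vectors, which is done while fixing the representative.\<close>

lemma reach_iff:
  fixes g h :: "'n::{finite,linorder} aframe"
  assumes g: "g \<in> adapted_frames r" and h: "h \<in> adapted_frames r"
  shows "reach r \<phi> s g h \<longleftrightarrow> dehom (gvec r \<phi> s g) = dehom (gvec r \<phi> s h)"
proof
  assume "reach r \<phi> s g h"
  then show "dehom (gvec r \<phi> s g) = dehom (gvec r \<phi> s h)" using reachD(3)[OF rs] by metis
next
  assume d: "dehom (gvec r \<phi> s g) = dehom (gvec r \<phi> s h)"
  define b where "b = fst (gvec r \<phi> s h) / fst (gvec r \<phi> s g)"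
  have b: "gvec r \<phi> s h = b *\<^sub>C gvec r \<phi> s g" "b \<noteq> 0"
    using iffD1[OF dehom_eq_iff[OF herm_gvec(5)[OF g rs] herm_gvec(5)[OF h rs]] d]
      herm_gvec(5)[OF g rs] herm_gvec(5)[OF h rs] by (simp_all add: b_def)
  obtain g2 where g2: "reach r \<phi> s g g2" "gvec r \<phi> s g2 = exp (Ln b) *\<^sub>C gvec r \<phi> s g"
    using reach_boost[OF g] by metis
  have "gvec r \<phi> s g2 = gvec r \<phi> s h" using b by (simp add: g2(2))
  moreover have g2a: "g2 \<in> adapted_frames r" by (rule reachD(2)[OF rs g2(1)])
  ultimately obtain g3 where g3: "reach r \<phi> s g2 g3" "gvec r \<phi> s g3 = gvec r \<phi> s h" "fst g3 = fst h"
    using reach_base_point[OF _ h] by metis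
  have "reach r \<phi> s g3 h" using reach_frame[OF reachD(2)[OF rs g3(1)] h g3(2,3)] .
  then show "reach r \<phi> s g h" using g2(1) g3(1) reach_trans[OF rs] by metis
qed

end

section \<open>Frames of the complex hyperbolic space\<close>

definition std_frame :: "real \<Rightarrow> 'n::finite aframe" where
  "std_frame r = ((of_real r, 0), \<chi> j. case j of Inl k \<Rightarrow> (0, axis k 1) | Inr k \<Rightarrow> (0, axis k \<i>))"

lemma std_frame_adapted:
  assumes "r > 0"
  shows "std_frame r \<in> (adapted_frames r :: 'n::finite aframe set)"
proof -
  have "(\<Sum>m\<in>UNIV. cnj (axis k 1 $ m) * axis l 1 $ m) = of_bool (k = l)" for k l :: 'n
  proof -
    have "(\<Sum>m\<in>UNIV. cnj (axis k 1 $ m) * axis l 1 $ m) = (\<Sum>m\<in>UNIV. if m = k then of_bool (k = l) else 0)"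
      by (rule sum.cong) (auto simp: axis_def)
    then show ?thesis by simp
  qed
  then show ?thesis
    unfolding adapted_iff[OF assms]
    by (auto simp: std_frame_def herm_def power2_eq_square axis_def intro!: cvec_eqI)
qed

text \<open>A phase and two complex reflections take the standard frame to one with the prescribed vectors.\<close>

lemma adapted_frame_exists:
  fixes z u :: "'n::{finite,linorder} cvec"
  assumes r: "r > 0" and z: "z \<in> Q r" and zu: "herm z u = 0" and uu: "herm u u = 1"
  obtains g where "g \<in> adapted_frames r" "fst g = z" "snd g $ Inl last_index = u"
proof -
  define g1 :: "'n aframe" where "g1 = act (\<lambda>v. cis (Arg (fst z)) *\<^sub>C v) (std_frame r)"
  have g1: "g1 \<in> adapted_frames r" unfolding g1_def by (rule act_adapted[OF cisom_phase std_frame_adapted[OF r] r])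
  let ?p = "fst g1"
  have p: "?p = (of_real r * cis (Arg (fst z)), 0)"
    by (simp add: g1_def std_frame_def cscale_def mult.commute)
  have fz: "fst z = of_real (cmod (fst z)) * cis (Arg (fst z))" using rcis_cmod_Arg[of "fst z"] by (simp add: rcis_def)
  have pp: "herm ?p ?p = herm z z" using adaptedD(2)[OF g1 r] herm_Q[OF z] by simp
  have "\<exists>g2. g2 \<in> adapted_frames r \<and> fst g2 = z"
  proof (cases "cmod (fst z) = r")
    case True
    then have "z = ?p" using Q_fst(3)[OF z r] fz p by (simp add: prod_eq_iff)
    then show ?thesis using g1 by auto
  next
    case False
    have "cnj (fst z) * cis (Arg (fst z)) = of_real (cmod (fst z)) * (cnj (cis (Arg (fst z))) * cis (Arg (fst z)))"
      by (subst fz) simp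
    also have "cnj (cis (Arg (fst z))) * cis (Arg (fst z)) = 1" by (simp add: cis_cnj cis_mult)
    finally have "herm z ?p = - of_real (r * cmod (fst z))"
      unfolding p herm_def by (simp add: mult_ac)
    then have "herm (?p - z) (?p - z) = of_real (2 * r * (cmod (fst z) - r))"
      unfolding herm_self_diff pp herm_Q[OF z] by (simp add: power2_eq_square algebra_simps)
    then have "herm (?p - z) (?p - z) \<noteq> 0" using False r by simp
    from reflection_exists[OF pp this] obtain T where "cisom T" "T ?p = z" by metis
    then show ?thesis using act_adapted[OF _ g1 r] by (intro exI[of _ "act T g1"]) simp
  qed
  then obtain g2 where g2: "g2 \<in> adapted_frames r" "fst g2 = z" by blast
  note d = adaptedD[OF g2(1) r]
  let ?q = "snd g2 $ Inl last_index"
  show thesis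
  proof (cases "?q = u")
    case True
    then show thesis using that g2 by blast
  next
    case False
    have x: "herm (?q - u) z = 0" "herm z (?q - u) = 0"
      using d(3,4) g2(2) zu herm_sym_zero[of z u] by (simp_all add: herm_diff)
    have "herm (?q - u) (?q - u) \<noteq> 0"
    proof
      assume "herm (?q - u) (?q - u) = 0"
      then have "?q - u = 0"
        using herm_orth_nonneg[of z "r\<^sup>2" "?q - u"] herm_Q[OF z] Q_fst(1)[OF z r] r x(2)
        by (metis of_real_eq_0_iff zero_less_power zero_le_power less_imp_le)
      then show False using False by simp
    qed
    moreover have "herm ?q ?q = herm u u" using d(5) uu by simp
    ultimately obtain T where T: "cisom T" "T ?q = u" "\<And>v. herm (?q - u) v = 0 \<Longrightarrow> T v = v"
      using reflection_exists[of ?q u] by metis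
    then show thesis using that[of "act T g2"] act_adapted[OF T(1) g2(1) r] T(3)[OF x(1)] g2(2) by simp
  qed
qed

lemma hor_id: "herm z v = 0 \<Longrightarrow> hor r z v = v"
  by (simp add: hor_def)

lemma herm_hor: "z \<in> Q r \<Longrightarrow> r > 0 \<Longrightarrow> herm z (hor r z v) = 0"
  by (simp add: hor_def herm_add herm_cscale herm_Q)

lemma push_eq: "herm z v = 0 \<Longrightarrow> push r z v = range (\<lambda>\<theta>. (cis \<theta> *\<^sub>C z, cis \<theta> *\<^sub>C v))"
  by (simp add: push_def hor_id)

lemma cscale_right_cancel: "fst z \<noteq> 0 \<Longrightarrow> a *\<^sub>C z = b *\<^sub>C z \<longleftrightarrow> a = b"
  by (auto simp: prod_eq_iff)

lemma push_phase:
  assumes "herm z v = 0"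
  shows "push r (cis \<theta> *\<^sub>C z) (cis \<theta> *\<^sub>C v) = push r z v"
proof -
  define A where "A = range (\<lambda>t. (cis t *\<^sub>C z, cis t *\<^sub>C v))"
  define B where "B = range (\<lambda>t. (cis t *\<^sub>C cis \<theta> *\<^sub>C z, cis t *\<^sub>C cis \<theta> *\<^sub>C v))"
  have *: "(cis t *\<^sub>C cis \<theta> *\<^sub>C z, cis t *\<^sub>C cis \<theta> *\<^sub>C v) = (cis (t + \<theta>) *\<^sub>C z, cis (t + \<theta>) *\<^sub>C v)"
     "(cis t *\<^sub>C z, cis t *\<^sub>C v) = (cis (t - \<theta>) *\<^sub>C cis \<theta> *\<^sub>C z, cis (t - \<theta>) *\<^sub>C cis \<theta> *\<^sub>C v)" for t
    by (simp_all add: cscale_assoc cis_mult)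
  have "(cis t *\<^sub>C cis \<theta> *\<^sub>C z, cis t *\<^sub>C cis \<theta> *\<^sub>C v) \<in> A" "(cis t *\<^sub>C z, cis t *\<^sub>C v) \<in> B" for t
    unfolding A_def B_def by (rule range_eqI, rule *)+
  then have "B = A" unfolding A_def B_def by blast
  moreover have "herm (cis \<theta> *\<^sub>C z) (cis \<theta> *\<^sub>C v) = 0" using assms by (simp add: herm_cscale)
  ultimately show ?thesis by (simp add: push_eq assms A_def B_def)
qed

lemma push_eqD:
  assumes "herm z v = 0" "herm z' v' = 0" "push r z v = push r z' v'"
  obtains \<theta> where "z' = cis \<theta> *\<^sub>C z" "v' = cis \<theta> *\<^sub>C v"
proof -
  have "(cis 0 *\<^sub>C z', cis 0 *\<^sub>C v') \<in> push r z' v'" unfolding push_eq[OF assms(2)] by (rule rangeI)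
  then have "(z', v') \<in> push r z v" using assms(3) by simp
  then show thesis unfolding push_eq[OF assms(1)] using that by auto
qed

lemma tmetric_push:
  assumes "fst z \<noteq> 0" "herm z v = 0" "herm z w = 0"
  shows "tmetric (push r z v) (push r z w) = ip v w"
  unfolding tmetric_def
proof (rule the_equality)
  have "(cis 0 *\<^sub>C z, cis 0 *\<^sub>C v) \<in> push r z v" "(cis 0 *\<^sub>C z, cis 0 *\<^sub>C w) \<in> push r z w"
    using assms by (simp_all only: push_eq) (rule rangeI)+
  then show "\<exists>z' v' w'. (z', v') \<in> push r z v \<and> (z', w') \<in> push r z w \<and> ip v w = ip v' w'"
    by (intro exI[of _ z] exI[of _ v] exI[of _ w]) simp
  fix c
  assume "\<exists>z' v' w'. (z', v') \<in> push r z v \<and> (z', w') \<in> push r z w \<and> c = ip v' w'"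
  then obtain z' v' w' where *: "(z', v') \<in> push r z v" "(z', w') \<in> push r z w" "c = ip v' w'" by blast
  obtain t where "z' = cis t *\<^sub>C z" "v' = cis t *\<^sub>C v"
    using *(1) unfolding push_eq[OF assms(2)] image_iff bex_UNIV prod.inject by (elim exE conjE)
  moreover obtain t' where "z' = cis t' *\<^sub>C z" "w' = cis t' *\<^sub>C w"
    using *(2) unfolding push_eq[OF assms(3)] image_iff bex_UNIV prod.inject by (elim exE conjE)
  ultimately have t: "cis t *\<^sub>C z = cis t' *\<^sub>C z" "c = ip (cis t *\<^sub>C v) (cis t' *\<^sub>C w)" using *(3) by metis+
  have "cis t' = cis t" using iffD1[OF cscale_right_cancel[OF assms(1)] t(1)] by (rule sym)
  then show "c = ip v w" using t(2) cisomD(4)[OF cisom_phase, of t v w] by (simp add: ip_def)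
qed

lemma tJ_push:
  assumes "herm z v = 0"
  shows "tJ (push r z v) = push r z (\<i> *\<^sub>C v)"
proof -
  have "herm z (\<i> *\<^sub>C v) = 0" using assms by (simp add: herm_cscale)
  then show ?thesis using assms
    by (simp add: push_eq tJ_def image_image cscale_assoc mult.commute)
qed

lemma adapted_herm_zero:
  assumes "g \<in> adapted_frames r" "r > 0"
  shows "herm (fst g) (snd g $ j) = 0"
  using adaptedD[OF assms] by (cases j) (simp_all add: herm_cscale)

lemma frame_proj_eq_iff:
  fixes g h :: "'n::finite aframe"
  assumes g: "g \<in> adapted_frames r" and h: "h \<in> adapted_frames r" and r: "r > 0"
  shows "frame_proj r g = frame_proj r h \<longleftrightarrow> (\<exists>\<theta>. h = act (\<lambda>v. cis \<theta> *\<^sub>C v) g)"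
proof
  assume eq: "frame_proj r g = frame_proj r h"
  have f0: "fst (fst g) \<noteq> 0" using Q_fst(1)[OF adaptedD(1)[OF g r] r] .
  have "hopf (fst g) = hopf (fst h)" using eq by (simp add: frame_proj_def)
  then obtain \<theta> where \<theta>: "fst h = cis \<theta> *\<^sub>C fst g"
    using hopf_eq_iff[OF adaptedD(1)[OF g r] adaptedD(1)[OF h r] r] by blast
  have "snd h $ j = cis \<theta> *\<^sub>C (snd g $ j)" for j
  proof -
    have "push r (fst g) (snd g $ j) = push r (fst h) (snd h $ j)" using eq by (simp add: frame_proj_def fun_eq_iff)
    then obtain t where t: "fst h = cis t *\<^sub>C fst g" "snd h $ j = cis t *\<^sub>C (snd g $ j)"
      using push_eqD[OF adapted_herm_zero[OF g r] adapted_herm_zero[OF h r]] by metis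
    then show ?thesis using \<theta> cscale_right_cancel[OF f0] by metis
  qed
  then have "h = act (\<lambda>v. cis \<theta> *\<^sub>C v) g" using \<theta> by (simp add: prod_eq_iff vec_eq_iff[of "snd h"])
  then show "\<exists>\<theta>. h = act (\<lambda>v. cis \<theta> *\<^sub>C v) g" ..
next
  assume "\<exists>\<theta>. h = act (\<lambda>v. cis \<theta> *\<^sub>C v) g"
  then obtain \<theta> where \<theta>: "h = act (\<lambda>v. cis \<theta> *\<^sub>C v) g" ..
  have "hopf (fst g) = hopf (fst h)"
    using hopf_eq_iff[OF adaptedD(1)[OF g r] adaptedD(1)[OF h r] r] \<theta> by auto
  then show "frame_proj r g = frame_proj r h"
    by (simp add: frame_proj_def \<theta> push_phase[OF adapted_herm_zero[OF g r]])
qed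

lemma frames_eq:
  assumes r: "r > 0"
  shows "frames r = frame_proj r ` (adapted_frames r :: 'n::finite aframe set)"
proof (intro equalityI subsetI)
  fix f :: "'n frame"
  assume "f \<in> frame_proj r ` adapted_frames r"
  then obtain g where g: "g \<in> adapted_frames r" and f: "f = frame_proj r g" by blast
  have f0: "fst (fst g) \<noteq> 0" using Q_fst(1)[OF adaptedD(1)[OF g r] r] .
  note h = adapted_herm_zero[OF g r]
  have "fst g \<in> hopf (fst g)" unfolding hopf_def by (rule range_eqI[of _ _ 0]) simp
  moreover have "ip (fst g) (snd g $ j) = 0" for j using h by (simp add: ip_def)
  ultimately have "push r (fst g) (snd g $ j) \<in> TCH r (hopf (fst g))" for j unfolding TCH_def by blast
  moreover have "hopf (fst g) \<in> CH r" using adaptedD(1)[OF g r] by (simp add: CH_def)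
  moreover have "ip (snd g $ i) (snd g $ j) = (if i = j then 1 else 0)" for i j
    using g by (simp add: adapted_frames_def)
  ultimately show "f \<in> frames r"
    unfolding f frames_def frame_proj_def
    by (simp add: tmetric_push[OF f0 h h] tJ_push[OF h] adaptedD(6)[OF g r])
next
  fix f :: "'n frame"
  assume f: "f \<in> frames r"
  obtain x e where fxe: "f = (x, e)" by (cases f)
  obtain z where z: "x = hopf z" "z \<in> Q r" using f by (auto simp: frames_def CH_def fxe)
  have z0: "fst z \<noteq> 0" using Q_fst(1)[OF z(2) r] .
  have "\<exists>w. herm z w = 0 \<and> e j = push r z w" for j
  proof -
    have "e j \<in> TCH r x" using f by (simp add: frames_def fxe)
    then obtain z' v where z': "e j = push r z' v" "z' \<in> x" by (auto simp: TCH_def)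
    then obtain \<theta> where \<theta>: "z' = cis \<theta> *\<^sub>C z" using z(1) by (auto simp: hopf_def)
    have z'Q: "z' \<in> Q r" using z(2) cisomD(4)[OF cisom_phase, of \<theta> z z] by (simp add: Q_iff \<theta>)
    define w where "w = cis (- \<theta>) *\<^sub>C hor r z' v"
    have zz': "z = cis (- \<theta>) *\<^sub>C z'" by (simp add: \<theta> cscale_assoc cis_mult)
    have 0: "herm z' (hor r z' v) = 0" by (rule herm_hor[OF z'Q r])
    then have "herm z w = 0" using zz' cisomD(4)[OF cisom_phase, of "-\<theta>" z' "hor r z' v"] by (simp add: w_def)
    moreover have "push r z w = push r z' (hor r z' v)" unfolding w_def by (subst zz') (rule push_phase[OF 0])
    moreover have "push r z' (hor r z' v) = push r z' v" by (simp add: push_def hor_id[OF 0])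
    ultimately show ?thesis using z'(1) by metis
  qed
  then obtain w where w: "\<And>j. herm z (w j) = 0" "\<And>j. e j = push r z (w j)" by metis
  define g where "g = (z, \<chi> j. w j)"
  have ww: "ip (w i) (w j) = (if i = j then 1 else 0)" for i j
    using f tmetric_push[OF z0 w(1) w(1), of r i j] by (simp add: frames_def fxe w(2))
  have "w (Inr k) = \<i> *\<^sub>C w (Inl k)" for k
  proof -
    have "push r z (\<i> *\<^sub>C w (Inl k)) = push r z (w (Inr k))"
      using f tJ_push[OF w(1), of r "Inl k"] by (simp add: frames_def fxe w(2))
    moreover have "herm z (\<i> *\<^sub>C w (Inl k)) = 0" by (simp add: herm_cscale w)
    ultimately obtain t where t: "z = cis t *\<^sub>C z" "w (Inr k) = cis t *\<^sub>C \<i> *\<^sub>C w (Inl k)"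
      using push_eqD[OF _ w(1)] by metis
    then have "cis t = 1" using cscale_right_cancel[OF z0, of "cis t" 1] by simp
    then show ?thesis using t(2) by simp
  qed
  moreover have "ip (e0 r g) (w j) = 0" "ip z (w j) = 0" for j
    by (simp_all add: e0_def g_def ip_def herm_cscale w)
  ultimately have "g \<in> adapted_frames r" using z(2) ww by (simp add: adapted_frames_def g_def)
  moreover have "frame_proj r g = f" by (simp add: frame_proj_def g_def fxe z(1) w(2) fun_eq_iff)
  ultimately show "f \<in> frame_proj r ` adapted_frames r" by blast
qed

context
  fixes r \<phi> s :: real
  assumes rs: "r > 0" "s\<^sup>2 = 1"
begin

lemma dehom_gvec_cong:
  fixes g h :: "'n::{finite,linorder} aframe"
  assumes "g \<in> adapted_frames r" "h \<in> adapted_frames r" "frame_proj r g = frame_proj r h"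
  shows "dehom (gvec r \<phi> s g) = dehom (gvec r \<phi> s h)"
proof -
  obtain \<theta> where "h = act (\<lambda>v. cis \<theta> *\<^sub>C v) g" using assms frame_proj_eq_iff rs(1) by blast
  then show ?thesis by (simp add: gvec_act[OF cisom_phase assms(1) rs(1)] cis_neq_zero)
qed

text \<open>A curve in the frame bundle has many lifts to adapted frames, but they all have the same null lines.\<close>

lemma leaf_frame_proj:
  fixes g :: "'n::{finite,linorder} aframe"
  assumes g: "g \<in> adapted_frames r"
  shows "leaf r \<phi> s (frame_proj r g) =
    frame_proj r ` {h \<in> adapted_frames r. dehom (gvec r \<phi> s h) = dehom (gvec r \<phi> s g)}"
proof (intro equalityI subsetI)
  fix f assume "f \<in> leaf r \<phi> s (frame_proj r g)"
  then obtain g' h where *: "reach r \<phi> s g' h" "frame_proj r g' = frame_proj r g" "f = frame_proj r h"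
    unfolding leaf_def reach_def by blast
  then show "f \<in> frame_proj r ` {h \<in> adapted_frames r. dehom (gvec r \<phi> s h) = dehom (gvec r \<phi> s g)}"
    using reachD[OF rs *(1)] dehom_gvec_cong[OF _ g] by auto
next
  fix f assume "f \<in> frame_proj r ` {h \<in> adapted_frames r. dehom (gvec r \<phi> s h) = dehom (gvec r \<phi> s g)}"
  then obtain h where h: "h \<in> adapted_frames r" "dehom (gvec r \<phi> s h) = dehom (gvec r \<phi> s g)" "f = frame_proj r h" by blast
  then have "reach r \<phi> s g h" using reach_iff[OF rs g] by simp
  then show "f \<in> leaf r \<phi> s (frame_proj r g)" unfolding reach_def leaf_def h(3) by blast
qed

lemma leaf_eq_iff:
  fixes g h :: "'n::{finite,linorder} aframe"
  assumes g: "g \<in> adapted_frames r" and h: "h \<in> adapted_frames r"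
  shows "leaf r \<phi> s (frame_proj r g) = leaf r \<phi> s (frame_proj r h) \<longleftrightarrow>
    dehom (gvec r \<phi> s g) = dehom (gvec r \<phi> s h)"
proof
  assume "leaf r \<phi> s (frame_proj r g) = leaf r \<phi> s (frame_proj r h)"
  then have "frame_proj r h \<in> leaf r \<phi> s (frame_proj r g)" using h by (auto simp: leaf_frame_proj)
  then obtain k where "k \<in> adapted_frames r" "dehom (gvec r \<phi> s k) = dehom (gvec r \<phi> s g)" "frame_proj r h = frame_proj r k"
    using g by (auto simp: leaf_frame_proj)
  then show "dehom (gvec r \<phi> s g) = dehom (gvec r \<phi> s h)" using dehom_gvec_cong[OF h] by metis
next
  assume "dehom (gvec r \<phi> s g) = dehom (gvec r \<phi> s h)"
  then show "leaf r \<phi> s (frame_proj r g) = leaf r \<phi> s (frame_proj r h)" by (simp add: leaf_frame_proj[OF g] leaf_frame_proj[OF h])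
qed

lemma gamma_leaf:
  fixes g :: "'n::{finite,linorder} aframe"
  assumes g: "g \<in> adapted_frames r"
  shows "gamma r \<phi> s (leaf r \<phi> s (frame_proj r g)) = cline (gvec r \<phi> s g)"
  unfolding gamma_def
proof (rule the_equality)
  show "\<forall>h\<in>adapted_frames r. leaf r \<phi> s (frame_proj r h) = leaf r \<phi> s (frame_proj r g) \<longrightarrow> cline (gvec r \<phi> s h) = cline (gvec r \<phi> s g)"
    using leaf_eq_iff[OF _ g] cline_eq_iff herm_gvec(5)[OF _ rs] g by blast
qed (use g in blast)

end

section \<open>Recovering a frame from its two null lines\<close>

text \<open>The product \<open>p\<close> of the normalised representatives of the two null lines of a frame.  It satisfies
  \<open>p + cnj p = 1\<close>, which puts \<open>Zvec\<close> into \<open>Q\<close>, and \<open>e\<^sup>\<i>\<^sup>\<phi> p\<close> is real, which makes \<open>Uvec\<close> orthogonal to \<open>Zvec\<close>.\<close>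

definition null_pairing :: "real \<Rightarrow> complex" where
  "null_pairing \<phi> = cis (- \<phi>) / of_real (2 * cos \<phi>)"

text \<open>The base point and the vector \<open>e\<^sub>2\<^sub>n\<^sub>-\<^sub>1\<close> of the frames with the null vectors \<open>N1\<close> and \<open>N2\<close>.\<close>

definition Zvec :: "real \<Rightarrow> 'n::finite cvec \<Rightarrow> 'n cvec \<Rightarrow> 'n cvec" where
  "Zvec r N1 N2 = (\<i> * of_real r) *\<^sub>C (N2 - N1)"

definition Uvec :: "real \<Rightarrow> 'n::finite cvec \<Rightarrow> 'n cvec \<Rightarrow> 'n cvec" where
  "Uvec \<phi> N1 N2 = \<i> *\<^sub>C (cis (- \<phi>) *\<^sub>C N1 + cis \<phi> *\<^sub>C N2)"

lemma gcoef_cis: "gcoef \<phi> 1 = \<i> * cis (- \<phi>)" "gcoef \<phi> (-1) = - \<i> * cis \<phi>"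
  by (simp_all add: gcoef_def complex_eq_iff)

lemma cis_sum: "cis \<phi> + cis (- \<phi>) = of_real (2 * cos \<phi>)"
  by (simp add: complex_eq_iff)

lemma cis_cancel [simp]: "cis \<phi> * cis (- \<phi>) = 1" "cis (- \<phi>) * cis \<phi> = 1"
  by (simp_all add: cis_mult)

lemma Zvec_Uvec_unitary:
  assumes r: "r > 0" and c: "cos \<phi> > 0"
    and N: "herm N1 N1 = 0" "herm N2 N2 = 0" "herm N1 N2 = null_pairing \<phi>"
  shows "Zvec r N1 N2 \<in> Q r" "herm (Zvec r N1 N2) (Uvec \<phi> N1 N2) = 0" "herm (Uvec \<phi> N1 N2) (Uvec \<phi> N1 N2) = 1"
    "(\<i> / of_real r) *\<^sub>C Zvec r N1 N2 - gcoef \<phi> 1 *\<^sub>C Uvec \<phi> N1 N2 = (of_real (2 * cos \<phi>) * cis (- \<phi>)) *\<^sub>C N1"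
    "(\<i> / of_real r) *\<^sub>C Zvec r N1 N2 - gcoef \<phi> (-1) *\<^sub>C Uvec \<phi> N1 N2 = (- of_real (2 * cos \<phi>) * cis \<phi>) *\<^sub>C N2"
proof -
  have c0: "complex_of_real (2 * cos \<phi>) \<noteq> 0" using c by simp
  have N21: "herm N2 N1 = cis \<phi> / of_real (2 * cos \<phi>)"
    using cnj_herm[of N1 N2] N(3) by (simp add: null_pairing_def cis_cnj)
  have sum: "cis \<phi> / complex_of_real (2 * cos \<phi>) + cis (-\<phi>) / complex_of_real (2 * cos \<phi>) = 1"
    using c0 by (simp only: cis_sum flip: add_divide_distrib) simp
  have "herm (Zvec r N1 N2) (Zvec r N1 N2) = - of_real (r^2) * (cis \<phi> / complex_of_real (2 * cos \<phi>) + cis (-\<phi>) / complex_of_real (2 * cos \<phi>))"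
    by (simp add: Zvec_def herm_cscale herm_diff N N21 null_pairing_def power2_eq_square algebra_simps)
  then show "Zvec r N1 N2 \<in> Q r" unfolding sum Q_iff by simp
  have "herm (Zvec r N1 N2) (Uvec \<phi> N1 N2) = of_real r * ((cis (- \<phi>) * cis \<phi>) / of_real (2 * cos \<phi>) - (cis \<phi> * cis (- \<phi>)) / of_real (2 * cos \<phi>))"
    by (simp add: Zvec_def Uvec_def herm_cscale herm_diff herm_add N N21 null_pairing_def algebra_simps del: cis_cancel)
  then show "herm (Zvec r N1 N2) (Uvec \<phi> N1 N2) = 0" by simp
  have "herm (Uvec \<phi> N1 N2) (Uvec \<phi> N1 N2) = cnj (cis (-\<phi>)) * (cis \<phi> * cis (-\<phi>)) / of_real (2 * cos \<phi>) + cnj (cis \<phi>) * (cis (-\<phi>) * cis \<phi>) / of_real (2 * cos \<phi>)"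
    by (simp add: Uvec_def herm_cscale herm_add N N21 null_pairing_def algebra_simps del: cis_cancel)
  then show "herm (Uvec \<phi> N1 N2) (Uvec \<phi> N1 N2) = 1" using sum by (simp add: cis_cnj)
  have u: "gcoef \<phi> 1 *\<^sub>C Uvec \<phi> N1 N2 = - ((cis (-\<phi>) * cis (-\<phi>)) *\<^sub>C N1 + N2)"
    "gcoef \<phi> (-1) *\<^sub>C Uvec \<phi> N1 N2 = N1 + (cis \<phi> * cis \<phi>) *\<^sub>C N2"
    by (rule cvec_eqI; simp add: gcoef_cis Uvec_def algebra_simps; simp flip: mult.assoc)+
  have z: "(\<i> / of_real r) *\<^sub>C Zvec r N1 N2 = N1 - N2"
    using r by (simp add: Zvec_def cscale_assoc flip: cscale_triv(4)) (simp add: cscale_distrib)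
  have e: "1 + cis (-\<phi>) * cis (-\<phi>) = of_real (2 * cos \<phi>) * cis (- \<phi>)" "- 1 - cis \<phi> * cis \<phi> = - of_real (2 * cos \<phi>) * cis \<phi>"
    unfolding cis_sum[symmetric] by (simp_all add: algebra_simps)
  show "(\<i> / of_real r) *\<^sub>C Zvec r N1 N2 - gcoef \<phi> 1 *\<^sub>C Uvec \<phi> N1 N2 = (of_real (2 * cos \<phi>) * cis (- \<phi>)) *\<^sub>C N1"
    unfolding z u e[symmetric] by (simp add: cscale_distrib)
  show "(\<i> / of_real r) *\<^sub>C Zvec r N1 N2 - gcoef \<phi> (-1) *\<^sub>C Uvec \<phi> N1 N2 = (- of_real (2 * cos \<phi>) * cis \<phi>) *\<^sub>C N2"
    unfolding z u e[symmetric] by (simp add: cscale_distrib)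
qed

lemma frame_of_null_pair:
  fixes N1 N2 :: "'n::{finite,linorder} cvec"
  assumes r: "r > 0" and c: "cos \<phi> > 0"
    and N: "herm N1 N1 = 0" "herm N2 N2 = 0" "herm N1 N2 = null_pairing \<phi>"
  obtains g where "g \<in> adapted_frames r" "fst g = Zvec r N1 N2" "snd g $ Inl last_index = Uvec \<phi> N1 N2"
    "gvec r \<phi> 1 g = (of_real (2 * cos \<phi>) * cis (- \<phi>)) *\<^sub>C N1"
    "gvec r \<phi> (-1) g = (- of_real (2 * cos \<phi>) * cis \<phi>) *\<^sub>C N2"
proof -
  note p = Zvec_Uvec_unitary[OF assms]
  obtain g where g: "g \<in> adapted_frames r" "fst g = Zvec r N1 N2" "snd g $ Inl last_index = Uvec \<phi> N1 N2"
    using adapted_frame_exists[OF r p(1-3)] by metis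
  show thesis using that[OF g] p(4,5) unfolding gvec_adapted[OF g(1) r] g(2,3) by simp
qed

lemma null_pair_of_frame:
  fixes g :: "'n::{finite,linorder} aframe"
  assumes g: "g \<in> adapted_frames r" and r: "r > 0" and c: "cos \<phi> > 0"
    and N1: "gvec r \<phi> 1 g = (of_real (2 * cos \<phi>) * cis (- \<phi>)) *\<^sub>C N1"
    and N2: "gvec r \<phi> (-1) g = (- of_real (2 * cos \<phi>) * cis \<phi>) *\<^sub>C N2"
  shows "herm N1 N2 = null_pairing \<phi>" "fst g = Zvec r N1 N2"
proof -
  have c0: "complex_of_real (2 * cos \<phi>) \<noteq> 0" "complex_of_real (cos \<phi>) \<noteq> 0" using c by simp_all
  note a = adaptedD[OF g r]
  have "herm (gvec r \<phi> 1 g) (gvec r \<phi> (-1) g) = - 1 - cis \<phi> * cis \<phi>"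
    using r by (simp add: gvec_adapted[OF g r] gcoef_cis herm_diff herm_add herm_cscale a power2_eq_square cis_cnj)
       (simp add: algebra_simps)
  also have "\<dots> = - of_real (2 * cos \<phi>) * cis \<phi>" unfolding cis_sum[symmetric] by (simp add: algebra_simps)
  finally have "cnj (of_real (2 * cos \<phi>) * cis (- \<phi>)) * (- of_real (2 * cos \<phi>) * cis \<phi>) * herm N1 N2 = - of_real (2 * cos \<phi>) * cis \<phi>"
    unfolding N1 N2 by (simp add: herm_cscale)
  then have "of_real (2 * cos \<phi>) * cis \<phi> * herm N1 N2 = 1"
    using c0 by (simp add: cis_cnj cis_neq_zero mult_ac)
  then have "cis (- \<phi>) * (of_real (2 * cos \<phi>) * cis \<phi> * herm N1 N2) = cis (- \<phi>)" by simp
  then have "(cis (- \<phi>) * cis \<phi>) * (of_real (2 * cos \<phi>) * herm N1 N2) = cis (- \<phi>)" by (simp only: mult_ac)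
  then show "herm N1 N2 = null_pairing \<phi>" using c0 by (simp add: null_pairing_def field_simps)
  have "gcoef \<phi> (-1) *\<^sub>C gvec r \<phi> 1 g - gcoef \<phi> 1 *\<^sub>C gvec r \<phi> (-1) g = (\<i> / of_real r * (gcoef \<phi> (-1) - gcoef \<phi> 1)) *\<^sub>C fst g"
    unfolding gvec_adapted[OF g r] by (rule cvec_eqI) (simp_all add: algebra_simps)
  also have "\<i> / of_real r * (gcoef \<phi> (-1) - gcoef \<phi> 1) = of_real (2 * cos \<phi>) / of_real r"
    by (simp add: gcoef_def complex_eq_iff)
  finally have "(of_real (2 * cos \<phi>) / of_real r) *\<^sub>C fst g
      = (- \<i> * cis \<phi> * (of_real (2 * cos \<phi>) * cis (- \<phi>))) *\<^sub>C N1 + (\<i> * cis (-\<phi>) * (of_real (2 * cos \<phi>) * cis \<phi>)) *\<^sub>C N2"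
    unfolding N1 N2 gcoef_cis by (simp add: cscale_assoc)
  also have "- \<i> * cis \<phi> * (of_real (2 * cos \<phi>) * cis (- \<phi>)) = - \<i> * of_real (2 * cos \<phi>) * (cis \<phi> * cis (-\<phi>))" by (simp only: mult_ac)
  also have "\<i> * cis (-\<phi>) * (of_real (2 * cos \<phi>) * cis \<phi>) = \<i> * of_real (2 * cos \<phi>) * (cis (-\<phi>) * cis \<phi>)" by (simp only: mult_ac)
  finally have "(of_real r / of_real (2 * cos \<phi>)) *\<^sub>C (of_real (2 * cos \<phi>) / of_real r) *\<^sub>C fst g
      = (of_real r / of_real (2 * cos \<phi>)) *\<^sub>C ((- \<i> * of_real (2 * cos \<phi>)) *\<^sub>C N1 + (\<i> * of_real (2 * cos \<phi>)) *\<^sub>C N2)" by simp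
  then show "fst g = Zvec r N1 N2"
    using c0 r by (simp add: cscale_assoc cscale_distrib Zvec_def mult_ac)
qed

lemma null_pairing_nonzero: "cos \<phi> > 0 \<Longrightarrow> null_pairing \<phi> \<noteq> 0"
  by (simp add: null_pairing_def cis_neq_zero)

lemma Zvec_cscale: "Zvec r (c *\<^sub>C N1) (c *\<^sub>C N2) = c *\<^sub>C Zvec r N1 N2"
  by (simp add: Zvec_def cscale_distrib cscale_assoc mult_ac)

lemma frame_lines:
  fixes g :: "'n::{finite,linorder} aframe"
  assumes g: "g \<in> adapted_frames r" and r: "r > 0" and c: "cos \<phi> > 0"
    and m: "fst m1 \<noteq> 0" "fst m2 \<noteq> 0"
    and d: "dehom (gvec r \<phi> 1 g) = dehom m1" "dehom (gvec r \<phi> (-1) g) = dehom m2"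
  obtains A B where "cnj A * B * herm m1 m2 = null_pairing \<phi>" "fst g = Zvec r (A *\<^sub>C m1) (B *\<^sub>C m2)"
    "cmod A = cmod (fst (gvec r \<phi> 1 g)) / (2 * cos \<phi> * cmod (fst m1))"
proof -
  define a where "a = fst (gvec r \<phi> 1 g) / fst m1"
  define b where "b = fst (gvec r \<phi> (-1) g) / fst m2"
  have f: "fst (gvec r \<phi> 1 g) \<noteq> 0" "fst (gvec r \<phi> (-1) g) \<noteq> 0" by (rule herm_gvec(5)[OF g r]; simp)+
  have a: "gvec r \<phi> 1 g = a *\<^sub>C m1" and b: "gvec r \<phi> (-1) g = b *\<^sub>C m2"
    unfolding a_def b_def using dehom_eq_iff[OF m(1) f(1)] dehom_eq_iff[OF m(2) f(2)] d by simp_all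
  define A where "A = a / (of_real (2 * cos \<phi>) * cis (- \<phi>))"
  define B where "B = b / (- of_real (2 * cos \<phi>) * cis \<phi>)"
  have c0: "complex_of_real (2 * cos \<phi>) \<noteq> 0" "cos \<phi> \<noteq> 0" using c by simp_all
  have gA: "gvec r \<phi> 1 g = (of_real (2 * cos \<phi>) * cis (- \<phi>)) *\<^sub>C A *\<^sub>C m1"
    and gB: "gvec r \<phi> (-1) g = (- of_real (2 * cos \<phi>) * cis \<phi>) *\<^sub>C B *\<^sub>C m2"
    unfolding cscale_assoc a b A_def B_def using c0 by (simp_all add: cis_neq_zero)
  note F = null_pair_of_frame[OF g r c gA gB]
  show thesis
  proof (rule that[OF _ F(2)])
    show "cnj A * B * herm m1 m2 = null_pairing \<phi>" using F(1) by (simp add: herm_cscale mult_ac)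
    show "cmod A = cmod (fst (gvec r \<phi> 1 g)) / (2 * cos \<phi> * cmod (fst m1))"
      unfolding A_def a_def using c by (simp add: norm_mult norm_divide)
  qed
qed

lemma frame_lines_pairing:
  fixes g :: "'n::{finite,linorder} aframe"
  assumes "g \<in> adapted_frames r" "r > 0" "cos \<phi> > 0" "fst m1 \<noteq> 0" "fst m2 \<noteq> 0"
    "dehom (gvec r \<phi> 1 g) = dehom m1" "dehom (gvec r \<phi> (-1) g) = dehom m2"
  shows "herm m1 m2 \<noteq> 0"
  using frame_lines[OF assms] null_pairing_nonzero[OF assms(3)] by (metis mult_zero_right)

text \<open>
  Once representatives \<open>N1\<close>, \<open>N2\<close> of the two null lines with product \<open>null_pairing\<close> are fixed, all
  others are obtained by scaling with \<open>A\<close> and \<open>1 / cnj A\<close>.  The modulus of \<open>A\<close> is the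
  parameter \<open>l\<close>; its argument is the phase that the Hopf fibration forgets.
\<close>

lemma frame_null_lines:
  fixes g :: "'n::{finite,linorder} aframe"
  assumes g: "g \<in> adapted_frames r" and r: "r > 0" and c: "cos \<phi> > 0"
    and N: "fst N1 \<noteq> 0" "fst N2 \<noteq> 0" "herm N1 N2 = null_pairing \<phi>"
    and d: "dehom (gvec r \<phi> 1 g) = dehom N1" "dehom (gvec r \<phi> (-1) g) = dehom N2"
    and l: "l = cmod (fst (gvec r \<phi> 1 g)) / (2 * cos \<phi> * cmod (fst N1))"
  shows "l > 0" "hopf (fst g) = hopf (Zvec r (of_real l *\<^sub>C N1) (of_real (1 / l) *\<^sub>C N2))"
proof -
  obtain A B where AB: "cnj A * B * herm N1 N2 = null_pairing \<phi>" "fst g = Zvec r (A *\<^sub>C N1) (B *\<^sub>C N2)" "cmod A = l"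
    using frame_lines[OF g r c N(1,2) d] l by metis
  have h: "cnj A * B = 1" using AB(1) null_pairing_nonzero[OF c] by (simp add: N(3))
  show l0: "l > 0" using h AB(3) by auto
  have cA: "cnj (cis (Arg A)) * cis (Arg A) = 1" by (simp add: cis_cnj cis_mult)
  have Al: "A = cis (Arg A) * of_real l" using rcis_cmod_Arg[of A] by (simp add: rcis_def AB(3) mult.commute)
  have "cis (Arg A) * (cnj (cis (Arg A)) * of_real l * B) = cis (Arg A)"
    using h by (subst (asm) Al) simp
  then have "(cnj (cis (Arg A)) * cis (Arg A)) * (of_real l * B) = cis (Arg A)"
    by (simp only: mult_ac)
  then have B: "B = cis (Arg A) * of_real (1 / l)"
    unfolding cA using l0 by (simp add: field_simps)
  define Z where "Z = Zvec r (of_real l *\<^sub>C N1) (of_real (1 / l) *\<^sub>C N2)"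
  have fg: "fst g = cis (Arg A) *\<^sub>C Z"
    unfolding AB(2) Z_def Zvec_cscale[symmetric] cscale_assoc B[symmetric] Al[symmetric] ..
  then have "Z = cis (- Arg A) *\<^sub>C fst g" by (simp add: cscale_assoc)
  then have "Z \<in> Q r"
    using adaptedD(1)[OF g r] cisomD(4)[OF cisom_phase, of "- Arg A" "fst g" "fst g"] unfolding Q_iff by simp
  then show "hopf (fst g) = hopf (Zvec r (of_real l *\<^sub>C N1) (of_real (1 / l) *\<^sub>C N2))"
    using hopf_eq_iff[OF _ adaptedD(1)[OF g r] r] fg unfolding Z_def by metis
qed

lemma lift_leaf:
  fixes g :: "'n::{finite,linorder} aframe"
  assumes rs: "r > 0" "s\<^sup>2 = 1" and l: "l \<in> leaf_space r \<phi> s"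
    and n: "n \<in> null_cone" "cline n = gamma r \<phi> s l" and g: "g \<in> adapted_frames r"
  shows "leaf r \<phi> s (frame_proj r g) = l \<longleftrightarrow> dehom (gvec r \<phi> s g) = dehom n"
proof -
  obtain f where f: "f \<in> frames r" "l = leaf r \<phi> s f"
    using l unfolding leaf_space_def by (rule imageE)
  obtain h where h: "h \<in> adapted_frames r" "l = leaf r \<phi> s (frame_proj r h)"
    using f unfolding frames_eq[OF rs(1)] by blast
  have "cline n = cline (gvec r \<phi> s h)" using n h gamma_leaf[OF rs h(1)] by simp
  moreover have "fst n \<noteq> 0" using n(1) null_fst unfolding null_cone_iff by blast
  ultimately have "dehom n = dehom (gvec r \<phi> s h)" using cline_eq_iff herm_gvec(5)[OF h(1) rs] by blast
  then show ?thesis using leaf_eq_iff[OF rs g h(1)] h(2) by simp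
qed

section \<open>The image of the parametrisation\<close>

lemma hopf_lift_eq:
  "hopf_lift r n1 n2 \<tau> p l = Zvec r (of_real l *\<^sub>C cnj (\<tau> p) *\<^sub>C n1 (fst p)) (of_real (1 / l) *\<^sub>C \<tau> p *\<^sub>C n2 (snd p))"
  unfolding hopf_lift_def Zvec_def
  by (rule cvec_eqI) (simp_all add: algebra_simps scaleR_conv_of_real[where 'a=complex])

lemma null_pairing_tan:
  assumes "cos \<phi> > 0"
  shows "null_pairing \<phi> = (1 - \<i> * of_real (tan \<phi>)) / 2"
  using assms by (simp add: null_pairing_def complex_eq_iff tan_def)

text \<open>The parameters \<open>p\<close> and \<open>l\<close> correspond to the pairs of vectors in the two null lines with
  product \<open>null_pairing\<close>, and these to the frames with the two null lines, up to a rotation of all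
  other frame vectors, which does not move the base point.\<close>

lemma hopf_lift_image:
  fixes N1 N2 :: "'n::{finite,linorder} frame set set"
  assumes r: "r > 0" and c: "cos \<phi> > 0"
    and N1: "N1 \<subseteq> leaf_space r \<phi> 1" "\<And>l. l \<in> N1 \<Longrightarrow> n1 l \<in> null_cone \<and> cline (n1 l) = gamma r \<phi> 1 l"
    and N2: "N2 \<subseteq> leaf_space r \<phi> (-1)" "\<And>l. l \<in> N2 \<Longrightarrow> n2 l \<in> null_cone \<and> cline (n2 l) = gamma r \<phi> (-1) l"
    and U: "U = {(p1, p2). p1 \<in> N1 \<and> p2 \<in> N2 \<and> herm (n1 p1) (n2 p2) \<noteq> 0}"
    and \<tau>: "\<And>p1 p2. (p1, p2) \<in> U \<Longrightarrow> (\<tau> (p1, p2))\<^sup>2 = (1 - \<i> * of_real (tan \<phi>)) / (2 * herm (n1 p1) (n2 p2))"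
  shows "p \<in> U \<Longrightarrow> l > 0 \<Longrightarrow> hopf_lift r n1 n2 \<tau> p l \<in> Q r"
    and "{hopf (hopf_lift r n1 n2 \<tau> p l) | p l. p \<in> U \<and> l > 0} = base_point ` R_set r \<phi> N1 N2"
proof -
  have N: "herm (cnj (\<tau> p) *\<^sub>C n1 (fst p)) (\<tau> p *\<^sub>C n2 (snd p)) = null_pairing \<phi>" if p: "p \<in> U" for p
  proof -
    have "herm (n1 (fst p)) (n2 (snd p)) \<noteq> 0" using p by (auto simp: U)
    moreover have "(\<tau> p)\<^sup>2 = (1 - \<i> * of_real (tan \<phi>)) / (2 * herm (n1 (fst p)) (n2 (snd p)))"
      using \<tau>[of "fst p" "snd p"] p by simp
    ultimately show ?thesis
      unfolding null_pairing_tan[OF c] by (simp add: herm_cscale power2_eq_square flip: mult.assoc)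
  qed
  have \<tau>0: "\<tau> p \<noteq> 0" if "p \<in> U" for p
    using N[OF that] null_pairing_nonzero[OF c] by auto
  have null: "herm (n1 (fst p)) (n1 (fst p)) = 0" "herm (n2 (snd p)) (n2 (snd p)) = 0" if "p \<in> U" for p
    using N1(2) N2(2) that by (auto simp: U null_cone_iff)
  have pair: "herm (of_real l *\<^sub>C cnj (\<tau> p) *\<^sub>C n1 (fst p)) (of_real l *\<^sub>C cnj (\<tau> p) *\<^sub>C n1 (fst p)) = 0"
    "herm (of_real (1 / l) *\<^sub>C \<tau> p *\<^sub>C n2 (snd p)) (of_real (1 / l) *\<^sub>C \<tau> p *\<^sub>C n2 (snd p)) = 0"
    "herm (of_real l *\<^sub>C cnj (\<tau> p) *\<^sub>C n1 (fst p)) (of_real (1 / l) *\<^sub>C \<tau> p *\<^sub>C n2 (snd p)) = null_pairing \<phi>"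
    if "p \<in> U" "l > 0" for p l
    using null[OF that(1)] N[OF that(1)] that(2) by (simp_all add: herm_cscale)
  show lift: "hopf_lift r n1 n2 \<tau> p l \<in> Q r" if "p \<in> U" "l > 0" for p l
    unfolding hopf_lift_eq by (rule Zvec_Uvec_unitary(1)[OF r c pair[OF that]])
  show "{hopf (hopf_lift r n1 n2 \<tau> p l) | p l. p \<in> U \<and> l > 0} = base_point ` R_set r \<phi> N1 N2"
  proof (intro equalityI subsetI)
    fix x assume "x \<in> {hopf (hopf_lift r n1 n2 \<tau> p l) | p l. p \<in> U \<and> l > 0}"
    then obtain p l where pl: "p \<in> U" "l > 0" and x: "x = hopf (hopf_lift r n1 n2 \<tau> p l)" by blast
    have p12: "fst p \<in> N1" "snd p \<in> N2" using pl(1) by (auto simp: U)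
    obtain g where g: "g \<in> adapted_frames r" "fst g = hopf_lift r n1 n2 \<tau> p l"
      "gvec r \<phi> 1 g = (of_real (2 * cos \<phi>) * cis (- \<phi>)) *\<^sub>C of_real l *\<^sub>C cnj (\<tau> p) *\<^sub>C n1 (fst p)"
      "gvec r \<phi> (-1) g = (- of_real (2 * cos \<phi>) * cis \<phi>) *\<^sub>C of_real (1 / l) *\<^sub>C \<tau> p *\<^sub>C n2 (snd p)"
      using frame_of_null_pair[OF r c pair[OF pl]] unfolding hopf_lift_eq by metis
    have "dehom (gvec r \<phi> 1 g) = dehom (n1 (fst p))" "dehom (gvec r \<phi> (-1) g) = dehom (n2 (snd p))"
      unfolding g(3,4) using c pl(2) \<tau>0[OF pl(1)] by (simp_all add: cis_neq_zero)
    then have "leaf r \<phi> 1 (frame_proj r g) = fst p" "leaf r \<phi> (-1) (frame_proj r g) = snd p"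
      using lift_leaf[OF r, of 1 "fst p" \<phi> "n1 (fst p)" g] lift_leaf[OF r, of "-1" "snd p" \<phi> "n2 (snd p)" g]
        N1 N2 p12 g(1) by auto
    then have "frame_proj r g \<in> R_set r \<phi> N1 N2" using g(1) frames_eq[OF r] p12 by (auto simp: R_set_def)
    moreover have "base_point (frame_proj r g) = x" by (simp add: base_point_def frame_proj_def x g(2))
    ultimately show "x \<in> base_point ` R_set r \<phi> N1 N2" by blast
  next
    fix x assume "x \<in> base_point ` R_set r \<phi> N1 N2"
    then obtain f where f: "f \<in> frames r" "leaf r \<phi> 1 f \<in> N1" "leaf r \<phi> (-1) f \<in> N2" "x = base_point f"
      by (auto simp: R_set_def)
    then obtain g where g: "g \<in> adapted_frames r" "f = frame_proj r g" using frames_eq[OF r] by blast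
    define p where "p = (leaf r \<phi> 1 f, leaf r \<phi> (-1) f)"
    have m: "fst (n1 (fst p)) \<noteq> 0" "fst (n2 (snd p)) \<noteq> 0"
      using N1(2)[OF f(2)] N2(2)[OF f(3)] null_fst unfolding p_def fst_conv snd_conv null_cone_iff by blast+
    have d: "dehom (gvec r \<phi> 1 g) = dehom (n1 (fst p))" "dehom (gvec r \<phi> (-1) g) = dehom (n2 (snd p))"
      using lift_leaf[OF r, of 1 "fst p" \<phi> "n1 (fst p)" g] lift_leaf[OF r, of "-1" "snd p" \<phi> "n2 (snd p)" g]
        N1 N2 f g by (auto simp: p_def)
    have pU: "p \<in> U" using frame_lines_pairing[OF g(1) r c m d] f by (simp add: U p_def)
    define l where "l = cmod (fst (gvec r \<phi> 1 g)) / (2 * cos \<phi> * cmod (fst (cnj (\<tau> p) *\<^sub>C n1 (fst p))))"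
    have "fst (cnj (\<tau> p) *\<^sub>C n1 (fst p)) \<noteq> 0" "fst (\<tau> p *\<^sub>C n2 (snd p)) \<noteq> 0" using m \<tau>0[OF pU] by simp_all
    from frame_null_lines[OF g(1) r c this N[OF pU] _ _ l_def]
    have "l > 0" "hopf (fst g) = hopf (hopf_lift r n1 n2 \<tau> p l)"
      using d \<tau>0[OF pU] unfolding hopf_lift_eq by simp_all
    moreover have "x = hopf (fst g)" by (simp add: f(4) g(2) base_point_def frame_proj_def)
    ultimately show "x \<in> {hopf (hopf_lift r n1 n2 \<tau> p l) | p l. p \<in> U \<and> l > 0}" using pU by blast
  qed
qed

section \<open>Smooth maps\<close>

lemma has_frechet_derivative: "f differentiable (at x) \<Longrightarrow> (f has_derivative frechet_derivative f (at x)) (at x)"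
  by (simp add: frechet_derivative_works)

lemma frechet_eqI: "(f has_derivative f') (at x) \<Longrightarrow> frechet_derivative f (at x) = f'"
  using frechet_derivative_at by metis

lemma Ck_on_cong:
  assumes "open S" "\<And>x. x \<in> S \<Longrightarrow> f x = g x" "Ck_on k f S"
  shows "Ck_on k g S"
  using assms(2,3)
proof (induction k arbitrary: f g)
  case 0
  then show ?case by (simp cong: continuous_on_cong)
next
  case (Suc k)
  have d: "(g has_derivative frechet_derivative f (at x)) (at x)" if "x \<in> S" for x
    by (rule has_derivative_transform_within_open[OF has_frechet_derivative assms(1)])
       (use Suc that in auto)
  have "Ck_on k (\<lambda>x. frechet_derivative g (at x) v) S" for v
  proof (rule Suc.IH)
    show "Ck_on k (\<lambda>x. frechet_derivative f (at x) v) S" using Suc by simp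
    show "frechet_derivative f (at x) v = frechet_derivative g (at x) v" if "x \<in> S" for x
      using frechet_eqI[OF d[OF that]] by simp
  qed
  then show ?case using d by (auto simp: differentiable_def)
qed

lemma Ck_on_SucI:
  assumes "open S" "\<And>x. x \<in> S \<Longrightarrow> (f has_derivative f' x) (at x)" "\<And>v. Ck_on k (\<lambda>x. f' x v) S"
  shows "Ck_on (Suc k) f S"
proof -
  have "Ck_on k (\<lambda>x. frechet_derivative f (at x) v) S" for v
    by (rule Ck_on_cong[OF assms(1) _ assms(3)[of v]]) (simp add: frechet_eqI[OF assms(2)])
  then show ?thesis using assms(2) by (auto simp: differentiable_def)
qed

lemma Ck_on_SucD:
  assumes "Ck_on (Suc k) f S"
  shows "x \<in> S \<Longrightarrow> (f has_derivative frechet_derivative f (at x)) (at x)" "Ck_on k (\<lambda>x. frechet_derivative f (at x) v) S"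
  using assms by (simp_all add: has_frechet_derivative)

lemma Ck_on_imp_continuous: "Ck_on k f S \<Longrightarrow> continuous_on S f"
  by (cases k) (auto simp: differentiable_imp_continuous_on differentiable_on_def
    intro!: continuous_at_imp_continuous_on differentiable_imp_continuous_within)

lemma Ck_on_lower: "Ck_on (Suc k) f S \<Longrightarrow> Ck_on k f S"
proof (induction k arbitrary: f)
  case 0
  then show ?case using Ck_on_imp_continuous[OF 0] by simp
next
  case (Suc k)
  then show ?case by auto
qed

lemma Ck_on_subset: "Ck_on k f S \<Longrightarrow> T \<subseteq> S \<Longrightarrow> Ck_on k f T"
  by (induction k arbitrary: f) (auto intro: continuous_on_subset)

lemma Ck_on_const: "Ck_on k (\<lambda>x. c) S"
  by (induction k arbitrary: c) auto

lemma Ck_on_add: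
  assumes "open S"
  shows "Ck_on k f S \<Longrightarrow> Ck_on k g S \<Longrightarrow> Ck_on k (\<lambda>x. f x + g x) S"
proof (induction k arbitrary: f g)
  case 0
  then show ?case by (simp add: continuous_on_add)
next
  case (Suc k)
  show ?case
    by (rule Ck_on_SucI[OF assms has_derivative_add[OF Ck_on_SucD(1)[OF Suc.prems(1)] Ck_on_SucD(1)[OF Suc.prems(2)]]])
       (auto intro: Suc.IH Ck_on_SucD(2)[OF Suc.prems(1)] Ck_on_SucD(2)[OF Suc.prems(2)])
qed

lemma Ck_on_bilinear:
  assumes "open S" and B: "bounded_bilinear B"
  shows "Ck_on k f S \<Longrightarrow> Ck_on k g S \<Longrightarrow> Ck_on k (\<lambda>x. B (f x) (g x)) S"
proof (induction k arbitrary: f g)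
  case 0
  then show ?case by (simp add: bounded_bilinear.continuous_on[OF B])
next
  case (Suc k)
  show ?case
    by (rule Ck_on_SucI[OF assms(1) bounded_bilinear.FDERIV[OF B Ck_on_SucD(1)[OF Suc.prems(1)] Ck_on_SucD(1)[OF Suc.prems(2)]]])
       (auto intro!: Ck_on_add[OF assms(1)] Suc.IH Ck_on_lower[OF Suc.prems(1)] Ck_on_lower[OF Suc.prems(2)]
         Ck_on_SucD(2)[OF Suc.prems(1)] Ck_on_SucD(2)[OF Suc.prems(2)])
qed

lemma Ck_on_linear:
  assumes "open S" and L: "bounded_linear L"
  shows "Ck_on k f S \<Longrightarrow> Ck_on k (\<lambda>x. L (f x)) S"
proof (induction k arbitrary: f)
  case 0
  then show ?case by (simp add: bounded_linear.continuous_on[OF L])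
next
  case (Suc k)
  show ?case
    by (rule Ck_on_SucI[OF assms(1) bounded_linear.has_derivative[OF L Ck_on_SucD(1)[OF Suc.prems]]])
       (auto intro!: Suc.IH Ck_on_SucD(2)[OF Suc.prems])
qed

lemma Ck_on_ident: "open S \<Longrightarrow> Ck_on k (\<lambda>x. x) S"
  by (cases k) (auto intro!: Ck_on_SucI Ck_on_const derivative_eq_intros)

lemma Ck_on_inverse:
  fixes f :: "'a::real_normed_vector \<Rightarrow> 'b::real_normed_field"
  assumes "open S" "\<And>x. x \<in> S \<Longrightarrow> f x \<noteq> 0"
  shows "Ck_on k f S \<Longrightarrow> Ck_on k (\<lambda>x. inverse (f x)) S"
proof (induction k)
  case 0
  then show ?case using assms(2) by (auto intro!: continuous_on_inverse)
next
  case (Suc k)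
  have inv: "Ck_on k (\<lambda>x. inverse (f x)) S" by (rule Suc.IH[OF Ck_on_lower[OF Suc.prems]])
  show ?case
  proof (rule Ck_on_SucI[OF assms(1) Deriv.has_derivative_inverse[OF assms(2) Ck_on_SucD(1)[OF Suc.prems]]])
    fix v
    have "Ck_on k (\<lambda>x. (-1) *\<^sub>R (inverse (f x) * frechet_derivative f (at x) v * inverse (f x))) S"
      by (intro Ck_on_linear[OF assms(1) bounded_linear_scaleR_right] Ck_on_bilinear[OF assms(1) bounded_bilinear_mult] inv
          Ck_on_SucD(2)[OF Suc.prems])
    then show "Ck_on k (\<lambda>x. - (inverse (f x) * frechet_derivative f (at x) v * inverse (f x))) S" by simp
  qed
qed

lemma Ck_on_compose_linear:
  assumes "open S" and L: "bounded_linear L" and W: "open W" "L ` W \<subseteq> S"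
  shows "Ck_on k f S \<Longrightarrow> Ck_on k (\<lambda>x. f (L x)) W"
proof (induction k arbitrary: f)
  case 0
  then show ?case
    using W by (auto intro!: continuous_on_compose2[OF _ linear_continuous_on[OF L]])
next
  case (Suc k)
  have d: "((\<lambda>x. f (L x)) has_derivative (\<lambda>v. frechet_derivative f (at (L x)) (L v))) (at x)" if "x \<in> W" for x
    using diff_chain_at[OF bounded_linear_imp_has_derivative[OF L] Ck_on_SucD(1)[OF Suc.prems]] W that
    by (auto simp: o_def)
  show ?case
    by (rule Ck_on_SucI[OF W(1) d]) (auto intro: Suc.IH Ck_on_SucD(2)[OF Suc.prems])
qed

lemma smooth_onD:
  assumes "smooth_on f S"
  shows "open S" "\<And>x. x \<in> S \<Longrightarrow> (f has_derivative frechet_derivative f (at x)) (at x)"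
    "continuous_on S f" "\<And>v. continuous_on S (\<lambda>x. frechet_derivative f (at x) v)"
proof -
  have C: "Ck_on k f S" for k using assms by (simp add: smooth_on_def)
  show "open S" using assms by (simp add: smooth_on_def)
  show "\<And>x. x \<in> S \<Longrightarrow> (f has_derivative frechet_derivative f (at x)) (at x)" by (rule Ck_on_SucD(1)[OF C])
  show "continuous_on S f" by (rule Ck_on_imp_continuous[OF C])
  show "continuous_on S (\<lambda>x. frechet_derivative f (at x) v)" for v
    by (rule Ck_on_imp_continuous[OF Ck_on_SucD(2)[OF C]])
qed

lemma smooth_on_subset: "smooth_on f S \<Longrightarrow> open T \<Longrightarrow> T \<subseteq> S \<Longrightarrow> smooth_on f T"
  by (auto simp: smooth_on_def intro: Ck_on_subset)

lemma smooth_on_add: "smooth_on f S \<Longrightarrow> smooth_on g S \<Longrightarrow> smooth_on (\<lambda>x. f x + g x) S"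
  by (auto simp: smooth_on_def intro: Ck_on_add)

lemma smooth_on_bilinear: "bounded_bilinear B \<Longrightarrow> smooth_on f S \<Longrightarrow> smooth_on g S \<Longrightarrow> smooth_on (\<lambda>x. B (f x) (g x)) S"
  by (auto simp: smooth_on_def intro: Ck_on_bilinear)

lemma smooth_on_linear: "bounded_linear L \<Longrightarrow> smooth_on f S \<Longrightarrow> smooth_on (\<lambda>x. L (f x)) S"
  by (auto simp: smooth_on_def intro: Ck_on_linear)

lemma smooth_on_const: "open S \<Longrightarrow> smooth_on (\<lambda>x. c) S"
  by (auto simp: smooth_on_def intro: Ck_on_const)

lemma smooth_on_linear_map: "bounded_linear L \<Longrightarrow> open S \<Longrightarrow> smooth_on L S"
  using smooth_on_linear[of L "\<lambda>x. x" S] by (simp add: smooth_on_def Ck_on_ident)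

lemma smooth_on_inverse:
  fixes f :: "'a::real_normed_vector \<Rightarrow> 'b::real_normed_field"
  shows "smooth_on f S \<Longrightarrow> (\<And>x. x \<in> S \<Longrightarrow> f x \<noteq> 0) \<Longrightarrow> smooth_on (\<lambda>x. inverse (f x)) S"
  by (auto simp: smooth_on_def intro: Ck_on_inverse)

lemma smooth_on_compose_linear:
  "smooth_on f S \<Longrightarrow> bounded_linear L \<Longrightarrow> open W \<Longrightarrow> L ` W \<subseteq> S \<Longrightarrow> smooth_on (\<lambda>x. f (L x)) W"
  by (auto simp: smooth_on_def intro: Ck_on_compose_linear)

lemma smooth_on_dehom:
  fixes f :: "'a::real_normed_vector \<Rightarrow> 'n::finite cvec"
  assumes "smooth_on f S" "\<And>x. x \<in> S \<Longrightarrow> fst (f x) \<noteq> 0"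
  shows "smooth_on (\<lambda>x. dehom (f x)) S"
  unfolding dehom_def
  by (intro smooth_on_bilinear[OF bounded_bilinear_cscale] smooth_on_inverse smooth_on_linear[OF bounded_linear_fst] assms)

section \<open>Immersions\<close>

text \<open>Near a point where the derivative is injective on a subspace, a continuously differentiable map
  expands distances, up to a factor, along that subspace: it differs from its derivative by a map
  with small Lipschitz constant.\<close>

lemma immersion_lower_bound:
  fixes F :: "'a::euclidean_space \<Rightarrow> 'b::euclidean_space"
  assumes F: "smooth_on F W" and x0: "x0 \<in> W" and T: "subspace T"
    and inj: "\<And>v. v \<in> T \<Longrightarrow> frechet_derivative F (at x0) v = 0 \<Longrightarrow> v = 0"
  obtains c d where "c > 0" "d > 0" "ball x0 d \<subseteq> W"
    "\<And>x y. x \<in> ball x0 d \<Longrightarrow> y \<in> ball x0 d \<Longrightarrow> x - y \<in> T \<Longrightarrow> c * norm (x - y) \<le> norm (F x - F y)"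
proof -
  note S = smooth_onD[OF F]
  define D where "D x = frechet_derivative F (at x)" for x
  have bl: "bounded_linear (D x)" if "x \<in> W" for x
    using S(2)[OF that] unfolding D_def by (rule has_derivative_bounded_linear)
  obtain e where e: "e > 0" "\<And>v. v \<in> T \<Longrightarrow> e * norm v \<le> norm (D x0 v)"
    using injective_imp_isometric[OF closed_subspace[OF T] T bl[OF x0]] inj by (auto simp: D_def)
  define \<epsilon> where "\<epsilon> = e / (2 * DIM('a))"
  have \<epsilon>: "\<epsilon> > 0" using e by (simp add: \<epsilon>_def)
  have "\<forall>\<^sub>F x in nhds x0. x \<in> W \<and> (\<forall>b\<in>Basis. dist (D x b) (D x0 b) < \<epsilon>)"
  proof (intro eventually_conj eventually_ball_finite finite_Basis ballI)
    show "\<forall>\<^sub>F x in nhds x0. x \<in> W" using S(1) x0 by (rule eventually_nhds_in_open)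
    show "\<forall>\<^sub>F x in nhds x0. dist (D x b) (D x0 b) < \<epsilon>" for b
    proof -
      have "isCont (\<lambda>x. D x b) x0"
        unfolding D_def using S(4)[of b] S(1) x0 by (simp add: continuous_on_eq_continuous_at)
      then have "((\<lambda>x. D x b) \<longlongrightarrow> D x0 b) (nhds x0)" using tendsto_at_iff_tendsto_nhds[of "\<lambda>x. D x b" x0] by (simp add: isCont_def)
      then show ?thesis using \<epsilon> by (rule tendstoD)
    qed
  qed
  then obtain d where d: "d > 0" "\<And>x. dist x x0 < d \<Longrightarrow> x \<in> W \<and> (\<forall>b\<in>Basis. dist (D x b) (D x0 b) < \<epsilon>)"
    unfolding eventually_nhds_metric by blast
  have on: "onorm (\<lambda>v. D x v - D x0 v) \<le> e / 2" if x: "x \<in> ball x0 d" for x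
  proof (rule onorm_le)
    fix v
    have xd: "dist x x0 < d" using x by (simp add: dist_commute)
    have l: "linear (\<lambda>v. D x v - D x0 v)"
      using bl d(2)[OF xd] x0 by (intro linear_compose_sub bounded_linear.linear) auto
    have "D x v - D x0 v = (\<Sum>b\<in>Basis. (v \<bullet> b) *\<^sub>R (D x b - D x0 b))"
    proof -
      define E where "E v = D x v - D x0 v" for v
      have lE: "linear E" using l by (simp add: E_def[abs_def])
      have "E v = E (\<Sum>b\<in>Basis. (v \<bullet> b) *\<^sub>R b)" by (simp only: euclidean_representation)
      also have "\<dots> = (\<Sum>b\<in>Basis. (v \<bullet> b) *\<^sub>R E b)" by (simp only: linear_sum[OF lE] linear_cmul[OF lE])
      finally show ?thesis by (simp only: E_def)
    qed
    then have "norm (D x v - D x0 v) = norm (\<Sum>b\<in>Basis. (v \<bullet> b) *\<^sub>R (D x b - D x0 b))" by (rule arg_cong)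
    also have "\<dots> \<le> (\<Sum>b\<in>(Basis::'a set). norm v * \<epsilon>)"
    proof (rule sum_norm_le)
      fix b :: 'a assume b: "b \<in> Basis"
      have "norm (D x b - D x0 b) \<le> \<epsilon>" using d(2)[OF xd] b by (simp add: dist_norm less_imp_le)
      then show "norm ((v \<bullet> b) *\<^sub>R (D x b - D x0 b)) \<le> norm v * \<epsilon>"
        using Basis_le_norm[OF b, of v] \<epsilon> by (simp add: mult_mono)
    qed
    also have "\<dots> = e / 2 * norm v" by (simp add: \<epsilon>_def)
    finally show "norm (D x v - D x0 v) \<le> e / 2 * norm v" .
  qed
  show thesis
  proof (rule that[of "e / 2" d])
    show "ball x0 d \<subseteq> W" using d(2) by (auto simp: dist_commute)
    fix x y assume xy: "x \<in> ball x0 d" "y \<in> ball x0 d" "x - y \<in> T"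
    have "norm ((F x - D x0 x) - (F y - D x0 y)) \<le> e / 2 * norm (x - y)"
    proof (rule differentiable_bound[OF convex_ball _ on xy(1,2)])
      fix z assume "z \<in> ball x0 d"
      then have "z \<in> W" using d(2) by (auto simp: dist_commute)
      then show "((\<lambda>x. F x - D x0 x) has_derivative (\<lambda>v. D z v - D x0 v)) (at z within ball x0 d)"
        unfolding D_def[of z]
        by (intro has_derivative_diff has_derivative_at_withinI[OF S(2)] bounded_linear_imp_has_derivative bl x0)
    qed
    moreover have "D x0 (x - y) = D x0 x - D x0 y" by (rule linear_diff[OF bounded_linear.linear[OF bl[OF x0]]])
    then have "(F x - D x0 x) - (F y - D x0 y) = (F x - F y) - D x0 (x - y)" by simp
    ultimately have "norm ((F x - F y) - D x0 (x - y)) \<le> e / 2 * norm (x - y)" by (simp only:)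
    moreover have "norm (D x0 (x - y)) \<le> norm (F x - F y) + norm ((F x - F y) - D x0 (x - y))"
      by (metis norm_triangle_sub add.commute norm_minus_commute)
    ultimately show "e / 2 * norm (x - y) \<le> norm (F x - F y)" using e(2)[OF xy(3)] by simp
  qed (use e d in simp_all)
qed

text \<open>Conversely, a map that expands distances has an injective derivative.  So injectivity of the derivative at
  one point is inherited by the points nearby.\<close>

lemma lower_bound_injective_derivative:
  fixes F :: "'a::real_normed_vector \<Rightarrow> 'b::real_normed_vector"
  assumes F: "(F has_derivative F') (at x)" and c: "c > 0" "d > 0" and T: "subspace T"
    and b: "\<And>y. y \<in> ball x d \<Longrightarrow> y - x \<in> T \<Longrightarrow> c * norm (y - x) \<le> norm (F y - F x)"
    and v: "v \<in> T" "F' v = 0"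
  shows "v = 0"
proof (rule ccontr)
  assume v0: "v \<noteq> 0"
  obtain e where e: "e > 0" "\<And>y. norm (y - x) < e \<Longrightarrow> norm (F y - F x - F' (y - x)) \<le> c / 2 * norm (y - x)"
    using F c unfolding has_derivative_at_alt by (metis half_gt_zero)
  define t where "t = min e d / (2 * norm v)"
  have t: "t > 0" using e c v0 by (simp add: t_def)
  define y where "y = x + t *\<^sub>R v"
  have n: "norm (y - x) = min e d / 2" using v0 e c by (simp add: y_def t_def)
  have "y - x \<in> T" using T v by (simp add: y_def subspace_scale)
  moreover have "F' (y - x) = 0" using linear_cmul[OF has_derivative_linear[OF F]] v by (simp add: y_def)
  moreover have "y \<in> ball x d" using n c e by (simp add: dist_norm norm_minus_commute)
  moreover have "norm (y - x) < e" using n c e by simp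
  ultimately have "c * norm (y - x) \<le> c / 2 * norm (y - x)" using b e(2) by (metis diff_zero order_trans)
  moreover have "norm (y - x) > 0" unfolding n using c e by simp
  ultimately show False using c by simp
qed

text \<open>A linear left inverse of the derivative turns the immersion into a perturbation of the identity.  As the curve is
  continuous, its increments are then comparable to those of its image.\<close>

lemma curve_through_immersion:
  fixes F :: "'a::euclidean_space \<Rightarrow> 'b::euclidean_space" and x :: "real \<Rightarrow> 'a"
  assumes F: "(F has_derivative F') (at (x t))" and T: "subspace T"
    and inj: "\<And>v. v \<in> T \<Longrightarrow> F' v = 0 \<Longrightarrow> v = 0"
    and x: "isCont x t" "\<forall>\<^sub>F s in at t. x s - x t \<in> T"
    and w: "((\<lambda>s. F (x s)) has_vector_derivative w) (at t)"
  obtains v where "v \<in> T" "(x has_vector_derivative v) (at t)"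
proof -
  have lF: "linear F'" by (rule has_derivative_linear[OF F])
  have "inj_on F' T"
  proof (rule inj_onI)
    fix u v assume "u \<in> T" "v \<in> T" "F' u = F' v"
    then have "u - v \<in> T" "F' (u - v) = 0" using T lF by (simp_all add: subspace_diff linear_diff)
    then show "u = v" using inj by fastforce
  qed
  then obtain g where g: "g ` UNIV \<subseteq> T" "linear g" "\<And>v. v \<in> T \<Longrightarrow> g (F' v) = v"
    using linear_exists_left_inverse_on[OF lF T] by auto
  have bg: "bounded_linear g" using g(2) linear_conv_bounded_linear by blast
  define H where "H y = g (F y)" for y
  have H: "(H has_derivative (\<lambda>v. g (F' v))) (at (x t))"
    unfolding H_def by (rule bounded_linear.has_derivative[OF bg F])
  define u where "u = g w"
  have hu: "((\<lambda>s. H (x s)) has_vector_derivative u) (at t)"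
    unfolding H_def u_def by (rule bounded_linear.has_vector_derivative[OF bg w])
  have hu': "((\<lambda>s. H (x s)) has_derivative (\<lambda>h. h *\<^sub>R u)) (at t)"
    using hu by (simp add: has_vector_derivative_def)
  have near: "\<forall>\<^sub>F s in at t. norm (H (x s) - H (x t) - (x s - x t)) \<le> e * norm (x s - x t)" if e0: "e > 0" for e
  proof -
    obtain d where d: "d > 0" "\<And>y. norm (y - x t) < d \<Longrightarrow> norm (H y - H (x t) - g (F' (y - x t))) \<le> e * norm (y - x t)"
      using H[unfolded has_derivative_at_alt, THEN conjunct2, rule_format, OF e0] by blast
    have "\<forall>\<^sub>F s in at t. dist (x s) (x t) < d" using x(1) d(1) unfolding isCont_def by (rule tendstoD)
    then show ?thesis using x(2)
    proof eventually_elim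
      case (elim s)
      then show ?case using d(2)[of "x s"] g(3) by (simp add: dist_norm)
    qed
  qed
  have near_t: "\<forall>\<^sub>F s in at t. norm (H (x s) - H (x t) - (s - t) *\<^sub>R u) \<le> e * norm (s - t)" if e0: "e > 0" for e
  proof -
    obtain d where "d > 0" "\<And>s. norm (s - t) < d \<Longrightarrow> norm (H (x s) - H (x t) - (s - t) *\<^sub>R u) \<le> e * norm (s - t)"
      using hu'[unfolded has_derivative_at_alt, THEN conjunct2, rule_format, OF e0] by blast
    then show ?thesis unfolding eventually_at by (metis dist_norm)
  qed
  have lip: "\<forall>\<^sub>F s in at t. norm (x s - x t) \<le> 2 * (norm u + 1) * norm (s - t)"
    using near[of "1/2", simplified] near_t[of 1, simplified]
  proof eventually_elim
    case (elim s)
    have "norm (x s - x t) \<le> norm (H (x s) - H (x t)) + norm (H (x s) - H (x t) - (x s - x t))"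
      by (metis norm_triangle_sub add.commute norm_minus_commute)
    moreover have "norm (H (x s) - H (x t)) \<le> norm ((s - t) *\<^sub>R u) + norm (H (x s) - H (x t) - (s - t) *\<^sub>R u)"
      by (rule norm_triangle_sub)
    ultimately have "norm (x s - x t) \<le> \<bar>s - t\<bar> * norm u + \<bar>s - t\<bar> + norm (x s - x t) / 2" using elim by simp
    then show ?case by (simp add: algebra_simps)
  qed
  have "(x has_derivative (\<lambda>h. h *\<^sub>R u)) (at t)"
    unfolding has_derivative_at_alt
  proof (intro conjI allI impI)
    show "bounded_linear (\<lambda>h. h *\<^sub>R u)" by (rule bounded_linear_scaleR_left)
    fix e :: real assume e: "e > 0"
    define e' where "e' = e / (2 * (2 * (norm u + 1)))"
    have "norm u + 1 > 0" using norm_ge_zero[of u] by linarith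
    then have e': "e' > 0" "e' * (2 * (norm u + 1)) = e / 2" using e unfolding e'_def by (simp_all only: zero_less_divide_iff) (auto simp: divide_simps)
    have "\<forall>\<^sub>F s in at t. norm (x s - x t - (s - t) *\<^sub>R u) \<le> e * norm (s - t)"
      using near[OF e'(1)] near_t[OF half_gt_zero[OF e]] lip
    proof eventually_elim
      case (elim s)
      have "norm (x s - x t - (s - t) *\<^sub>R u) \<le> norm (H (x s) - H (x t) - (s - t) *\<^sub>R u) + norm (H (x s) - H (x t) - (x s - x t))"
      proof -
        have "x s - x t - (s - t) *\<^sub>R u = (H (x s) - H (x t) - (s - t) *\<^sub>R u) - (H (x s) - H (x t) - (x s - x t))" by simp
        then show ?thesis by (metis norm_triangle_ineq4)
      qed
      also have "\<dots> \<le> e / 2 * norm (s - t) + e' * norm (x s - x t)" using elim(1,2) by simp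
      also have "e' * norm (x s - x t) \<le> e' * (2 * (norm u + 1) * norm (s - t))" using elim(3) e'(1) by (simp add: mult_left_mono)
      also have "\<dots> = e / 2 * norm (s - t)" unfolding e'(2)[symmetric] by (simp only: mult.assoc)
      finally show ?case by simp
    qed
    then obtain d where d: "d > 0" "\<And>s. s \<noteq> t \<Longrightarrow> dist s t < d \<Longrightarrow> norm (x s - x t - (s - t) *\<^sub>R u) \<le> e * norm (s - t)"
      unfolding eventually_at by blast
    have "norm (x s - x t - (s - t) *\<^sub>R u) \<le> e * norm (s - t)" if "norm (s - t) < d" for s
      using d(2)[of s] that by (cases "s = t") (auto simp: dist_norm)
    then show "\<exists>d>0. \<forall>s. norm (s - t) < d \<longrightarrow> norm (x s - x t - (s - t) *\<^sub>R u) \<le> e * norm (s - t)" using d(1) by blast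
  qed
  then have "(x has_vector_derivative u) (at t)" by (simp add: has_vector_derivative_def)
  moreover have "u \<in> T" using g(1) by (auto simp: u_def)
  ultimately show thesis using that by blast
qed

section \<open>Charts of Legendrian submanifolds in the null cone\<close>

text \<open>
  A local parametrisation of a Legendrian submanifold of a leaf space, composed with the
  identification of leaves and null lines and written in the affine chart.  The last clause says
  that it is a homeomorphism onto an open subset of the submanifold.
\<close>

definition null_chart ::
  "real \<Rightarrow> real \<Rightarrow> real \<Rightarrow> 'n::{finite,linorder} frame set set
    \<Rightarrow> 'n cvec set \<Rightarrow> 'n cvec set \<Rightarrow> ('n cvec \<Rightarrow> 'n cvec) \<Rightarrow> bool" where
  "null_chart r \<phi> s N W S m \<longleftrightarrow>
     subspace S \<and> smooth_on m W \<and> (\<forall>x\<in>W. fst (m x) = 1) \<and> (\<forall>x\<in>W \<inter> S. herm (m x) (m x) = 0) \<and>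
     inj_on m (W \<inter> S) \<and>
     (\<forall>x\<in>W \<inter> S. \<forall>v\<in>S. (frechet_derivative m (at x) v = 0 \<longrightarrow> v = 0) \<and> herm (m x) (frechet_derivative m (at x) v) = 0) \<and>
     (\<forall>V. open V \<and> V \<subseteq> W \<longrightarrow> (\<exists>A. openin (top_of_set (adapted_frames r)) {h \<in> adapted_frames r. leaf r \<phi> s (frame_proj r h) \<in> A} \<and>
       (\<forall>h\<in>adapted_frames r. leaf r \<phi> s (frame_proj r h) \<in> N \<inter> A \<longleftrightarrow> (\<exists>x\<in>V \<inter> S. dehom (gvec r \<phi> s h) = m x))))"

lemma null_chartD:
  assumes "null_chart r \<phi> s N W S m"
  shows "subspace S" "smooth_on m W" "\<And>x. x \<in> W \<Longrightarrow> fst (m x) = 1" "\<And>x. x \<in> W \<inter> S \<Longrightarrow> herm (m x) (m x) = 0"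
    "inj_on m (W \<inter> S)"
    "\<And>x v. x \<in> W \<inter> S \<Longrightarrow> v \<in> S \<Longrightarrow> frechet_derivative m (at x) v = 0 \<Longrightarrow> v = 0"
    "\<And>x v. x \<in> W \<inter> S \<Longrightarrow> v \<in> S \<Longrightarrow> herm (m x) (frechet_derivative m (at x) v) = 0"
    "\<And>V. open V \<Longrightarrow> V \<subseteq> W \<Longrightarrow> (\<exists>A. openin (top_of_set (adapted_frames r)) {h \<in> adapted_frames r. leaf r \<phi> s (frame_proj r h) \<in> A} \<and>
       (\<forall>h\<in>adapted_frames r. leaf r \<phi> s (frame_proj r h) \<in> N \<inter> A \<longleftrightarrow> (\<exists>x\<in>V \<inter> S. dehom (gvec r \<phi> s h) = m x)))"
  using assms by (simp_all add: null_chart_def)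

lemma inf_frame_of_param:
  fixes \<psi> :: "'a::real_normed_vector \<Rightarrow> 'n::finite aframe"
  assumes r: "r > 0" and D: "(\<psi> has_derivative D) (at x)" and W: "open W" "x \<in> W \<inter> S" and S: "subspace S"
    and P: "\<psi> ` (W \<inter> S) \<subseteq> adapted_frames r" and v: "v \<in> S"
  shows "inf_frame (\<psi> x) (D v)"
proof -
  let ?c = "\<lambda>t. \<psi> (x + t *\<^sub>R v)"
  have "((\<lambda>t. x + t *\<^sub>R v) has_derivative (\<lambda>t. t *\<^sub>R v)) (at 0)"
    by (auto intro!: derivative_eq_intros)
  moreover have "(\<psi> has_derivative D) (at (x + 0 *\<^sub>R v))" using D by simp
  ultimately have "(?c has_derivative (\<lambda>t. D (t *\<^sub>R v))) (at 0)"
    using diff_chain_at[of "\<lambda>t. x + t *\<^sub>R v" "\<lambda>t. t *\<^sub>R v" 0 \<psi> D] by (simp add: o_def)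
  then have d: "(?c has_vector_derivative D v) (at 0)"
    by (simp add: has_vector_derivative_def linear_cmul[OF has_derivative_linear[OF D]])
  have "open ((\<lambda>t. x + t *\<^sub>R v) -` W)" by (intro open_vimage W continuous_intros)
  moreover have "?c t \<in> adapted_frames r" if "t \<in> (\<lambda>t. x + t *\<^sub>R v) -` W" for t
    using that W S v P by (auto simp: subspace_add subspace_scale)
  ultimately have "inf_frame (?c 0) (D v)"
    using W(2) by (intro inf_frame_of_curve[OF r d, of "(\<lambda>t. x + t *\<^sub>R v) -` W"]) auto
  then show ?thesis by simp
qed

text \<open>A tangent vector lies in the kernel of the projection to the leaf space iff it does not move the null line,
  so \<open>m\<close> is an immersion; and \<open>kappa0\<close> is, up to a factor, the product of the null vector with its
  derivative.\<close>

lemma null_chart_exists: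
  fixes N :: "'n::{finite,linorder} frame set set"
  assumes rs: "r > 0" "s\<^sup>2 = 1" and N: "legendrian r \<phi> s d N" and l: "l \<in> N"
  obtains W S m x where "null_chart r \<phi> s N W S m" "dim S = d" "x \<in> W \<inter> S"
    "\<And>h. h \<in> adapted_frames r \<Longrightarrow> leaf r \<phi> s (frame_proj r h) = l \<longleftrightarrow> dehom (gvec r \<phi> s h) = m x"
proof -
  have "leaf_submanifold r \<phi> s d N" using N by (simp add: legendrian_def)
  then obtain W0 S \<psi> where lp: "leaf_param r \<phi> s d N W0 S \<psi>" and l': "l \<in> (leaf r \<phi> s \<circ> frame_proj r \<circ> \<psi>) ` (W0 \<inter> S)"
    using l unfolding leaf_submanifold_def by meson
  note lp' = lp[unfolded leaf_param_def local_param_def]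
  have S: "subspace S" "dim S = d" and sm: "smooth_on \<psi> W0" and P: "\<psi> ` (W0 \<inter> S) \<subseteq> adapted_frames r"
    and inj: "inj_on (leaf r \<phi> s \<circ> frame_proj r \<circ> \<psi>) (W0 \<inter> S)"
    using lp' by simp_all
  have top: "\<And>V. open V \<Longrightarrow> V \<subseteq> W0 \<Longrightarrow> \<exists>A. quot_open (adapted_frames r) (leaf r \<phi> s \<circ> frame_proj r) A \<and> (leaf r \<phi> s \<circ> frame_proj r \<circ> \<psi>) ` (V \<inter> S) = N \<inter> A"
    using lp' by blast
  have imm: "\<And>x v. x \<in> W0 \<inter> S \<Longrightarrow> v \<in> S \<Longrightarrow> frechet_derivative \<psi> (at x) v \<in> annihilated r \<phi> s (\<psi> x) \<Longrightarrow> v = 0"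
    using lp' by blast
  have leg: "kappa0 r \<phi> s (\<psi> x) (frechet_derivative \<psi> (at x) v) = 0" if "x \<in> W0 \<inter> S" "v \<in> S" for x v
    using N lp that unfolding legendrian_def by blast
  define \<gamma> where "\<gamma> x = gvec r \<phi> s (\<psi> x)" for x
  define m where "m x = dehom (\<gamma> x)" for x
  define W where "W = {x \<in> W0. fst (\<gamma> x) \<noteq> 0}"
  have s\<gamma>: "smooth_on \<gamma> W0" unfolding \<gamma>_def by (rule smooth_on_linear[OF bounded_linear_gvec sm])
  have W0: "open W0" by (rule smooth_onD(1)[OF sm])
  have "openin (top_of_set W0) (W0 \<inter> \<gamma> -` {v. fst v \<noteq> 0})"
    by (rule continuous_openin_preimage_gen[OF smooth_onD(3)[OF s\<gamma>]]) (auto intro!: open_Collect_neq continuous_intros)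
  moreover have "W0 \<inter> \<gamma> -` {v. fst v \<noteq> 0} = W" by (auto simp: W_def)
  ultimately have W: "open W" using W0 by (metis openin_open_trans)
  have ad: "\<psi> x \<in> adapted_frames r" if "x \<in> W0 \<inter> S" for x using P that by auto
  have WS: "W \<inter> S = W0 \<inter> S" using herm_gvec(5)[OF ad rs] by (auto simp: W_def \<gamma>_def)
  have dm: "(m has_derivative (\<lambda>v. ddehom (\<gamma> x) (gvec r \<phi> s (frechet_derivative \<psi> (at x) v)))) (at x)" if "x \<in> W" for x
  proof -
    have x: "x \<in> W0" "fst (\<gamma> x) \<noteq> 0" using that by (auto simp: W_def)
    have "(\<gamma> has_derivative (\<lambda>v. gvec r \<phi> s (frechet_derivative \<psi> (at x) v))) (at x)"
      unfolding \<gamma>_def by (rule bounded_linear.has_derivative[OF bounded_linear_gvec smooth_onD(2)[OF sm x(1)]])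
    from diff_chain_at[OF this has_derivative_dehom[OF x(2)]] show ?thesis by (simp add: o_def m_def[abs_def])
  qed
  have inf: "inf_frame (\<psi> x) (frechet_derivative \<psi> (at x) v)" if "x \<in> W0 \<inter> S" "v \<in> S" for x v
    using inf_frame_of_param[OF rs(1) smooth_onD(2)[OF sm] W0 that(1) S(1) P that(2)] that by blast
  have iff: "leaf r \<phi> s (frame_proj r h) = leaf r \<phi> s (frame_proj r (\<psi> x)) \<longleftrightarrow> dehom (gvec r \<phi> s h) = m x"
    if "x \<in> W0 \<inter> S" "h \<in> adapted_frames r" for x h
    using leaf_eq_iff[OF rs that(2) ad[OF that(1)]] by (simp add: m_def \<gamma>_def)
  have "null_chart r \<phi> s N W S m"
    unfolding null_chart_def
  proof (intro conjI ballI allI impI)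
    show "subspace S" by fact
    show "smooth_on m W"
      unfolding m_def by (rule smooth_on_dehom[OF smooth_on_subset[OF s\<gamma> W]]) (auto simp: W_def)
    show "fst (m x) = 1" if "x \<in> W" for x using that by (simp add: m_def W_def)
    show "herm (m x) (m x) = 0" if "x \<in> W \<inter> S" for x
      using herm_gvec(4)[OF ad rs] that WS by (simp add: m_def \<gamma>_def dehom_def herm_cscale)
    show "inj_on m (W \<inter> S)"
    proof (rule inj_onI)
      fix x y assume "x \<in> W \<inter> S" "y \<in> W \<inter> S" "m x = m y"
      then have xy: "x \<in> W0 \<inter> S" "y \<in> W0 \<inter> S" and "dehom (gvec r \<phi> s (\<psi> x)) = m y" unfolding WS by (simp_all add: m_def \<gamma>_def)
      then have "(leaf r \<phi> s \<circ> frame_proj r \<circ> \<psi>) x = (leaf r \<phi> s \<circ> frame_proj r \<circ> \<psi>) y"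
        using iff[OF xy(2) ad[OF xy(1)]] by simp
      then show "x = y" by (rule inj_onD[OF inj _ xy])
    qed
    fix x v assume "x \<in> W \<inter> S" and v: "v \<in> S"
    then have x: "x \<in> W0 \<inter> S" "x \<in> W" using WS by auto
    note [simp] = frechet_eqI[OF dm[OF x(2)]]
    have f0: "fst (\<gamma> x) \<noteq> 0" using x by (auto simp: W_def)
    show "v = 0" if "frechet_derivative m (at x) v = 0"
    proof (rule imm[OF x(1) v])
      show "frechet_derivative \<psi> (at x) v \<in> annihilated r \<phi> s (\<psi> x)"
        unfolding annihilated_iff[OF rs(1) ad[OF x(1)] inf[OF x(1) v] rs(2)]
        using that ddehom_eq_0_iff[OF f0] by (simp add: \<gamma>_def)
    qed
    have "herm (\<gamma> x) (gvec r \<phi> s (frechet_derivative \<psi> (at x) v)) = 0"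
      using kappa0_eq[OF rs(1) ad[OF x(1)] inf[OF x(1) v] rs(2), of \<phi>] leg[OF x(1) v] by (simp add: \<gamma>_def)
    moreover have "herm (\<gamma> x) (\<gamma> x) = 0" using herm_gvec(4)[OF ad[OF x(1)] rs] by (simp add: \<gamma>_def)
    ultimately show "herm (m x) (frechet_derivative m (at x) v) = 0"
      by (simp add: m_def dehom_def ddehom_def herm_cscale herm_diff)
  next
    fix V assume V: "open V \<and> V \<subseteq> W"
    then have "V \<subseteq> W0" by (auto simp: W_def)
    then obtain A where A: "quot_open (adapted_frames r) (leaf r \<phi> s \<circ> frame_proj r) A"
      "(leaf r \<phi> s \<circ> frame_proj r \<circ> \<psi>) ` (V \<inter> S) = N \<inter> A" using top V by blast
    have "leaf r \<phi> s (frame_proj r h) \<in> N \<inter> A \<longleftrightarrow> (\<exists>x\<in>V \<inter> S. dehom (gvec r \<phi> s h) = m x)"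
      if h: "h \<in> adapted_frames r" for h
    proof -
      have "leaf r \<phi> s (frame_proj r h) \<in> N \<inter> A \<longleftrightarrow> (\<exists>x\<in>V \<inter> S. leaf r \<phi> s (frame_proj r h) = leaf r \<phi> s (frame_proj r (\<psi> x)))"
        unfolding A(2)[symmetric] by auto
      also have "\<dots> \<longleftrightarrow> (\<exists>x\<in>V \<inter> S. dehom (gvec r \<phi> s h) = m x)"
        using iff[OF _ h] \<open>V \<subseteq> W0\<close> by blast
      finally show ?thesis .
    qed
    moreover have "openin (top_of_set (adapted_frames r)) {h \<in> adapted_frames r. leaf r \<phi> s (frame_proj r h) \<in> A}"
      using A(1) by (simp add: quot_open_def)
    ultimately show "\<exists>A. openin (top_of_set (adapted_frames r)) {h \<in> adapted_frames r. leaf r \<phi> s (frame_proj r h) \<in> A} \<and>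
       (\<forall>h\<in>adapted_frames r. leaf r \<phi> s (frame_proj r h) \<in> N \<inter> A \<longleftrightarrow> (\<exists>x\<in>V \<inter> S. dehom (gvec r \<phi> s h) = m x))"
      by blast
  qed
  moreover obtain x where "x \<in> W0 \<inter> S" "l = leaf r \<phi> s (frame_proj r (\<psi> x))" using l' by auto
  ultimately show thesis using that[of W S m x] S(2) WS iff by auto
qed

text \<open>The chart coordinates of a curve are continuous, because the chart is a homeomorphism, and hence
  differentiable, because it is an immersion.\<close>

lemma null_chart_curve:
  fixes c :: "real \<Rightarrow> 'n::{finite,linorder} aframe"
  assumes rs: "r > 0" "s\<^sup>2 = 1" and chart: "null_chart r \<phi> s N W S m"
    and c: "\<And>t. c t \<in> adapted_frames r" "\<And>t. leaf r \<phi> s (frame_proj r (c t)) \<in> N" "(c has_vector_derivative X) (at 0)"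
    and x0: "x0 \<in> W \<inter> S" "dehom (gvec r \<phi> s (c 0)) = m x0"
  obtains x v where "x 0 = x0" "v \<in> S" "(x has_vector_derivative v) (at 0)"
    "\<forall>\<^sub>F t in nhds 0. x t \<in> W \<inter> S \<and> dehom (gvec r \<phi> s (c t)) = m (x t)"
proof -
  note C = null_chartD[OF chart]
  have W: "open W" by (rule smooth_onD(1)[OF C(2)])
  have cont: "isCont c 0" using c(3) by (rule has_vector_derivative_continuous)
  define x where "x t = (SOME y. y \<in> W \<inter> S \<and> dehom (gvec r \<phi> s (c t)) = m y)" for t
  have xI: "x t = y" if "y \<in> W \<inter> S" "dehom (gvec r \<phi> s (c t)) = m y" for t y
    unfolding x_def
  proof (rule some_equality)
    show "z = y" if "z \<in> W \<inter> S \<and> dehom (gvec r \<phi> s (c t)) = m z" for z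
      using inj_onD[OF C(5), of z y] that \<open>y \<in> W \<inter> S\<close> \<open>dehom (gvec r \<phi> s (c t)) = m y\<close> by simp
  qed (use that in simp)
  have near: "\<forall>\<^sub>F t in nhds 0. x t \<in> V \<inter> S \<and> dehom (gvec r \<phi> s (c t)) = m (x t)" if V: "open V" "V \<subseteq> W" "x0 \<in> V" for V
  proof -
    obtain A where A: "openin (top_of_set (adapted_frames r)) {h \<in> adapted_frames r. leaf r \<phi> s (frame_proj r h) \<in> A}"
      "\<And>h. h \<in> adapted_frames r \<Longrightarrow> leaf r \<phi> s (frame_proj r h) \<in> N \<inter> A \<longleftrightarrow> (\<exists>x\<in>V \<inter> S. dehom (gvec r \<phi> s h) = m x)"
      using C(8)[OF V(1,2)] by blast
    obtain Ob where Ob: "open Ob" "{h \<in> adapted_frames r. leaf r \<phi> s (frame_proj r h) \<in> A} = adapted_frames r \<inter> Ob"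
      using A(1) unfolding openin_open by blast
    have "leaf r \<phi> s (frame_proj r (c 0)) \<in> N \<inter> A" using A(2)[OF c(1)] x0 V(3) by blast
    then have "c 0 \<in> Ob" using Ob(2) c(1) by blast
    then have "\<forall>\<^sub>F t in nhds 0. c t \<in> Ob"
      using cont Ob(1) tendsto_at_iff_tendsto_nhds[of c 0] unfolding isCont_def by (auto dest: topological_tendstoD)
    then show ?thesis
    proof eventually_elim
      case (elim t)
      then have "leaf r \<phi> s (frame_proj r (c t)) \<in> N \<inter> A" using Ob(2) c(1,2) by blast
      then obtain y where y: "y \<in> V \<inter> S" "dehom (gvec r \<phi> s (c t)) = m y" using A(2)[OF c(1)] by blast
      then have "x t = y" using V(2) by (intro xI) auto
      then show ?case using y by simp
    qed
  qed
  have x_0: "x 0 = x0" by (rule xI[OF x0])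
  have isC: "isCont x 0"
    unfolding isCont_def x_0
  proof (rule topological_tendstoI)
    fix V assume "open V" "x0 \<in> V"
    then have "\<forall>\<^sub>F t in nhds 0. x t \<in> (V \<inter> W) \<inter> S \<and> dehom (gvec r \<phi> s (c t)) = m (x t)"
      using W x0(1) by (intro near) auto
    then show "\<forall>\<^sub>F t in at 0. x t \<in> V" unfolding eventually_at_filter by eventually_elim auto
  qed
  have nW: "\<forall>\<^sub>F t in nhds 0. x t \<in> W \<inter> S \<and> dehom (gvec r \<phi> s (c t)) = m (x t)" using W x0(1) by (intro near) auto
  have "((\<lambda>t. dehom (gvec r \<phi> s (c t))) has_vector_derivative ddehom (gvec r \<phi> s (c 0)) (gvec r \<phi> s X)) (at 0)"
    by (rule gvec_curve_derivative[OF rs c(3) c(1)])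
  then have "((\<lambda>t. m (x t)) has_vector_derivative ddehom (gvec r \<phi> s (c 0)) (gvec r \<phi> s X)) (at 0)"
    unfolding has_vector_derivative_def
  proof (rule has_derivative_transform_eventually)
    show "\<forall>\<^sub>F t in at 0. dehom (gvec r \<phi> s (c t)) = m (x t)"
      using nW unfolding eventually_at_filter by eventually_elim auto
  qed (simp_all add: x_0 x0)
  moreover have "(m has_derivative frechet_derivative m (at x0)) (at (x 0))"
    using smooth_onD(2)[OF C(2)] x0(1) x_0 by auto
  moreover have "\<forall>\<^sub>F t in at 0. x t - x 0 \<in> S"
    using nW unfolding eventually_at_filter by eventually_elim (use x_0 x0 C(1) in \<open>auto intro: subspace_diff\<close>)
  moreover have "v = 0" if "v \<in> S" "frechet_derivative m (at x0) v = 0" for v by (rule C(6)[OF x0(1) that])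
  ultimately obtain v where "v \<in> S" "(x has_vector_derivative v) (at 0)"
    using curve_through_immersion[of m "frechet_derivative m (at x0)" x 0 S] C(1) isC by metis
  then show thesis using that[OF x_0 _ _ nW] by blast
qed

section \<open>The first and second order geometry of the parametrisation\<close>

text \<open>
  Each null vector is orthogonal to its derivative, by the Legendrian condition, and their product is constant;
  this makes the Hermitian product of \<open>U\<close> with the velocity of \<open>Z\<close> real.
\<close>

lemma Uvec_normal:
  assumes "herm N1 d1 = 0" "herm N2 d2 = 0" "herm d1 N2 + herm N1 d2 = 0"
  shows "ip (\<i> *\<^sub>C Uvec \<phi> N1 N2) (Zvec r d1 d2) = 0"
proof -
  define b where "b = herm N2 d1"
  have b: "herm N1 d2 = - cnj b" using assms(3) unfolding b_def cnj_herm by (simp add: add_eq_0_iff)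
  have "herm (Uvec \<phi> N1 N2) (Zvec r d1 d2) = of_real r * (cnj (cis (- \<phi>)) * herm N1 d2 - cnj (cis \<phi>) * herm N2 d1)"
    by (simp add: Uvec_def Zvec_def herm_cscale herm_add herm_diff assms algebra_simps)
  also have "\<dots> = - of_real r * (cnj (cis (- \<phi>) * b) + cis (- \<phi>) * b)"
    by (simp add: b b_def[symmetric] cis_cnj algebra_simps)
  finally show ?thesis by (simp add: ip_def herm_cscale)
qed

lemma hor_linear:
  "hor r z (a + b) = hor r z a + hor r z b" "hor r z (a - b) = hor r z a - hor r z b"
  "hor r z (c *\<^sub>C a) = c *\<^sub>C hor r z a" "hor r z (t *\<^sub>R a) = t *\<^sub>R hor r z a"
  by (simp_all add: hor_def herm_add herm_diff herm_cscale herm_scaleR cscale_distrib cscale_assoc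
      add_divide_distrib diff_divide_distrib scaleR_add_right flip: cscale_of_real)

lemma hor_self: "z \<in> Q r \<Longrightarrow> r > 0 \<Longrightarrow> hor r z z = 0"
  by (simp add: hor_def herm_Q)

lemma hor_eq_0D: "hor r z v = 0 \<Longrightarrow> \<exists>\<mu>. v = \<mu> *\<^sub>C z"
  unfolding hor_def by (metis add_eq_0_iff2 cscale_triv(4))

text \<open>
  When \<open>N1\<close> is stretched and \<open>N2\<close> shrunk at the same rate, the projected base point moves in the
  direction of \<open>U\<close>, and the frame vector \<open>U\<close> stays in the complex plane of \<open>Z\<close> and \<open>U\<close>; so this is the
  Hopf direction, and it is a principal direction.
\<close>

lemma hopf_direction:
  fixes N1 N2 :: "'n::finite cvec"
  assumes r: "r > 0" and c: "cos \<phi> > 0"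
    and N: "herm N1 N1 = 0" "herm N2 N2 = 0" "herm N1 N2 = null_pairing \<phi>"
  defines "Z \<equiv> Zvec r N1 N2" and "U \<equiv> Uvec \<phi> N1 N2" and "t \<equiv> - (cos \<phi> / r)"
  shows "hor r Z (t *\<^sub>R Zvec r N1 (- N2)) = U"
    and "- cov r Z (t *\<^sub>R Zvec r N1 (- N2)) (\<i> *\<^sub>C U) (\<i> *\<^sub>C (t *\<^sub>R Uvec \<phi> N1 (- N2))) = (2 / r * sin \<phi>) *\<^sub>R U"
proof -
  note p = Zvec_Uvec_unitary[OF r c N, folded Z_def U_def]
  have c0: "complex_of_real (2 * cos \<phi>) \<noteq> 0" "complex_of_real (cos \<phi>) \<noteq> 0" "complex_of_real r \<noteq> 0" using r c by simp_all
  have hU: "hor r Z U = U" by (rule hor_id[OF p(2)])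
  have hZ: "hor r Z Z = 0" by (rule hor_self[OF p(1) r])
  have "hor r Z ((of_real (2 * cos \<phi>) * cis (- \<phi>)) *\<^sub>C N1) = - (\<i> * cis (-\<phi>)) *\<^sub>C U"
    unfolding p(4)[symmetric] by (simp add: hor_linear hU hZ gcoef_cis)
  then have "(of_real (2 * cos \<phi>) * cis (- \<phi>)) *\<^sub>C hor r Z N1 = - (\<i> * cis (-\<phi>)) *\<^sub>C U" by (simp only: hor_linear)
  then have "inverse (of_real (2 * cos \<phi>) * cis (- \<phi>)) *\<^sub>C (of_real (2 * cos \<phi>) * cis (- \<phi>)) *\<^sub>C hor r Z N1
      = inverse (of_real (2 * cos \<phi>) * cis (- \<phi>)) *\<^sub>C (- (\<i> * cis (-\<phi>)) *\<^sub>C U)" by simp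
  then have h1: "hor r Z N1 = (- \<i> / of_real (2 * cos \<phi>)) *\<^sub>C U"
    using c0 by (simp add: cscale_assoc cis_neq_zero field_simps)
  have "hor r Z ((- of_real (2 * cos \<phi>) * cis \<phi>) *\<^sub>C N2) = (\<i> * cis \<phi>) *\<^sub>C U"
    unfolding p(5)[symmetric] by (simp add: hor_linear hU hZ gcoef_cis)
  then have "(- of_real (2 * cos \<phi>) * cis \<phi>) *\<^sub>C hor r Z N2 = (\<i> * cis \<phi>) *\<^sub>C U" by (simp only: hor_linear)
  then have "inverse (- of_real (2 * cos \<phi>) * cis \<phi>) *\<^sub>C (- of_real (2 * cos \<phi>) * cis \<phi>) *\<^sub>C hor r Z N2
      = inverse (- of_real (2 * cos \<phi>) * cis \<phi>) *\<^sub>C ((\<i> * cis \<phi>) *\<^sub>C U)" by simp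
  then have h2: "hor r Z N2 = (- \<i> / of_real (2 * cos \<phi>)) *\<^sub>C U"
    using c0 by (simp add: cscale_assoc cis_neq_zero field_simps del: cscale_triv(4))
  define X where "X = t *\<^sub>R Zvec r N1 (- N2)"
  have X: "X = (\<i> * of_real (cos \<phi>)) *\<^sub>C (N1 + N2)"
    unfolding X_def t_def Zvec_def using r by (intro cvec_eqI) (simp_all add: field_simps scaleR_conv_of_real[where 'a=complex])
  show hX: "hor r Z (t *\<^sub>R Zvec r N1 (- N2)) = U"
    unfolding X_def[symmetric] unfolding X hor_linear h1 h2 using c0
    by (intro cvec_eqI) (simp_all add: field_simps)
  have N21: "herm N2 N1 = cis \<phi> / of_real (2 * cos \<phi>)"
    using cnj_herm[of N1 N2] N(3) by (simp add: null_pairing_def cis_cnj)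
  have "herm Z X = (\<i> * of_real (cos \<phi>)) * (- \<i> * of_real r * (cis \<phi> / of_real (2 * cos \<phi>) - cis (-\<phi>) / of_real (2 * cos \<phi>)))"
    unfolding X Z_def Zvec_def by (simp add: herm_cscale herm_add herm_diff N N21 null_pairing_def algebra_simps)
  also have "cis \<phi> / of_real (2 * cos \<phi>) - cis (-\<phi>) / of_real (2 * cos \<phi>) = \<i> * of_real (sin \<phi> / cos \<phi>)"
    using c by (simp add: complex_eq_iff field_simps)
  finally have "herm Z X = \<i> * of_real (r * sin \<phi>)" using c0 by (simp add: field_simps)
  then have a: "- ip (\<i> *\<^sub>C Z) X / r\<^sup>2 = - (sin \<phi> / r)"
    using r by (simp add: ip_def herm_cscale power2_eq_square)
  have "\<i> *\<^sub>C (t *\<^sub>R Uvec \<phi> N1 (- N2)) = of_real (cos \<phi> / r) *\<^sub>C (cis (- \<phi>) *\<^sub>C N1 - cis \<phi> *\<^sub>C N2)"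
    unfolding t_def Uvec_def by (rule cvec_eqI) (simp_all add: scaleR_conv_of_real[where 'a=complex] algebra_simps)
  then have E: "\<i> *\<^sub>C (t *\<^sub>R Uvec \<phi> N1 (- N2)) = of_real (cos \<phi> / r) *\<^sub>C (cis (- \<phi>) *\<^sub>C N1 - cis \<phi> *\<^sub>C N2)" .
  have "hor r Z (\<i> *\<^sub>C (t *\<^sub>R Uvec \<phi> N1 (- N2))) = (of_real (cos \<phi> / r) * ((cis (- \<phi>) - cis \<phi>) * (- \<i> / of_real (2 * cos \<phi>)))) *\<^sub>C U"
  proof -
    have "q *\<^sub>C (a *\<^sub>C k *\<^sub>C U - b *\<^sub>C k *\<^sub>C U) = (q * ((a - b) * k)) *\<^sub>C U" for q a b k
      by (rule cvec_eqI) (simp_all add: algebra_simps)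
    then show ?thesis unfolding E hor_linear h1 h2 .
  qed
  also have "cis (- \<phi>) - cis \<phi> = - 2 * \<i> * of_real (sin \<phi>)" by (simp add: complex_eq_iff)
  also have "of_real (cos \<phi> / r) * (- 2 * \<i> * of_real (sin \<phi>) * (- \<i> / of_real (2 * cos \<phi>))) = complex_of_real (- (sin \<phi> / r))"
    using c0 by (simp add: field_simps)
  finally have d: "hor r Z (\<i> *\<^sub>C (t *\<^sub>R Uvec \<phi> N1 (- N2))) = (- (sin \<phi> / r)) *\<^sub>R U" by (simp only: cscale_of_real)
  have i: "(complex_of_real (- (sin \<phi> / r)) * \<i>) *\<^sub>C (\<i> *\<^sub>C U) = (sin \<phi> / r) *\<^sub>R U"
  proof -
    have "(complex_of_real (- (sin \<phi> / r)) * \<i>) *\<^sub>C (\<i> *\<^sub>C U) = (complex_of_real (- (sin \<phi> / r)) * (\<i> * \<i>)) *\<^sub>C U"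
      by (simp only: cscale_assoc mult.assoc)
    also have "complex_of_real (- (sin \<phi> / r)) * (\<i> * \<i>) = of_real (sin \<phi> / r)" by simp
    finally show ?thesis by (simp only: cscale_of_real)
  qed
  have "cov r Z X (\<i> *\<^sub>C U) (\<i> *\<^sub>C (t *\<^sub>R Uvec \<phi> N1 (- N2))) = (- (sin \<phi> / r)) *\<^sub>R U - (sin \<phi> / r) *\<^sub>R U"
    unfolding cov_def Let_def a hor_linear(2) d unfolding i hor_linear(4) hU ..
  then show "- cov r Z (t *\<^sub>R Zvec r N1 (- N2)) (\<i> *\<^sub>C U) (\<i> *\<^sub>C (t *\<^sub>R Uvec \<phi> N1 (- N2))) = (2 / r * sin \<phi>) *\<^sub>R U"
    unfolding X_def by (simp flip: scaleR_left.add scaleR_left_diff_distrib scaleR_minus_left)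
qed

section \<open>The parametrisation by two null charts and a scale\<close>

text \<open>The parameters are two chart coordinates and the modulus \<open>l\<close>.  The inverse factor in \<open>null2\<close> fixes the
  product of the two null vectors.\<close>

definition null1 :: "('n::finite cvec \<Rightarrow> 'n cvec) \<Rightarrow> 'n cvec \<times> 'n cvec \<times> real \<Rightarrow> 'n cvec" where
  "null1 m1 e = of_real (snd (snd e)) *\<^sub>C m1 (fst e)"

definition null2 :: "real \<Rightarrow> ('n::finite cvec \<Rightarrow> 'n cvec) \<Rightarrow> ('n cvec \<Rightarrow> 'n cvec) \<Rightarrow> 'n cvec \<times> 'n cvec \<times> real \<Rightarrow> 'n cvec" where
  "null2 \<phi> m1 m2 e = (null_pairing \<phi> * inverse (of_real (snd (snd e)) * herm (m1 (fst e)) (m2 (fst (snd e))))) *\<^sub>C m2 (fst (snd e))"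

definition Zmap :: "real \<Rightarrow> real \<Rightarrow> ('n::finite cvec \<Rightarrow> 'n cvec) \<Rightarrow> ('n cvec \<Rightarrow> 'n cvec) \<Rightarrow> 'n cvec \<times> 'n cvec \<times> real \<Rightarrow> 'n cvec" where
  "Zmap r \<phi> m1 m2 e = Zvec r (null1 m1 e) (null2 \<phi> m1 m2 e)"

definition Umap :: "real \<Rightarrow> ('n::finite cvec \<Rightarrow> 'n cvec) \<Rightarrow> ('n cvec \<Rightarrow> 'n cvec) \<Rightarrow> 'n cvec \<times> 'n cvec \<times> real \<Rightarrow> 'n cvec" where
  "Umap \<phi> m1 m2 e = Uvec \<phi> (null1 m1 e) (null2 \<phi> m1 m2 e)"

definition param_dom :: "'n::finite cvec set \<Rightarrow> 'n cvec set \<Rightarrow> ('n cvec \<Rightarrow> 'n cvec) \<Rightarrow> ('n cvec \<Rightarrow> 'n cvec) \<Rightarrow> ('n cvec \<times> 'n cvec \<times> real) set" where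
  "param_dom W1 W2 m1 m2 = {e. fst e \<in> W1 \<and> fst (snd e) \<in> W2 \<and> herm (m1 (fst e)) (m2 (fst (snd e))) \<noteq> 0 \<and> snd (snd e) > 0}"

context
  fixes r \<phi> :: real and N1 N2 :: "'n::{finite,linorder} frame set set"
    and W1 S1 W2 S2 :: "'n cvec set" and m1 m2 :: "'n cvec \<Rightarrow> 'n cvec"
  assumes r: "r > 0" and c: "cos \<phi> > 0"
    and ch1: "null_chart r \<phi> 1 N1 W1 S1 m1" and ch2: "null_chart r \<phi> (-1) N2 W2 S2 m2"
begin

lemma bounded_linear_fst_snd: "bounded_linear (\<lambda>e :: 'n cvec \<times> 'n cvec \<times> real. fst (snd e))"
  "bounded_linear (\<lambda>e :: 'n cvec \<times> 'n cvec \<times> real. snd (snd e))"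
  using bounded_linear_compose[OF bounded_linear_fst bounded_linear_snd] bounded_linear_compose[OF bounded_linear_snd bounded_linear_snd]
  by simp_all

lemma param_dom_smooth:
  "open (param_dom W1 W2 m1 m2)"
  "smooth_on (\<lambda>e. m1 (fst e)) (param_dom W1 W2 m1 m2)"
  "smooth_on (\<lambda>e. m2 (fst (snd e))) (param_dom W1 W2 m1 m2)"
proof -
  let ?\<Omega> = "{e :: 'n cvec \<times> 'n cvec \<times> real. fst e \<in> W1 \<and> fst (snd e) \<in> W2}"
  let ?\<zeta> = "\<lambda>e :: 'n cvec \<times> 'n cvec \<times> real. herm (m1 (fst e)) (m2 (fst (snd e)))"
  note C1 = null_chartD(2)[OF ch1] and C2 = null_chartD(2)[OF ch2]
  have "open (fst -` W1 \<inter> (\<lambda>e :: 'n cvec \<times> 'n cvec \<times> real. fst (snd e)) -` W2)"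
    by (rule open_Int[OF open_vimage[OF smooth_onD(1)[OF C1]] open_vimage[OF smooth_onD(1)[OF C2]]]) (intro continuous_intros)+
  moreover have "fst -` W1 \<inter> (\<lambda>e :: 'n cvec \<times> 'n cvec \<times> real. fst (snd e)) -` W2 = ?\<Omega>" by auto
  ultimately have \<Omega>: "open ?\<Omega>" by (rule subst[rotated])
  have 1: "smooth_on (\<lambda>e. m1 (fst e)) ?\<Omega>" by (rule smooth_on_compose_linear[OF C1 bounded_linear_fst \<Omega>]) auto
  have 2: "smooth_on (\<lambda>e. m2 (fst (snd e))) ?\<Omega>" by (rule smooth_on_compose_linear[OF C2 bounded_linear_fst_snd(1) \<Omega>]) auto
  have "continuous_on ?\<Omega> ?\<zeta>" by (rule smooth_onD(3)[OF smooth_on_bilinear[OF bounded_bilinear_herm 1 2]])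
  then have a: "open (?\<Omega> \<inter> ?\<zeta> -` (- {0}))" using \<Omega> by (rule continuous_open_preimage) auto
  have b: "open {e :: 'n cvec \<times> 'n cvec \<times> real. 0 < snd (snd e)}" by (intro open_Collect_less continuous_intros)
  have eq: "param_dom W1 W2 m1 m2 = (?\<Omega> \<inter> ?\<zeta> -` (- {0})) \<inter> {e. 0 < snd (snd e)}" by (auto simp: param_dom_def)
  show o: "open (param_dom W1 W2 m1 m2)" unfolding eq by (rule open_Int[OF a b])
  have "param_dom W1 W2 m1 m2 \<subseteq> ?\<Omega>" by (auto simp: param_dom_def)
  then show "smooth_on (\<lambda>e. m1 (fst e)) (param_dom W1 W2 m1 m2)" "smooth_on (\<lambda>e. m2 (fst (snd e))) (param_dom W1 W2 m1 m2)"
    using 1 2 o by (auto intro: smooth_on_subset)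
qed

lemma smooth_scale: "smooth_on (\<lambda>e. complex_of_real (snd (snd e))) (param_dom W1 W2 m1 m2)"
  by (rule smooth_on_linear_map[OF bounded_linear_compose[OF bounded_linear_of_real bounded_linear_fst_snd(2)] param_dom_smooth(1)])

lemma smooth_coeff:
  "smooth_on (\<lambda>e. null_pairing \<phi> * inverse (of_real (snd (snd e)) * herm (m1 (fst e)) (m2 (fst (snd e))))) (param_dom W1 W2 m1 m2)"
  by (intro smooth_on_bilinear[OF bounded_bilinear_mult] smooth_on_const smooth_on_inverse smooth_scale
      smooth_on_bilinear[OF bounded_bilinear_herm] param_dom_smooth) (auto simp: param_dom_def)

lemma smooth_null:
  "smooth_on (null1 m1) (param_dom W1 W2 m1 m2)" "smooth_on (null2 \<phi> m1 m2) (param_dom W1 W2 m1 m2)"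
  unfolding null1_def[abs_def] null2_def[abs_def]
  by (intro smooth_on_bilinear[OF bounded_bilinear_cscale] smooth_scale smooth_coeff param_dom_smooth)+

lemma bounded_linear_cscale: "bounded_linear (\<lambda>v :: 'n cvec. a *\<^sub>C v)"
  by (rule bounded_bilinear.bounded_linear_right[OF bounded_bilinear_cscale])

lemma smooth_Zmap_Umap:
  "smooth_on (Zmap r \<phi> m1 m2) (param_dom W1 W2 m1 m2)" "smooth_on (Umap \<phi> m1 m2) (param_dom W1 W2 m1 m2)"
proof -
  have "smooth_on (\<lambda>e. (\<i> * of_real r) *\<^sub>C (null2 \<phi> m1 m2 e + (- 1) *\<^sub>C null1 m1 e)) (param_dom W1 W2 m1 m2)"
    by (intro smooth_on_linear[OF bounded_linear_cscale] smooth_on_add smooth_null)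
  then show "smooth_on (Zmap r \<phi> m1 m2) (param_dom W1 W2 m1 m2)" by (simp add: Zmap_def[abs_def] Zvec_def)
  show "smooth_on (Umap \<phi> m1 m2) (param_dom W1 W2 m1 m2)"
    unfolding Umap_def[abs_def] Uvec_def by (intro smooth_on_linear[OF bounded_linear_cscale] smooth_on_add smooth_null)
qed

lemma frechet_Zmap_Umap:
  assumes e: "e \<in> param_dom W1 W2 m1 m2"
  shows "frechet_derivative (Zmap r \<phi> m1 m2) (at e) v = Zvec r (frechet_derivative (null1 m1) (at e) v) (frechet_derivative (null2 \<phi> m1 m2) (at e) v)"
    and "frechet_derivative (Umap \<phi> m1 m2) (at e) v = Uvec \<phi> (frechet_derivative (null1 m1) (at e) v) (frechet_derivative (null2 \<phi> m1 m2) (at e) v)"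
proof -
  note d = smooth_onD(2)[OF smooth_null(1) e] smooth_onD(2)[OF smooth_null(2) e]
  have "(Zmap r \<phi> m1 m2 has_derivative (\<lambda>v. Zvec r (frechet_derivative (null1 m1) (at e) v) (frechet_derivative (null2 \<phi> m1 m2) (at e) v))) (at e)"
    unfolding Zmap_def[abs_def] Zvec_def
    by (intro bounded_linear.has_derivative[OF bounded_linear_cscale] has_derivative_diff d)
  then show "frechet_derivative (Zmap r \<phi> m1 m2) (at e) v = Zvec r (frechet_derivative (null1 m1) (at e) v) (frechet_derivative (null2 \<phi> m1 m2) (at e) v)"
    by (simp add: frechet_eqI)
  have "(Umap \<phi> m1 m2 has_derivative (\<lambda>v. Uvec \<phi> (frechet_derivative (null1 m1) (at e) v) (frechet_derivative (null2 \<phi> m1 m2) (at e) v))) (at e)"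
    unfolding Umap_def[abs_def] Uvec_def
    by (rule bounded_linear.has_derivative[OF bounded_linear_cscale],
        rule has_derivative_add[OF bounded_linear.has_derivative[OF bounded_linear_cscale d(1)] bounded_linear.has_derivative[OF bounded_linear_cscale d(2)]])
  then show "frechet_derivative (Umap \<phi> m1 m2) (at e) v = Uvec \<phi> (frechet_derivative (null1 m1) (at e) v) (frechet_derivative (null2 \<phi> m1 m2) (at e) v)"
    by (simp add: frechet_eqI)
qed

lemma frechet_null:
  assumes e: "e \<in> param_dom W1 W2 m1 m2"
  shows "frechet_derivative (null1 m1) (at e) v =
      of_real (snd (snd e)) *\<^sub>C frechet_derivative m1 (at (fst e)) (fst v) + of_real (snd (snd v)) *\<^sub>C m1 (fst e)"
    and "\<exists>k. frechet_derivative (null2 \<phi> m1 m2) (at e) v =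
      (null_pairing \<phi> * inverse (of_real (snd (snd e)) * herm (m1 (fst e)) (m2 (fst (snd e))))) *\<^sub>C
        frechet_derivative m2 (at (fst (snd e))) (fst (snd v)) + k *\<^sub>C m2 (fst (snd e))"
    and "herm (frechet_derivative (null1 m1) (at e) v) (null2 \<phi> m1 m2 e) + herm (null1 m1 e) (frechet_derivative (null2 \<phi> m1 m2) (at e) v) = 0"
proof -
  have w: "fst e \<in> W1" "fst (snd e) \<in> W2" using e by (auto simp: param_dom_def)
  have 1: "((\<lambda>e. m1 (fst e)) has_derivative (\<lambda>v. frechet_derivative m1 (at (fst e)) (fst v))) (at e)"
    using diff_chain_at[OF bounded_linear_imp_has_derivative[OF bounded_linear_fst] smooth_onD(2)[OF null_chartD(2)[OF ch1] w(1)]]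
    by (simp add: o_def)
  have 2: "((\<lambda>e. m2 (fst (snd e))) has_derivative (\<lambda>v. frechet_derivative m2 (at (fst (snd e))) (fst (snd v)))) (at e)"
    using diff_chain_at[OF bounded_linear_imp_has_derivative[OF bounded_linear_fst_snd(1)] smooth_onD(2)[OF null_chartD(2)[OF ch2] w(2)]]
    by (simp add: o_def)
  have s: "((\<lambda>e. complex_of_real (snd (snd e))) has_derivative (\<lambda>v. of_real (snd (snd v)))) (at e)"
    by (rule bounded_linear_imp_has_derivative[OF bounded_linear_compose[OF bounded_linear_of_real bounded_linear_fst_snd(2)]])
  have "(null1 m1 has_derivative (\<lambda>v. of_real (snd (snd e)) *\<^sub>C frechet_derivative m1 (at (fst e)) (fst v) + of_real (snd (snd v)) *\<^sub>C m1 (fst e))) (at e)"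
    unfolding null1_def[abs_def] by (rule bounded_bilinear.FDERIV[OF bounded_bilinear_cscale s 1])
  then show "frechet_derivative (null1 m1) (at e) v =
      of_real (snd (snd e)) *\<^sub>C frechet_derivative m1 (at (fst e)) (fst v) + of_real (snd (snd v)) *\<^sub>C m1 (fst e)"
    by (simp add: frechet_eqI)
  from bounded_bilinear.FDERIV[OF bounded_bilinear_cscale smooth_onD(2)[OF smooth_coeff e] 2]
  show "\<exists>k. frechet_derivative (null2 \<phi> m1 m2) (at e) v =
      (null_pairing \<phi> * inverse (of_real (snd (snd e)) * herm (m1 (fst e)) (m2 (fst (snd e))))) *\<^sub>C
        frechet_derivative m2 (at (fst (snd e))) (fst (snd v)) + k *\<^sub>C m2 (fst (snd e))"
    unfolding null2_def[abs_def] by (auto simp: frechet_eqI)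
  have "((\<lambda>e. herm (null1 m1 e) (null2 \<phi> m1 m2 e)) has_derivative
     (\<lambda>v. herm (null1 m1 e) (frechet_derivative (null2 \<phi> m1 m2) (at e) v) + herm (frechet_derivative (null1 m1) (at e) v) (null2 \<phi> m1 m2 e))) (at e)"
    by (rule bounded_bilinear.FDERIV[OF bounded_bilinear_herm smooth_onD(2)[OF smooth_null(1) e] smooth_onD(2)[OF smooth_null(2) e]])
  moreover have "((\<lambda>e. herm (null1 m1 e) (null2 \<phi> m1 m2 e)) has_derivative (\<lambda>v. 0)) (at e)"
  proof (rule has_derivative_transform_within_open[OF has_derivative_const param_dom_smooth(1) e])
    show "null_pairing \<phi> = herm (null1 m1 x) (null2 \<phi> m1 m2 x)" if "x \<in> param_dom W1 W2 m1 m2" for x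
      using that by (simp add: null1_def null2_def herm_cscale param_dom_def field_simps)
  qed
  ultimately have "(\<lambda>v. herm (null1 m1 e) (frechet_derivative (null2 \<phi> m1 m2) (at e) v) + herm (frechet_derivative (null1 m1) (at e) v) (null2 \<phi> m1 m2 e)) = (\<lambda>v. 0)"
    by (rule has_derivative_unique)
  from fun_cong[OF this, of v]
  show "herm (frechet_derivative (null1 m1) (at e) v) (null2 \<phi> m1 m2 e) + herm (null1 m1 e) (frechet_derivative (null2 \<phi> m1 m2) (at e) v) = 0"
    by (simp only: add.commute)
qed

context
  fixes e :: "'n cvec \<times> 'n cvec \<times> real"
  assumes e: "e \<in> param_dom W1 W2 m1 m2" and eS: "e \<in> S1 \<times> S2 \<times> UNIV"
begin

lemma null_pair:
  "herm (null1 m1 e) (null1 m1 e) = 0" "herm (null2 \<phi> m1 m2 e) (null2 \<phi> m1 m2 e) = 0" "herm (null1 m1 e) (null2 \<phi> m1 m2 e) = null_pairing \<phi>"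
proof -
  have "fst e \<in> W1 \<inter> S1" "fst (snd e) \<in> W2 \<inter> S2" using e eS by (auto simp: param_dom_def)
  then have "herm (m1 (fst e)) (m1 (fst e)) = 0" "herm (m2 (fst (snd e))) (m2 (fst (snd e))) = 0"
    using null_chartD(4)[OF ch1] null_chartD(4)[OF ch2] by blast+
  then show "herm (null1 m1 e) (null1 m1 e) = 0" "herm (null2 \<phi> m1 m2 e) (null2 \<phi> m1 m2 e) = 0" "herm (null1 m1 e) (null2 \<phi> m1 m2 e) = null_pairing \<phi>"
    using e by (auto simp: null1_def null2_def param_dom_def herm_cscale field_simps)
qed

lemmas Zmap_Umap_unitary = Zvec_Uvec_unitary[OF r c null_pair, folded Zmap_def Umap_def]

lemma param_normal:
  assumes v: "v \<in> S1 \<times> S2 \<times> UNIV"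
  shows "ip (\<i> *\<^sub>C Umap \<phi> m1 m2 e) (frechet_derivative (Zmap r \<phi> m1 m2) (at e) v) = 0"
  unfolding frechet_Zmap_Umap(1)[OF e] Umap_def
proof (rule Uvec_normal)
  have w: "fst e \<in> W1 \<inter> S1" "fst (snd e) \<in> W2 \<inter> S2" using e eS by (auto simp: param_dom_def)
  have v': "fst v \<in> S1" "fst (snd v) \<in> S2" using v by auto
  show "herm (null1 m1 e) (frechet_derivative (null1 m1) (at e) v) = 0"
    unfolding frechet_null(1)[OF e]
    using null_chartD(4)[OF ch1 w(1)] null_chartD(7)[OF ch1 w(1) v'(1)] by (simp add: null1_def herm_cscale herm_add)
  show "herm (null2 \<phi> m1 m2 e) (frechet_derivative (null2 \<phi> m1 m2) (at e) v) = 0"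
    using frechet_null(2)[OF e, of v] null_chartD(4)[OF ch2 w(2)] null_chartD(7)[OF ch2 w(2) v'(2)]
    by (auto simp: null2_def herm_cscale herm_add)
qed (rule frechet_null(3)[OF e])

lemma param_scale_direction:
  defines "v \<equiv> (0, 0, snd (snd e))"
  shows "frechet_derivative (null1 m1) (at e) v = null1 m1 e" "frechet_derivative (null2 \<phi> m1 m2) (at e) v = - null2 \<phi> m1 m2 e"
proof -
  have l: "snd (snd e) \<noteq> 0" using e by (auto simp: param_dom_def)
  have z: "frechet_derivative m1 (at (fst e)) 0 = 0" "frechet_derivative m2 (at (fst (snd e))) 0 = 0"
  proof -
    have "fst e \<in> W1" "fst (snd e) \<in> W2" using e by (auto simp: param_dom_def)
    then show "frechet_derivative m1 (at (fst e)) 0 = 0" "frechet_derivative m2 (at (fst (snd e))) 0 = 0"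
      using linear_0[OF has_derivative_linear[OF smooth_onD(2)[OF null_chartD(2)[OF ch1]]]]
        linear_0[OF has_derivative_linear[OF smooth_onD(2)[OF null_chartD(2)[OF ch2]]]] by blast+
  qed
  show 1: "frechet_derivative (null1 m1) (at e) v = null1 m1 e"
    unfolding frechet_null(1)[OF e] by (simp add: v_def z null1_def)
  obtain k where k: "frechet_derivative (null2 \<phi> m1 m2) (at e) v = k *\<^sub>C m2 (fst (snd e))"
    using frechet_null(2)[OF e, of v] by (auto simp: v_def z)
  define b where "b = null_pairing \<phi> * inverse (of_real (snd (snd e)) * herm (m1 (fst e)) (m2 (fst (snd e))))"
  have b0: "b \<noteq> 0" using e null_pairing_nonzero[OF c] by (auto simp: b_def param_dom_def)
  have P2b: "null2 \<phi> m1 m2 e = b *\<^sub>C m2 (fst (snd e))" by (simp add: null2_def b_def)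
  have d: "frechet_derivative (null2 \<phi> m1 m2) (at e) v = (k / b) *\<^sub>C null2 \<phi> m1 m2 e"
    unfolding k P2b using b0 by (simp add: cscale_assoc)
  have "null_pairing \<phi> + (k / b) * null_pairing \<phi> = 0"
    using frechet_null(3)[OF e, of v] unfolding 1 d by (simp add: herm_cscale null_pair)
  then have "(1 + k / b) * null_pairing \<phi> = 0" by (simp add: distrib_right)
  then have "1 + k / b = 0" using null_pairing_nonzero[OF c] by (simp only: mult_eq_0_iff) simp
  then have "k / b = - 1" by (simp only: add_eq_0_iff)
  then show "frechet_derivative (null2 \<phi> m1 m2) (at e) v = - null2 \<phi> m1 m2 e" unfolding d by simp
qed

text \<open>Since the projected derivative is injective, only the scale direction is mapped to \<open>U\<close>.\<close>

lemma param_hopf: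
  assumes v: "v \<in> S1 \<times> S2 \<times> UNIV"
    and inj: "\<And>v. v \<in> S1 \<times> S2 \<times> UNIV \<Longrightarrow> hor r (Zmap r \<phi> m1 m2 e) (frechet_derivative (Zmap r \<phi> m1 m2) (at e) v) = 0 \<Longrightarrow> v = 0"
    and h: "hor r (Zmap r \<phi> m1 m2 e) (frechet_derivative (Zmap r \<phi> m1 m2) (at e) v) = Umap \<phi> m1 m2 e"
  shows "- cov r (Zmap r \<phi> m1 m2 e) (frechet_derivative (Zmap r \<phi> m1 m2) (at e) v) (\<i> *\<^sub>C Umap \<phi> m1 m2 e)
      (\<i> *\<^sub>C frechet_derivative (Umap \<phi> m1 m2) (at e) v) = (2 / r * sin \<phi>) *\<^sub>R Umap \<phi> m1 m2 e"
proof -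
  \<comment> \<open>the rate at which \<open>l\<close> has to change for the projected velocity to be \<open>U\<close>\<close>
  define t where "t = - (cos \<phi> / r)"
  define v1 where "v1 = t *\<^sub>R (0 :: 'n cvec, 0 :: 'n cvec, snd (snd e))"
  note lin = has_derivative_linear[OF smooth_onD(2)[OF smooth_Zmap_Umap(1) e]] has_derivative_linear[OF smooth_onD(2)[OF smooth_Zmap_Umap(2) e]]
  have Z1: "frechet_derivative (Zmap r \<phi> m1 m2) (at e) v1 = t *\<^sub>R Zvec r (null1 m1 e) (- null2 \<phi> m1 m2 e)"
    using linear_cmul[OF lin(1), of t "(0, 0, snd (snd e))"] unfolding v1_def[symmetric] frechet_Zmap_Umap(1)[OF e, of "(0, 0, _)"] param_scale_direction .
  have U1: "frechet_derivative (Umap \<phi> m1 m2) (at e) v1 = t *\<^sub>R Uvec \<phi> (null1 m1 e) (- null2 \<phi> m1 m2 e)"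
    using linear_cmul[OF lin(2), of t "(0, 0, snd (snd e))"] unfolding v1_def[symmetric] frechet_Zmap_Umap(2)[OF e, of "(0, 0, _)"] param_scale_direction .
  note H = hopf_direction[OF r c null_pair, folded Zmap_def Umap_def t_def]
  have S: "subspace S1" "subspace S2" using null_chartD(1)[OF ch1] null_chartD(1)[OF ch2] .
  have v1T: "v1 \<in> S1 \<times> S2 \<times> UNIV" using S by (simp add: v1_def subspace_0)
  have "v - v1 = 0"
  proof (rule inj)
    show "v - v1 \<in> S1 \<times> S2 \<times> UNIV"
      by (rule subspace_diff[OF subspace_Times[OF S(1) subspace_Times[OF S(2) subspace_UNIV]] v v1T])
    show "hor r (Zmap r \<phi> m1 m2 e) (frechet_derivative (Zmap r \<phi> m1 m2) (at e) (v - v1)) = 0"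
      unfolding linear_diff[OF lin(1)] hor_linear(2) h Z1 H(1) by simp
  qed
  then have "v = v1" by simp
  then show ?thesis unfolding Z1 U1 using H(2) Z1 U1 by simp
qed

end

end

section \<open>The rank condition\<close>

text \<open>The alternating sum over the permutations of all indices but one is the determinant of the matrix
  bordered by a unit vector.\<close>

lemma alternating_sum_kernel:
  fixes f :: "'m::finite \<Rightarrow> 'm \<Rightarrow> real" and c :: "'m \<Rightarrow> real" and k :: 'm
  defines "I \<equiv> UNIV - {k}"
  assumes nz: "(\<Sum>\<sigma> | \<sigma> permutes I. of_int (sign \<sigma>) * (\<Prod>i\<in>I. f i (\<sigma> i))) \<noteq> 0"
    and ker: "\<And>i. i \<in> I \<Longrightarrow> (\<Sum>j\<in>I. f i j * c j) = 0" and j: "j \<in> I"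
  shows "c j = 0"
proof -
  define A :: "real ^ 'm ^ 'm" where "A = (\<chi> i j. if i = k \<or> j = k then of_bool (i = j) else f i j)"
  define x :: "real ^ 'm" where "x = (\<chi> j. if j = k then 0 else c j)"
  have U: "UNIV = insert k I" "k \<notin> I" "finite I" by (auto simp: I_def)
  have pr: "(\<Prod>i\<in>UNIV. A $ i $ \<sigma> i) = (\<Prod>i\<in>I. f i (\<sigma> i))" if \<sigma>: "\<sigma> permutes I" for \<sigma>
  proof -
    have k: "\<sigma> k = k" using permutes_not_in[OF \<sigma> U(2)] .
    have "\<sigma> i \<in> I" if "i \<in> I" for i using permutes_in_image[OF \<sigma>] that by simp
    then have "(\<Prod>i\<in>I. A $ i $ \<sigma> i) = (\<Prod>i\<in>I. f i (\<sigma> i))"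
      by (intro prod.cong) (auto simp: A_def I_def)
    then show ?thesis unfolding U(1) using U(2,3) by (simp add: k A_def)
  qed
  have "det A = (\<Sum>\<sigma> | \<sigma> permutes UNIV. of_int (sign \<sigma>) * (\<Prod>i\<in>UNIV. A $ i $ \<sigma> i))"
    by (simp add: det_def)
  also have "\<dots> = (\<Sum>\<sigma> | \<sigma> permutes I. of_int (sign \<sigma>) * (\<Prod>i\<in>UNIV. A $ i $ \<sigma> i))"
  proof (rule sum.mono_neutral_right)
    show "finite {\<sigma>. \<sigma> permutes (UNIV :: 'm set)}" by (rule finite_permutations) simp
    show "{\<sigma>. \<sigma> permutes I} \<subseteq> {\<sigma>. \<sigma> permutes UNIV}" by (auto intro: permutes_subset)
    show "\<forall>\<sigma>\<in>{\<sigma>. \<sigma> permutes UNIV} - {\<sigma>. \<sigma> permutes I}. of_int (sign \<sigma>) * (\<Prod>i\<in>UNIV. A $ i $ \<sigma> i) = 0"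
    proof
      fix \<sigma> assume \<sigma>: "\<sigma> \<in> {\<sigma>. \<sigma> permutes UNIV} - {\<sigma>. \<sigma> permutes I}"
      then have "\<sigma> k \<noteq> k" unfolding permutes_def I_def by auto
      then have "A $ k $ \<sigma> k = 0" by (simp add: A_def)
      then have "(\<Prod>i\<in>UNIV. A $ i $ \<sigma> i) = 0" by (intro prod_zero) auto
      then show "of_int (sign \<sigma>) * (\<Prod>i\<in>UNIV. A $ i $ \<sigma> i) = 0" by simp
    qed
  qed
  also have "\<dots> = (\<Sum>\<sigma> | \<sigma> permutes I. of_int (sign \<sigma>) * (\<Prod>i\<in>I. f i (\<sigma> i)))"
    by (rule sum.cong) (auto simp: pr)
  finally have "det A \<noteq> 0" using nz by simp
  then have "\<exists>B. B ** A = mat 1" using invertible_det_nz invertible_def by blast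
  moreover have "A *v x = 0"
  proof -
    have "(A *v x) $ i = 0" for i
    proof -
      have "(A *v x) $ i = (\<Sum>j\<in>I. A $ i $ j * c j)"
        unfolding matrix_vector_mult_def U(1) using U(2,3) by (simp add: x_def) (auto intro!: sum.cong simp: I_def)
      also have "\<dots> = 0"
      proof (cases "i = k")
        case True
        then show ?thesis by (intro sum.neutral) (auto simp: A_def I_def)
      next
        case False
        then have "(\<Sum>j\<in>I. A $ i $ j * c j) = (\<Sum>j\<in>I. f i j * c j)"
          by (intro sum.cong) (auto simp: A_def I_def)
        then show ?thesis using ker False by (simp add: I_def)
      qed
      finally show ?thesis .
    qed
    then show ?thesis by (simp add: vec_eq_iff)
  qed
  ultimately have "x = 0" using matrix_left_invertible_ker by blast
  then have "x $ j = 0" by simp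
  then show ?thesis using j by (simp add: x_def I_def)
qed

lemma has_vector_derivative_norm:
  fixes f :: "real \<Rightarrow> 'a::real_inner"
  assumes "(f has_vector_derivative d) (at t)" "f t \<noteq> 0"
  shows "((\<lambda>t. norm (f t)) has_vector_derivative (d \<bullet> sgn (f t))) (at t)"
  using diff_chain_at[OF assms(1)[unfolded has_vector_derivative_def] has_derivative_norm[OF assms(2)]]
  by (simp add: has_vector_derivative_def o_def)

text \<open>The parameter \<open>l\<close> as a function of the frame, for charts normalised to have time coordinate 1.\<close>

definition scale_coord :: "real \<Rightarrow> real \<Rightarrow> 'n::{finite,linorder} aframe \<Rightarrow> real" where
  "scale_coord r \<phi> h = cmod (fst (gvec r \<phi> 1 h)) / (2 * cos \<phi>)"

context
  fixes r \<phi> :: real and N1 N2 :: "'n::{finite,linorder} frame set set"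
    and W1 S1 W2 S2 :: "'n cvec set" and m1 m2 :: "'n cvec \<Rightarrow> 'n cvec"
    and F :: "'n cvec \<times> 'n cvec \<times> real \<Rightarrow> 'n cvec" and T \<Omega> :: "('n cvec \<times> 'n cvec \<times> real) set"
  assumes r: "r > 0" and c: "cos \<phi> > 0"
    and ch1: "null_chart r \<phi> 1 N1 W1 S1 m1" and ch2: "null_chart r \<phi> (-1) N2 W2 S2 m2"
    and F: "F = (\<lambda>e. dehom (Zmap r \<phi> m1 m2 e))" and T: "T = S1 \<times> S2 \<times> UNIV"
    and \<Omega>: "\<Omega> = {e \<in> param_dom W1 W2 m1 m2. fst (Zmap r \<phi> m1 m2 e) \<noteq> 0}"
begin

lemma subspace_T: "subspace T"
  unfolding T by (intro subspace_Times null_chartD(1)[OF ch1] null_chartD(1)[OF ch2] subspace_UNIV)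

lemma dim_T:
  assumes "dim S1 = CARD('n) - 1" "dim S2 = CARD('n) - 1"
  shows "dim T = 2 * CARD('n) - 1"
proof -
  have "dim T = dim S1 + dim (S2 \<times> (UNIV :: real set))"
    unfolding T by (intro dim_Times subspace_Times null_chartD(1)[OF ch1] null_chartD(1)[OF ch2] subspace_UNIV)
  also have "dim (S2 \<times> (UNIV :: real set)) = dim S2 + dim (UNIV :: real set)"
    by (intro dim_Times null_chartD(1)[OF ch2] subspace_UNIV)
  finally show ?thesis using assms by simp
qed

lemma Zmap_Q:
  assumes "e \<in> param_dom W1 W2 m1 m2" "e \<in> T"
  shows "Zmap r \<phi> m1 m2 e \<in> Q r" "fst (Zmap r \<phi> m1 m2 e) \<noteq> 0" "e \<in> \<Omega>"
proof -
  show *: "Zmap r \<phi> m1 m2 e \<in> Q r" using Zmap_Umap_unitary(1)[OF r c ch1 ch2] assms by (simp add: T)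
  show "fst (Zmap r \<phi> m1 m2 e) \<noteq> 0" by (rule Q_fst(1)[OF * r])
  then show "e \<in> \<Omega>" using assms by (simp add: \<Omega>)
qed

lemma \<Omega>_open: "open \<Omega>"
proof -
  note Z = smooth_Zmap_Umap(1)[OF r c ch1 ch2]
  have "\<Omega> = param_dom W1 W2 m1 m2 \<inter> Zmap r \<phi> m1 m2 -` {v. fst v \<noteq> 0}" by (auto simp: \<Omega>)
  moreover have "open \<dots>"
    by (rule continuous_open_preimage[OF smooth_onD(3)[OF Z] smooth_onD(1)[OF Z]])
       (intro open_Collect_neq continuous_intros)
  ultimately show ?thesis by simp
qed

lemma smooth_F: "smooth_on F \<Omega>"
  unfolding F by (rule smooth_on_dehom[OF smooth_on_subset[OF smooth_Zmap_Umap(1)[OF r c ch1 ch2] \<Omega>_open]]) (auto simp: \<Omega>)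

lemma frechet_F:
  assumes "e \<in> \<Omega>"
  shows "frechet_derivative F (at e) v = ddehom (Zmap r \<phi> m1 m2 e) (frechet_derivative (Zmap r \<phi> m1 m2) (at e) v)"
proof -
  have e: "e \<in> param_dom W1 W2 m1 m2" "fst (Zmap r \<phi> m1 m2 e) \<noteq> 0" using assms by (auto simp: \<Omega>)
  from diff_chain_at[OF smooth_onD(2)[OF smooth_Zmap_Umap(1)[OF r c ch1 ch2] e(1)] has_derivative_dehom[OF e(2)]]
  show ?thesis by (simp add: frechet_eqI F o_def)
qed

lemma frame_params:
  assumes h: "h \<in> adapted_frames r" and x: "x1 \<in> W1 \<inter> S1" "x2 \<in> W2 \<inter> S2"
    and d: "dehom (gvec r \<phi> 1 h) = m1 x1" "dehom (gvec r \<phi> (-1) h) = m2 x2"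
  shows "(x1, x2, scale_coord r \<phi> h) \<in> param_dom W1 W2 m1 m2" "(x1, x2, scale_coord r \<phi> h) \<in> T"
    "hopf (fst h) = hopf (Zmap r \<phi> m1 m2 (x1, x2, scale_coord r \<phi> h))"
    "dehom (fst h) = F (x1, x2, scale_coord r \<phi> h)"
proof -
  have f: "fst (m1 x1) = 1" "fst (m2 x2) = 1" using null_chartD(3)[OF ch1] null_chartD(3)[OF ch2] x by auto
  have dd: "dehom (gvec r \<phi> 1 h) = dehom (m1 x1)" "dehom (gvec r \<phi> (-1) h) = dehom (m2 x2)"
    using d f by (simp_all add: dehom_def[of "m1 x1"] dehom_def[of "m2 x2"])
  have \<zeta>: "herm (m1 x1) (m2 x2) \<noteq> 0"
    by (rule frame_lines_pairing[OF h r c _ _ dd]) (simp_all add: f)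
  define N where "N = (null_pairing \<phi> / herm (m1 x1) (m2 x2)) *\<^sub>C m2 x2"
  have N: "fst N \<noteq> 0" "herm (m1 x1) N = null_pairing \<phi>" "dehom (m2 x2) = dehom N"
    using \<zeta> f null_pairing_nonzero[OF c] by (simp_all add: N_def herm_cscale)
  have l: "scale_coord r \<phi> h = cmod (fst (gvec r \<phi> 1 h)) / (2 * cos \<phi> * cmod (fst (m1 x1)))"
    by (simp add: scale_coord_def f)
  note FN = frame_null_lines[OF h r c _ N(1,2) dd(1) dd(2)[unfolded N(3)] l]
  show 1: "(x1, x2, scale_coord r \<phi> h) \<in> param_dom W1 W2 m1 m2" "(x1, x2, scale_coord r \<phi> h) \<in> T"
    using FN(1) \<zeta> f x by (simp_all add: param_dom_def T)
  have "null2 \<phi> m1 m2 (x1, x2, l) = of_real (1 / l) *\<^sub>C N" for l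
    by (simp add: null2_def N_def cscale_assoc field_simps)
  then show 2: "hopf (fst h) = hopf (Zmap r \<phi> m1 m2 (x1, x2, scale_coord r \<phi> h))"
    using FN(2) f by (simp add: Zmap_def null1_def)
  show "dehom (fst h) = F (x1, x2, scale_coord r \<phi> h)"
    using hopf_eq_iff(1)[OF adaptedD(1)[OF h r] Zmap_Q(1)[OF 1] r] 2 by (simp add: F)
qed

text \<open>A tangent vector of \<open>R\<close> is the velocity at one point of a curve that may be irregular elsewhere; the
  parameters of this curve are differentiable at that point by \<open>null_chart_curve\<close>.\<close>

lemma tangent_in_range:
  assumes g: "g \<in> adapted_frames r" and x: "x1 \<in> W1 \<inter> S1" "x2 \<in> W2 \<inter> S2"
    and d: "dehom (gvec r \<phi> 1 g) = m1 x1" "dehom (gvec r \<phi> (-1) g) = m2 x2"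
    and X: "X \<in> tangent_space {h \<in> adapted_frames r. frame_proj r h \<in> R_set r \<phi> N1 N2} g"
  obtains v where "v \<in> T" "frechet_derivative F (at (x1, x2, scale_coord r \<phi> g)) v = ddehom (fst g) (fst X)"
proof -
  obtain k where k': "\<forall>t. k t \<in> adapted_frames r \<and> frame_proj r (k t) \<in> R_set r \<phi> N1 N2" "k 0 = g" "(k has_vector_derivative X) (at 0)"
    using X unfolding tangent_space_def mem_Collect_eq by (elim exE conjE)
  then have k: "\<And>t. k t \<in> adapted_frames r" "\<And>t. frame_proj r (k t) \<in> R_set r \<phi> N1 N2" "k 0 = g"
    "(k has_vector_derivative X) (at 0)"
    by simp_all
  have kN: "leaf r \<phi> 1 (frame_proj r (k t)) \<in> N1" "leaf r \<phi> (-1) (frame_proj r (k t)) \<in> N2" for t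
    using k(2)[of t] by (simp_all add: R_set_def)
  obtain y1 v1 where y1: "y1 0 = x1" "v1 \<in> S1" "(y1 has_vector_derivative v1) (at 0)"
    "\<forall>\<^sub>F t in nhds 0. y1 t \<in> W1 \<inter> S1 \<and> dehom (gvec r \<phi> 1 (k t)) = m1 (y1 t)"
    using null_chart_curve[OF r _ ch1 k(1) kN(1) k(4) x(1)] d(1) k(3) by auto
  obtain y2 v2 where y2: "y2 0 = x2" "v2 \<in> S2" "(y2 has_vector_derivative v2) (at 0)"
    "\<forall>\<^sub>F t in nhds 0. y2 t \<in> W2 \<inter> S2 \<and> dehom (gvec r \<phi> (-1) (k t)) = m2 (y2 t)"
    using null_chart_curve[OF r _ ch2 k(1) kN(2) k(4) x(2)] d(2) k(3) by auto
  have f: "((\<lambda>t. fst (gvec r \<phi> 1 (k t))) has_vector_derivative fst (gvec r \<phi> 1 X)) (at 0)"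
    by (rule bounded_linear.has_vector_derivative[OF bounded_linear_fst bounded_linear.has_vector_derivative[OF bounded_linear_gvec k(4)]])
  have f0: "fst (gvec r \<phi> 1 (k 0)) \<noteq> 0" by (rule herm_gvec(5)[OF k(1) r]) simp
  obtain l' where l': "((\<lambda>t. scale_coord r \<phi> (k t)) has_vector_derivative l') (at 0)"
    unfolding scale_coord_def using has_vector_derivative_divide[OF has_vector_derivative_norm[OF f f0]] by blast
  define y where "y t = (y1 t, y2 t, scale_coord r \<phi> (k t))" for t
  have y0: "y 0 = (x1, x2, scale_coord r \<phi> g)" by (simp add: y_def y1 y2 k)
  have yv: "(y has_vector_derivative (v1, v2, l')) (at 0)"
    unfolding y_def by (intro has_vector_derivative_Pair y1 y2 l')
  have e: "y 0 \<in> \<Omega>" unfolding y0 using Zmap_Q(3)[OF frame_params(1,2)[OF g x d]] .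
  have "((\<lambda>t. F (y t)) has_derivative (\<lambda>t. frechet_derivative F (at (y 0)) (t *\<^sub>R (v1, v2, l')))) (at 0)"
    using diff_chain_at[OF yv[unfolded has_vector_derivative_def] smooth_onD(2)[OF smooth_F e]] by (simp only: o_def)
  then have 1: "((\<lambda>t. F (y t)) has_vector_derivative frechet_derivative F (at (y 0)) (v1, v2, l')) (at 0)"
    unfolding has_vector_derivative_def linear_cmul[OF has_derivative_linear[OF smooth_onD(2)[OF smooth_F e]]] .
  have z0: "fst (fst (k 0)) \<noteq> 0" by (rule Q_fst(1)[OF adaptedD(1)[OF k(1) r] r])
  have 2: "((\<lambda>t. dehom (fst (k t))) has_vector_derivative ddehom (fst (k 0)) (fst X)) (at 0)"
    by (rule has_vector_derivative_dehom[OF bounded_linear.has_vector_derivative[OF bounded_linear_fst k(4)] z0])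
  have ev: "\<forall>\<^sub>F t in nhds 0. dehom (fst (k t)) = F (y t)"
    using y1(4) y2(4)
  proof eventually_elim
    case (elim t)
    then show ?case using frame_params(4)[OF k(1)] by (simp add: y_def)
  qed
  have "((\<lambda>t. F (y t)) has_vector_derivative ddehom (fst (k 0)) (fst X)) (at 0)"
    unfolding has_vector_derivative_def
  proof (rule has_derivative_transform_eventually[OF 2[unfolded has_vector_derivative_def]])
    show "\<forall>\<^sub>F t in at 0. dehom (fst (k t)) = F (y t)" using ev unfolding eventually_at_filter by eventually_elim simp
    show "dehom (fst (k 0)) = F (y 0)" using ev by (rule eventually_nhds_x_imp_x)
  qed simp
  then have "frechet_derivative F (at (y 0)) (v1, v2, l') = ddehom (fst g) (fst X)"
    using vector_derivative_unique_at[OF 1] k(3) by simp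
  moreover have "(v1, v2, l') \<in> T" using y1 y2 by (simp add: T)
  ultimately show thesis using that y0 by simp
qed

text \<open>
  The space of parameters has dimension \<open>2n - 1\<close>, and the non-vanishing wedge product provides
  as many tangent vectors of \<open>R\<close> with independent projections, all in the range of the derivative.
\<close>

lemma immersion_of_wedge:
  assumes g: "g \<in> adapted_frames r" and x: "x1 \<in> W1 \<inter> S1" "x2 \<in> W2 \<inter> S2"
    and d: "dehom (gvec r \<phi> 1 g) = m1 x1" "dehom (gvec r \<phi> (-1) g) = m2 x2"
    and dim: "dim S1 = CARD('n) - 1" "dim S2 = CARD('n) - 1"
    and wedge: "wedge_nonzero r (R_set r \<phi> N1 N2) g"
    and v: "v \<in> T" "frechet_derivative F (at (x1, x2, scale_coord r \<phi> g)) v = 0"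
  shows "v = 0"
proof -
  let ?D = "frechet_derivative F (at (x1, x2, scale_coord r \<phi> g))"
  define L :: "'n + 'n" where "L = Inr last_index"
  define I where "I = UNIV - {L}"
  obtain X where X: "\<And>j. j \<in> I \<Longrightarrow> X j \<in> tangent_space {h \<in> adapted_frames r. frame_proj r h \<in> R_set r \<phi> N1 N2} g"
    "(\<Sum>\<sigma> | \<sigma> permutes I. of_int (sign \<sigma>) * (\<Prod>i\<in>I. omega r i g (X (\<sigma> i)))) \<noteq> 0"
    using wedge unfolding wedge_nonzero_def Let_def I_def L_def by blast
  have "\<exists>w. w \<in> T \<and> ?D w = ddehom (fst g) (fst (X j))" if "j \<in> I" for j
    using tangent_in_range[OF g x d X(1)[OF that]] by blast
  then obtain w where w: "\<And>j. j \<in> I \<Longrightarrow> w j \<in> T" "\<And>j. j \<in> I \<Longrightarrow> ?D (w j) = ddehom (fst g) (fst (X j))" by metis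
  have z: "fst g \<in> Q r" by (rule adaptedD(1)[OF g r])
  have indep: "k j = 0" if "(\<Sum>j\<in>I. k j *\<^sub>R ddehom (fst g) (fst (X j))) = 0" and j: "j \<in> I" for k :: "'n + 'n \<Rightarrow> real" and j
  proof -
    have "ddehom (fst g) (\<Sum>j\<in>I. k j *\<^sub>R fst (X j)) = 0"
      using that(1) by (simp add: linear_sum[OF linear_ddehom] linear_cmul[OF linear_ddehom])
    then obtain \<mu> where \<mu>: "(\<Sum>j\<in>I. k j *\<^sub>R fst (X j)) = \<mu> *\<^sub>C fst g"
      using ddehom_eq_0_iff[OF Q_fst(1)[OF z r]] by blast
    have "(\<Sum>j\<in>I. omega r i g (X j) * k j) = 0" for i
    proof -
      define p where "p y = ip (snd g $ i) (hor r (fst g) y)" for y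
      have lp: "linear p" unfolding p_def by (rule linearI) (simp_all add: hor_linear ip_def herm_add herm_scaleR)
      have "(\<Sum>j\<in>I. omega r i g (X j) * k j) = (\<Sum>j\<in>I. k j *\<^sub>R p (fst (X j)))"
        by (simp add: omega_def p_def mult.commute)
      also have "\<dots> = p (\<mu> *\<^sub>C fst g)" unfolding \<mu>[symmetric] by (simp only: linear_sum[OF lp] linear_cmul[OF lp])
      also have "\<dots> = 0" by (simp add: p_def hor_linear hor_self[OF z r] ip_def)
      finally show ?thesis .
    qed
    then show "k j = 0"
      using alternating_sum_kernel[where k = L and f = "\<lambda>i j. omega r i g (X j)" and c = k and j = j, folded I_def] X(2) j by blast
  qed
  have e: "(x1, x2, scale_coord r \<phi> g) \<in> \<Omega>" using Zmap_Q(3)[OF frame_params(1,2)[OF g x d]] .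
  have lD: "linear ?D" by (rule has_derivative_linear[OF smooth_onD(2)[OF smooth_F e]])
  define \<Psi> where "\<Psi> k = (\<Sum>j\<in>I. (k $ j) *\<^sub>R w j)" for k :: "real ^ ('n + 'n)"
  define K where "K = {k :: real ^ ('n + 'n). axis L 1 \<bullet> k = 0}"
  have l\<Psi>: "linear \<Psi>" unfolding \<Psi>_def by (rule linearI) (simp_all add: scaleR_left_distrib sum.distrib scaleR_sum_right)
  have D\<Psi>: "?D (\<Psi> k) = (\<Sum>j\<in>I. (k $ j) *\<^sub>R ddehom (fst g) (fst (X j)))" for k
    unfolding \<Psi>_def by (simp add: linear_sum[OF lD] linear_cmul[OF lD] w(2))
  have zero: "k = 0" if "k \<in> K" "?D (\<Psi> k) = 0" for k
  proof -
    have "k $ j = 0" for j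
    proof (cases "j \<in> I")
      case True
      then show ?thesis using indep[of "\<lambda>j. k $ j"] that(2) unfolding D\<Psi> by blast
    next
      case False
      then show ?thesis using that(1) by (simp add: I_def K_def inner_axis')
    qed
    then show ?thesis by (simp add: vec_eq_iff)
  qed
  have K: "subspace K" unfolding K_def by (rule subspace_hyperplane)
  have "inj_on \<Psi> K"
  proof (rule inj_onI)
    fix a b assume "a \<in> K" "b \<in> K" "\<Psi> a = \<Psi> b"
    then have "a - b \<in> K" "?D (\<Psi> (a - b)) = 0" using K by (simp_all add: subspace_diff linear_diff[OF l\<Psi>] linear_0[OF lD])
    then have "a - b = 0" by (rule zero)
    then show "a = b" by simp
  qed
  moreover have "span K = K" using K by (simp only: span_eq_iff)
  ultimately have "dim (\<Psi> ` K) = dim K" by (metis dim_image_eq l\<Psi>)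
  also have "dim K = 2 * CARD('n) - 1" unfolding K_def by (subst dim_hyperplane) (simp_all add: axis_eq_0_iff)
  also have "\<dots> = dim T" by (rule dim_T[OF dim, symmetric])
  finally have dK: "dim (\<Psi> ` K) = dim T" .
  have "\<Psi> k \<in> T" for k
    unfolding \<Psi>_def by (intro subspace_sum subspace_T subspace_scale w(1))
  then have "\<Psi> ` K \<subseteq> T" by blast
  then have "\<Psi> ` K = T"
    using subspace_dim_equal[OF linear_subspace_image[OF l\<Psi> K] subspace_T] dK by simp
  then obtain k where "k \<in> K" "v = \<Psi> k" using v(1) by blast
  then show "v = 0" using zero[of k] v(2) linear_0[OF l\<Psi>] by simp
qed

section \<open>The hypersurface\<close>

text \<open>The neighbourhood is a product because its three factors translate into three open conditions on frames.\<close>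

lemma local_box:
  assumes p0: "p0 \<in> \<Omega>" "p0 \<in> T"
    and inj: "\<And>v. v \<in> T \<Longrightarrow> frechet_derivative F (at p0) v = 0 \<Longrightarrow> v = 0"
  obtains V1 V2 J k where "open V1" "open V2" "open J" "p0 \<in> V1 \<times> V2 \<times> J" "V1 \<times> V2 \<times> J \<subseteq> \<Omega>" "V1 \<subseteq> W1" "V2 \<subseteq> W2" "k > 0"
    "\<forall>x\<in>(V1 \<times> V2 \<times> J) \<inter> T. \<forall>y\<in>(V1 \<times> V2 \<times> J) \<inter> T. k * norm (x - y) \<le> norm (F x - F y)"
    "\<forall>e\<in>(V1 \<times> V2 \<times> J) \<inter> T. \<forall>v\<in>T. frechet_derivative F (at e) v = 0 \<longrightarrow> v = 0"
proof -
  obtain k d where kd: "k > 0" "d > 0" "ball p0 d \<subseteq> \<Omega>"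
    "\<And>x y. x \<in> ball p0 d \<Longrightarrow> y \<in> ball p0 d \<Longrightarrow> x - y \<in> T \<Longrightarrow> k * norm (x - y) \<le> norm (F x - F y)"
    using immersion_lower_bound[OF smooth_F p0(1) subspace_T inj] by blast
  have "open (ball p0 d)" "p0 \<in> ball p0 d" using kd(2) by simp_all
  then obtain V1 B where B: "open V1" "open B" "p0 \<in> V1 \<times> B" "V1 \<times> B \<subseteq> ball p0 d" by (rule open_prod_elim)
  have "snd p0 \<in> B" using B(3) by (simp add: mem_Times_iff)
  with B(2) obtain V2 J where VJ: "open V2" "open J" "snd p0 \<in> V2 \<times> J" "V2 \<times> J \<subseteq> B" by (rule open_prod_elim)
  have in_box: "p0 \<in> V1 \<times> V2 \<times> J" using B(3) VJ(3) by (simp add: mem_Times_iff)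
  have sub: "V1 \<times> V2 \<times> J \<subseteq> ball p0 d" using B(4) VJ(4) by blast
  have "V1 \<subseteq> W1"
  proof
    fix x assume "x \<in> V1"
    then have "(x, snd p0) \<in> V1 \<times> V2 \<times> J" using in_box by (simp add: mem_Times_iff)
    then have "(x, snd p0) \<in> \<Omega>" by (rule subsetD[OF subset_trans[OF sub kd(3)]])
    then show "x \<in> W1" by (simp add: \<Omega> param_dom_def)
  qed
  moreover have "V2 \<subseteq> W2"
  proof
    fix x assume "x \<in> V2"
    then have "(fst p0, x, snd (snd p0)) \<in> V1 \<times> V2 \<times> J" using in_box by (simp add: mem_Times_iff)
    then have "(fst p0, x, snd (snd p0)) \<in> \<Omega>" by (rule subsetD[OF subset_trans[OF sub kd(3)]])
    then show "x \<in> W2" by (simp add: \<Omega> param_dom_def)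
  qed
  moreover have "v = 0" if e: "e \<in> (V1 \<times> V2 \<times> J) \<inter> T" and v: "v \<in> T" "frechet_derivative F (at e) v = 0" for e v
  proof -
    have eb: "e \<in> ball p0 d" using e sub by blast
    then have e\<Omega>: "e \<in> \<Omega>" using kd(3) by blast
    obtain d' where d': "d' > 0" "ball e d' \<subseteq> ball p0 d" using open_ball eb openE by blast
    show ?thesis
      by (rule lower_bound_injective_derivative[OF smooth_onD(2)[OF smooth_F e\<Omega>] kd(1) d'(1) subspace_T _ v])
         (use kd(4) eb d'(2) in blast)
  qed
  moreover have "k * norm (x - y) \<le> norm (F x - F y)" if "x \<in> (V1 \<times> V2 \<times> J) \<inter> T" "y \<in> (V1 \<times> V2 \<times> J) \<inter> T" for x y
  proof (rule kd(4))
    show "x \<in> ball p0 d" "y \<in> ball p0 d" using subsetD[OF sub IntD1[OF that(1)]] subsetD[OF sub IntD1[OF that(2)]] .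
    show "x - y \<in> T" using that by (intro subspace_diff[OF subspace_T]) simp_all
  qed
  ultimately show thesis
    by (intro that[of V1 V2 J k] B(1) VJ(1,2) in_box subset_trans[OF sub kd(3)] kd(1)) blast+
qed

context
  fixes V1 V2 :: "'n cvec set" and J :: "real set" and k :: real and V :: "('n cvec \<times> 'n cvec \<times> real) set"
  assumes V: "open V1" "open V2" "open J" "V = V1 \<times> V2 \<times> J" and sub: "V \<subseteq> \<Omega>" and k: "k > 0"
    and lower': "\<forall>x\<in>V \<inter> T. \<forall>y\<in>V \<inter> T. k * norm (x - y) \<le> norm (F x - F y)"
    and imm': "\<forall>e\<in>V \<inter> T. \<forall>v\<in>T. frechet_derivative F (at e) v = 0 \<longrightarrow> v = 0"
begin

lemmas lower = bspec[OF bspec[OF lower']] and imm = mp[OF bspec[OF bspec[OF imm']]]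

lemma V_open: "open V"
  unfolding V(4) by (intro open_Times V)

lemma V_dom: "V \<subseteq> param_dom W1 W2 m1 m2"
  using sub by (auto simp: \<Omega>)

lemma V_imm:
  assumes e: "e \<in> V \<inter> T" and v: "v \<in> T" and h: "hor r (Zmap r \<phi> m1 m2 e) (frechet_derivative (Zmap r \<phi> m1 m2) (at e) v) = 0"
  shows "v = 0"
proof (rule imm[OF e v])
  have e': "e \<in> \<Omega>" using e sub by blast
  then have f0: "fst (Zmap r \<phi> m1 m2 e) \<noteq> 0" by (simp add: \<Omega>)
  show "frechet_derivative F (at e) v = 0"
    unfolding frechet_F[OF e'] ddehom_eq_0_iff[OF f0] by (rule hor_eq_0D[OF h])
qed

text \<open>The lower bound makes the parametrisation a homeomorphism onto its image.\<close>

lemma image_open: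
  assumes V': "open V'" "V' \<subseteq> V"
  obtains A where "quot_open (Q r) hopf A" "(\<lambda>e. hopf (Zmap r \<phi> m1 m2 e)) ` (V' \<inter> T) = (\<lambda>e. hopf (Zmap r \<phi> m1 m2 e)) ` (V \<inter> T) \<inter> A"
proof -
  have ZQ: "Zmap r \<phi> m1 m2 e \<in> Q r" if "e \<in> V \<inter> T" for e using Zmap_Q(1) V_dom that by blast
  have "\<exists>d>0. ball e d \<subseteq> V'" if "e \<in> V'" for e using V'(1) that openE by blast
  then obtain \<delta> where \<delta>: "\<And>e. e \<in> V' \<Longrightarrow> \<delta> e > 0 \<and> ball e (\<delta> e) \<subseteq> V'" by metis
  define Ob where "Ob = (\<Union>e\<in>V' \<inter> T. ball (F e) (k * \<delta> e))"
  have Ob: "open Ob" unfolding Ob_def by auto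
  have iff: "F e \<in> Ob \<longleftrightarrow> e \<in> V'" if e: "e \<in> V \<inter> T" for e
  proof
    assume "F e \<in> Ob"
    then obtain e' where e': "e' \<in> V' \<inter> T" "norm (F e' - F e) < k * \<delta> e'" by (auto simp: Ob_def dist_norm)
    have "k * norm (e' - e) \<le> norm (F e' - F e)" using e e' V'(2) by (intro lower) auto
    then have "norm (e' - e) < \<delta> e'" using e'(2) k by (smt (verit) mult_left_mono)
    then have "e \<in> ball e' (\<delta> e')" by (simp add: dist_norm)
    then show "e \<in> V'" using \<delta> e'(1) by blast
  next
    assume "e \<in> V'"
    then have "F e \<in> ball (F e) (k * \<delta> e)" using \<delta> k by simp
    then show "F e \<in> Ob" using \<open>e \<in> V'\<close> e unfolding Ob_def by blast
  qed
  define A where "A = hopf ` {z \<in> Q r. dehom z \<in> (Ob :: 'n cvec set)}"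
  have A: "hopf z \<in> A \<longleftrightarrow> dehom z \<in> Ob" if "z \<in> Q r" for z
  proof
    assume "hopf z \<in> A"
    then obtain z' where "z' \<in> Q r" "dehom z' \<in> Ob" "hopf z = hopf z'" unfolding A_def by blast
    then show "dehom z \<in> Ob" using hopf_eq_iff(1)[OF that _ r] by metis
  qed (use that in \<open>auto simp: A_def\<close>)
  have "continuous_on (Q r) (dehom :: 'n cvec \<Rightarrow> _)"
    using has_derivative_continuous[OF has_derivative_dehom] Q_fst(1)[OF _ r] by (intro continuous_at_imp_continuous_on) blast
  then have "openin (top_of_set (Q r)) (Q r \<inter> dehom -` Ob)" using Ob by (rule continuous_openin_preimage_gen)
  moreover have "Q r \<inter> dehom -` Ob = {z \<in> Q r. hopf z \<in> A}" using A by auto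
  ultimately have "quot_open (Q r) hopf A" by (auto simp: quot_open_def A_def)
  moreover have "(\<lambda>e. hopf (Zmap r \<phi> m1 m2 e)) ` (V' \<inter> T) = (\<lambda>e. hopf (Zmap r \<phi> m1 m2 e)) ` (V \<inter> T) \<inter> A"
  proof -
    have "hopf (Zmap r \<phi> m1 m2 e) \<in> A \<longleftrightarrow> e \<in> V'" if "e \<in> V \<inter> T" for e
      using iff[OF that] A[OF ZQ[OF that]] by (simp add: F)
    then show ?thesis using V'(2) by blast
  qed
  ultimately show thesis using that by blast
qed

text \<open>The parameter space \<open>T\<close> is transferred by a linear isomorphism to a subspace of \<open>\<complex>\<^sup>n\<^sup>+\<^sup>1\<close>, in which
  the parametrisations of hypersurfaces have their domains.  The unit normal is \<open>\<i> U\<close>.\<close>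

lemma hopf_hypersurface_box:
  assumes dim: "dim S1 = CARD('n) - 1" "dim S2 = CARD('n) - 1"
  shows "hopf_hypersurface r (2 / r * sin \<phi>) ((\<lambda>e. hopf (Zmap r \<phi> m1 m2 e)) ` (V \<inter> T))"
proof -
  let ?Z = "Zmap r \<phi> m1 m2" and ?U = "Umap \<phi> m1 m2"
  let ?M = "(\<lambda>e. hopf (?Z e)) ` (V \<inter> T)"
  have dT: "dim T = 2 * CARD('n) - 1" by (rule dim_T[OF dim])
  have "2 * CARD('n) - 1 \<le> dim (UNIV :: 'n cvec set)" by simp
  then obtain S :: "'n cvec set" where S: "subspace S" "dim S = 2 * CARD('n) - 1"
    using choose_subspace_of_subspace by metis
  obtain L where L: "linear L" "L ` S = T" "inj_on L S"
    using subspace_isomorphism[OF S(1) subspace_T] S(2) dT by auto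
  obtain G where G: "G ` UNIV \<subseteq> S" "linear G" "\<And>v. v \<in> S \<Longrightarrow> G (L v) = v"
    using linear_exists_left_inverse_on[OF L(1) S(1) L(3)] by auto
  have bL: "bounded_linear L" and bG: "bounded_linear G" using L(1) G(2) linear_conv_bounded_linear by blast+
  define W where "W = L -` V"
  have W: "open W" unfolding W_def using V_open linear_continuous_on[OF bL] by (intro open_vimage) auto
  have WS: "L x \<in> V \<inter> T" if "x \<in> W \<inter> S" for x using that L(2) by (auto simp: W_def)
  have LWS: "L ` (W' \<inter> S) = (V \<inter> G -` W') \<inter> T" if "W' \<subseteq> W" for W'
  proof (intro equalityI subsetI)
    fix e assume "e \<in> L ` (W' \<inter> S)"
    then show "e \<in> (V \<inter> G -` W') \<inter> T" using that G(3) L(2) by (auto simp: W_def)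
  next
    fix e assume e: "e \<in> (V \<inter> G -` W') \<inter> T"
    then obtain x where x: "x \<in> S" "e = L x" using L(2) by blast
    then show "e \<in> L ` (W' \<inter> S)" using e G(3) by auto
  qed
  have dom: "L ` W \<subseteq> param_dom W1 W2 m1 m2" using V_dom by (auto simp: W_def)
  define \<psi> where "\<psi> x = ?Z (L x)" for x
  define \<nu> where "\<nu> x = \<i> *\<^sub>C ?U (L x)" for x
  have s\<psi>: "smooth_on \<psi> W" unfolding \<psi>_def by (rule smooth_on_compose_linear[OF smooth_Zmap_Umap(1)[OF r c ch1 ch2] bL W dom])
  have s\<nu>: "smooth_on \<nu> W"
    unfolding \<nu>_def
    by (rule smooth_on_linear[OF bounded_bilinear.bounded_linear_right[OF bounded_bilinear_cscale] smooth_on_compose_linear[OF smooth_Zmap_Umap(2)[OF r c ch1 ch2] bL W dom]])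
  have d\<psi>: "frechet_derivative \<psi> (at x) v = frechet_derivative ?Z (at (L x)) (L v)" if "x \<in> W" for x v
  proof -
    have "L x \<in> param_dom W1 W2 m1 m2" using dom that by blast
    from diff_chain_at[OF bounded_linear_imp_has_derivative[OF bL] smooth_onD(2)[OF smooth_Zmap_Umap(1)[OF r c ch1 ch2] this]]
    show ?thesis by (simp add: frechet_eqI \<psi>_def[abs_def] o_def)
  qed
  have d\<nu>: "frechet_derivative \<nu> (at x) v = \<i> *\<^sub>C frechet_derivative ?U (at (L x)) (L v)" if "x \<in> W" for x v
  proof -
    have "L x \<in> param_dom W1 W2 m1 m2" using dom that by blast
    from diff_chain_at[OF bounded_linear_imp_has_derivative[OF bL] smooth_onD(2)[OF smooth_Zmap_Umap(2)[OF r c ch1 ch2] this]]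
    have "((\<lambda>x. ?U (L x)) has_derivative (\<lambda>v. frechet_derivative ?U (at (L x)) (L v))) (at x)" by (simp only: o_def)
    from bounded_linear.has_derivative[OF bounded_bilinear.bounded_linear_right[OF bounded_bilinear_cscale] this, of \<i>]
    show ?thesis by (simp add: frechet_eqI \<nu>_def[abs_def])
  qed
  have pd: "L x \<in> param_dom W1 W2 m1 m2" "L x \<in> S1 \<times> S2 \<times> UNIV" if "x \<in> W \<inter> S" for x
    using WS[OF that] V_dom T by blast+
  have at: "?Z (L x) \<in> Q r" "herm (?Z (L x)) (?U (L x)) = 0" "herm (?U (L x)) (?U (L x)) = 1" if "x \<in> W \<inter> S" for x
    using Zmap_Umap_unitary(1-3)[OF r c ch1 ch2 pd[OF that]] .
  have LT: "L v \<in> S1 \<times> S2 \<times> UNIV" if "v \<in> S" for v using L(2) that T by blast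
  have img: "(hopf \<circ> \<psi>) ` (W' \<inter> S) = (\<lambda>e. hopf (?Z e)) ` (V \<inter> G -` W' \<inter> T)" if "W' \<subseteq> W" for W'
    unfolding LWS[OF that, symmetric] by (simp add: image_image \<psi>_def)
  have lp: "hypersurface_param r ?M W S \<psi>"
    unfolding hypersurface_param_def local_param_def
  proof (intro conjI allI impI ballI)
    show "subspace S" "dim S = 2 * CARD('n) - 1" "smooth_on \<psi> W" by fact+
    show "\<psi> ` (W \<inter> S) \<subseteq> Q r" using at(1) by (auto simp: \<psi>_def)
    show "inj_on (hopf \<circ> \<psi>) (W \<inter> S)"
    proof (rule inj_onI)
      fix x y assume xy: "x \<in> W \<inter> S" "y \<in> W \<inter> S" "(hopf \<circ> \<psi>) x = (hopf \<circ> \<psi>) y"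
      then have "F (L x) = F (L y)" using hopf_eq_iff(1)[OF at(1)[OF xy(1)] at(1)[OF xy(2)] r] by (simp add: F \<psi>_def)
      then have "k * norm (L x - L y) \<le> 0" using lower[OF WS[OF xy(1)] WS[OF xy(2)]] by simp
      then have "norm (L x - L y) \<le> 0" using k by (simp add: mult_le_0_iff)
      then have "L x = L y" by simp
      then show "x = y" using inj_onD[OF L(3)] xy by blast
    qed
    show "\<exists>A. quot_open (Q r) hopf A \<and> (hopf \<circ> \<psi>) ` (W' \<inter> S) = ?M \<inter> A" if W': "open W' \<and> W' \<subseteq> W" for W'
    proof -
      have "open (V \<inter> G -` W')" using V_open W' linear_continuous_on[OF bG] by (intro open_Int open_vimage) auto
      from image_open[OF this] show ?thesis using img[of W'] W' by (metis inf_le1)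
    qed
    fix x v assume x: "x \<in> W \<inter> S" and v: "v \<in> S" and h: "frechet_derivative \<psi> (at x) v \<in> {X. hor r (\<psi> x) X = 0}"
    have "L v = 0" using V_imm[OF WS[OF x], of "L v"] h d\<psi>[of x v] x v LT T by (simp add: \<psi>_def)
    then show "v = 0" using G(3)[OF v] linear_0[OF G(2)] by simp
  qed
  have un: "unit_normal W S \<psi> \<nu>"
    unfolding unit_normal_def
  proof (intro conjI ballI)
    show "smooth_on \<nu> W" by fact
    fix x assume x: "x \<in> W \<inter> S"
    show "herm (\<psi> x) (\<nu> x) = 0" "ip (\<nu> x) (\<nu> x) = 1" using at(2,3)[OF x] by (simp_all add: \<psi>_def \<nu>_def herm_cscale ip_def)
    show "ip (\<nu> x) (frechet_derivative \<psi> (at x) v) = 0" if v: "v \<in> S" for v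
      using param_normal[OF r c ch1 ch2 pd[OF x] LT[OF v]] d\<psi>[of x v] x by (simp add: \<nu>_def)
  qed
  have Hopf: "- cov r (\<psi> x) (frechet_derivative \<psi> (at x) v) (\<nu> x) (frechet_derivative \<nu> (at x) v) = (2 / r * sin \<phi>) *\<^sub>R ((- \<i>) *\<^sub>C \<nu> x)"
    if x: "x \<in> W \<inter> S" and v: "v \<in> S" and h: "hor r (\<psi> x) (frechet_derivative \<psi> (at x) v) = (- \<i>) *\<^sub>C \<nu> x" for x v
  proof -
    have iu: "(- \<i>) *\<^sub>C \<nu> x = ?U (L x)" unfolding \<nu>_def by (simp add: cscale_assoc del: cscale_triv(4))
    have xW: "x \<in> W" using x by simp
    show ?thesis
      unfolding iu unfolding d\<psi>[OF xW] d\<nu>[OF xW] \<psi>_def \<nu>_def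
    proof (rule param_hopf[OF r c ch1 ch2 pd[OF x] LT[OF v]])
      show "w = 0" if "w \<in> S1 \<times> S2 \<times> UNIV" "hor r (?Z (L x)) (frechet_derivative ?Z (at (L x)) w) = 0" for w
        using V_imm[OF WS[OF x]] that T by blast
      show "hor r (?Z (L x)) (frechet_derivative ?Z (at (L x)) (L v)) = ?U (L x)"
        using h unfolding iu d\<psi>[OF xW] \<psi>_def .
    qed
  qed
  have M: "?M = (hopf \<circ> \<psi>) ` (W \<inter> S)"
  proof -
    have "e \<in> V \<inter> G -` W \<inter> T" if e: "e \<in> V \<inter> T" for e
    proof -
      obtain x where x: "x \<in> S" "e = L x" using L(2) e by blast
      then show ?thesis using e G(3)[OF x(1)] by (simp add: W_def)
    qed
    then have "V \<inter> G -` W \<inter> T = V \<inter> T" by blast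
    then show ?thesis using img[of W] by simp
  qed
  show ?thesis
    unfolding hopf_hypersurface_def
  proof (intro conjI ballI)
    show "?M \<subseteq> CH r" using at(1) unfolding M CH_def by (auto simp: \<psi>_def)
    fix y assume "y \<in> ?M"
    then have y: "y \<in> (hopf \<circ> \<psi>) ` (W \<inter> S)" using M by simp
    show "\<exists>W S \<psi> \<nu>. hypersurface_param r ?M W S \<psi> \<and> y \<in> (hopf \<circ> \<psi>) ` (W \<inter> S) \<and> unit_normal W S \<psi> \<nu> \<and>
       (\<forall>x\<in>W \<inter> S. \<forall>v\<in>S. hor r (\<psi> x) (frechet_derivative \<psi> (at x) v) = (- \<i>) *\<^sub>C \<nu> x \<longrightarrow>
          - cov r (\<psi> x) (frechet_derivative \<psi> (at x) v) (\<nu> x) (frechet_derivative \<nu> (at x) v) = (2 / r * sin \<phi>) *\<^sub>R ((- \<i>) *\<^sub>C \<nu> x))"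
      by (intro exI[of _ W] exI[of _ S] exI[of _ \<psi>] exI[of _ \<nu>] conjI ballI impI lp un Hopf y)
  qed
qed

text \<open>The frames over the image are cut out by open conditions: their leaves lie in open parts of the
  two submanifolds, and their scale lies in an open set.\<close>

lemma frames_over_box:
  assumes sub12: "V1 \<subseteq> W1" "V2 \<subseteq> W2"
  obtains A where "quot_open (adapted_frames r) (frame_proj r) A"
    "\<And>g x1 x2. g \<in> adapted_frames r \<Longrightarrow> x1 \<in> V1 \<inter> S1 \<Longrightarrow> x2 \<in> V2 \<inter> S2 \<Longrightarrow> scale_coord r \<phi> g \<in> J \<Longrightarrow>
       dehom (gvec r \<phi> 1 g) = m1 x1 \<Longrightarrow> dehom (gvec r \<phi> (-1) g) = m2 x2 \<Longrightarrow> frame_proj r g \<in> A"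
    "base_point ` (R_set r \<phi> N1 N2 \<inter> A) = (\<lambda>e. hopf (Zmap r \<phi> m1 m2 e)) ` (V \<inter> T)"
proof -
  obtain A1 where A1: "openin (top_of_set (adapted_frames r)) {h \<in> adapted_frames r. leaf r \<phi> 1 (frame_proj r h) \<in> A1}"
    "\<And>h. h \<in> adapted_frames r \<Longrightarrow> leaf r \<phi> 1 (frame_proj r h) \<in> N1 \<inter> A1 \<longleftrightarrow> (\<exists>x\<in>V1 \<inter> S1. dehom (gvec r \<phi> 1 h) = m1 x)"
    using null_chartD(8)[OF ch1 V(1) sub12(1)] by blast
  obtain A2 where A2: "openin (top_of_set (adapted_frames r)) {h \<in> adapted_frames r. leaf r \<phi> (-1) (frame_proj r h) \<in> A2}"
    "\<And>h. h \<in> adapted_frames r \<Longrightarrow> leaf r \<phi> (-1) (frame_proj r h) \<in> N2 \<inter> A2 \<longleftrightarrow> (\<exists>x\<in>V2 \<inter> S2. dehom (gvec r \<phi> (-1) h) = m2 x)"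
    using null_chartD(8)[OF ch2 V(2) sub12(2)] by blast
  define Ob where "Ob = {h \<in> adapted_frames r. leaf r \<phi> 1 (frame_proj r h) \<in> A1} \<inter>
     {h \<in> adapted_frames r. leaf r \<phi> (-1) (frame_proj r h) \<in> A2} \<inter> (adapted_frames r \<inter> scale_coord r \<phi> -` J)"
  define A where "A = frame_proj r ` Ob"
  have cont: "continuous_on (adapted_frames r :: 'n aframe set) (scale_coord r \<phi>)"
    unfolding scale_coord_def[abs_def] using c
    by (intro continuous_intros linear_continuous_on[OF bounded_linear_gvec]) auto
  have Ob: "openin (top_of_set (adapted_frames r)) Ob"
    unfolding Ob_def by (intro openin_Int A1 A2 continuous_openin_preimage_gen cont V)
  have sat: "h \<in> Ob" if h: "h \<in> adapted_frames r" and hA: "frame_proj r h \<in> A" for h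
  proof -
    obtain h' where h': "h' \<in> Ob" "frame_proj r h = frame_proj r h'" using hA unfolding A_def by blast
    have "h' \<in> adapted_frames r" using h'(1) by (simp add: Ob_def)
    then obtain \<theta> where \<theta>: "h' = act (\<lambda>v. cis \<theta> *\<^sub>C v) h" using frame_proj_eq_iff[OF h _ r] h'(2) by blast
    have "scale_coord r \<phi> h' = scale_coord r \<phi> h"
      unfolding scale_coord_def \<theta> gvec_act[OF cisom_phase h r] by (simp add: norm_mult)
    then show ?thesis using h' h by (simp add: Ob_def)
  qed
  show thesis
  proof (rule that[of A])
    have ObA: "Ob \<subseteq> adapted_frames r" by (rule openin_imp_subset[OF Ob])
    have "{h \<in> adapted_frames r. frame_proj r h \<in> A} = Ob"
    proof (intro equalityI subsetI)
      show "h \<in> Ob" if "h \<in> {h \<in> adapted_frames r. frame_proj r h \<in> A}" for h using that sat by simp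
      show "h \<in> {h \<in> adapted_frames r. frame_proj r h \<in> A}" if "h \<in> Ob" for h
        using subsetD[OF ObA that] imageI[OF that, of "frame_proj r"] by (simp add: A_def)
    qed
    moreover have "A \<subseteq> frame_proj r ` adapted_frames r" unfolding A_def using ObA by (rule image_mono)
    ultimately show "quot_open (adapted_frames r) (frame_proj r) A" using Ob by (simp add: quot_open_def)
    show "frame_proj r g \<in> A" if "g \<in> adapted_frames r" "x1 \<in> V1 \<inter> S1" "x2 \<in> V2 \<inter> S2" "scale_coord r \<phi> g \<in> J"
       "dehom (gvec r \<phi> 1 g) = m1 x1" "dehom (gvec r \<phi> (-1) g) = m2 x2" for g x1 x2
    proof -
      have "leaf r \<phi> 1 (frame_proj r g) \<in> N1 \<inter> A1" using A1(2)[OF that(1)] that by blast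
      moreover have "leaf r \<phi> (-1) (frame_proj r g) \<in> N2 \<inter> A2" using A2(2)[OF that(1)] that by blast
      ultimately have "g \<in> Ob" using that by (simp add: Ob_def)
      then show ?thesis by (simp add: A_def)
    qed
    show "base_point ` (R_set r \<phi> N1 N2 \<inter> A) = (\<lambda>e. hopf (Zmap r \<phi> m1 m2 e)) ` (V \<inter> T)"
    proof (intro equalityI subsetI)
      fix y assume "y \<in> base_point ` (R_set r \<phi> N1 N2 \<inter> A)"
      then obtain h where h: "h \<in> Ob" "frame_proj r h \<in> R_set r \<phi> N1 N2" "y = base_point (frame_proj r h)"
        by (auto simp: A_def)
      have ha: "h \<in> adapted_frames r" using h(1) by (simp add: Ob_def)
      obtain x1 where x1: "x1 \<in> V1 \<inter> S1" "dehom (gvec r \<phi> 1 h) = m1 x1"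
        using A1(2)[OF ha] h by (auto simp: Ob_def R_set_def)
      obtain x2 where x2: "x2 \<in> V2 \<inter> S2" "dehom (gvec r \<phi> (-1) h) = m2 x2"
        using A2(2)[OF ha] h by (auto simp: Ob_def R_set_def)
      have w: "x1 \<in> W1 \<inter> S1" "x2 \<in> W2 \<inter> S2" using x1(1) x2(1) sub12 by blast+
      have "y = hopf (Zmap r \<phi> m1 m2 (x1, x2, scale_coord r \<phi> h))"
        using frame_params(3)[OF ha w x1(2) x2(2)] h(3) by (simp add: base_point_def frame_proj_def)
      moreover have "(x1, x2, scale_coord r \<phi> h) \<in> V \<inter> T" using x1(1) x2(1) h(1) by (simp add: V(4) T Ob_def)
      ultimately show "y \<in> (\<lambda>e. hopf (Zmap r \<phi> m1 m2 e)) ` (V \<inter> T)" by blast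
    next
      fix y assume "y \<in> (\<lambda>e. hopf (Zmap r \<phi> m1 m2 e)) ` (V \<inter> T)"
      then obtain e where e: "e \<in> V \<inter> T" "y = hopf (Zmap r \<phi> m1 m2 e)" by blast
      have ed: "e \<in> param_dom W1 W2 m1 m2" "e \<in> S1 \<times> S2 \<times> UNIV" using e(1) V_dom T by blast+
      obtain h where h: "h \<in> adapted_frames r" "fst h = Zmap r \<phi> m1 m2 e"
        "gvec r \<phi> 1 h = (of_real (2 * cos \<phi>) * cis (- \<phi>)) *\<^sub>C null1 m1 e"
        "gvec r \<phi> (-1) h = (- of_real (2 * cos \<phi>) * cis \<phi>) *\<^sub>C null2 \<phi> m1 m2 e"
        using frame_of_null_pair[OF r c null_pair[OF r c ch1 ch2 ed]] unfolding Zmap_def by metis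
      have l: "snd (snd e) > 0" "herm (m1 (fst e)) (m2 (fst (snd e))) \<noteq> 0" "fst e \<in> W1" "fst (snd e) \<in> W2"
        using ed(1) by (simp_all add: param_dom_def)
      have f: "fst (m1 (fst e)) = 1" "fst (m2 (fst (snd e))) = 1"
        using null_chartD(3)[OF ch1 l(3)] null_chartD(3)[OF ch2 l(4)] .
      have d: "dehom (gvec r \<phi> 1 h) = m1 (fst e)" "dehom (gvec r \<phi> (-1) h) = m2 (fst (snd e))"
      proof -
        have "dehom (gvec r \<phi> 1 h) = dehom (m1 (fst e))" using c l unfolding h(3) null1_def by (simp add: cis_neq_zero)
        then show "dehom (gvec r \<phi> 1 h) = m1 (fst e)" using f by (simp add: dehom_def[of "m1 (fst e)"])
        have "dehom (gvec r \<phi> (-1) h) = dehom (m2 (fst (snd e)))"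
          using c l null_pairing_nonzero[OF c] unfolding h(4) null2_def by (simp add: cis_neq_zero)
        then show "dehom (gvec r \<phi> (-1) h) = m2 (fst (snd e))" using f by (simp add: dehom_def[of "m2 (fst (snd e))"])
      qed
      have sc: "scale_coord r \<phi> h = snd (snd e)"
        unfolding scale_coord_def h(3) null1_def using c l f by (simp add: norm_mult)
      have x: "fst e \<in> V1 \<inter> S1" "fst (snd e) \<in> V2 \<inter> S2" "snd (snd e) \<in> J" using e(1) by (auto simp: V(4) T)
      have n: "leaf r \<phi> 1 (frame_proj r h) \<in> N1 \<inter> A1" "leaf r \<phi> (-1) (frame_proj r h) \<in> N2 \<inter> A2"
        using A1(2)[OF h(1)] A2(2)[OF h(1)] d x by blast+
      have "frame_proj r h \<in> A" using n x h(1) by (auto simp: A_def Ob_def sc)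
      moreover have "frame_proj r h \<in> R_set r \<phi> N1 N2" using n h(1) frames_eq[OF r] by (auto simp: R_set_def)
      moreover have "base_point (frame_proj r h) = y" by (simp add: base_point_def frame_proj_def h(2) e(2))
      ultimately show "y \<in> base_point ` (R_set r \<phi> N1 N2 \<inter> A)" by blast
    qed
  qed
qed

end

lemma hopf_hypersurface_near:
  assumes g: "g \<in> adapted_frames r" and x: "x1 \<in> W1 \<inter> S1" "x2 \<in> W2 \<inter> S2"
    and d: "dehom (gvec r \<phi> 1 g) = m1 x1" "dehom (gvec r \<phi> (-1) g) = m2 x2"
    and dim: "dim S1 = CARD('n) - 1" "dim S2 = CARD('n) - 1"
    and wedge: "wedge_nonzero r (R_set r \<phi> N1 N2) g"
  shows "\<exists>A. quot_open (adapted_frames r) (frame_proj r) A \<and> frame_proj r g \<in> A \<and>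
    hopf_hypersurface r (2 / r * sin \<phi>) (base_point ` (R_set r \<phi> N1 N2 \<inter> A))"
proof -
  let ?e = "(x1, x2, scale_coord r \<phi> g)"
  note fp = frame_params(1,2)[OF g x d]
  obtain V1 V2 J k where V: "open V1" "open V2" "open J" "?e \<in> V1 \<times> V2 \<times> J" "V1 \<times> V2 \<times> J \<subseteq> \<Omega>" "V1 \<subseteq> W1" "V2 \<subseteq> W2" "k > 0"
    "\<forall>x\<in>(V1 \<times> V2 \<times> J) \<inter> T. \<forall>y\<in>(V1 \<times> V2 \<times> J) \<inter> T. k * norm (x - y) \<le> norm (F x - F y)"
    "\<forall>e\<in>(V1 \<times> V2 \<times> J) \<inter> T. \<forall>v\<in>T. frechet_derivative F (at e) v = 0 \<longrightarrow> v = 0"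
    by (rule local_box[OF Zmap_Q(3)[OF fp] fp(2) immersion_of_wedge[OF g x d dim wedge]]) (assumption | rule that)+
  note box = V(1-3) refl V(5,8,9,10)
  obtain A where A: "quot_open (adapted_frames r) (frame_proj r) A"
    "\<And>g x1 x2. g \<in> adapted_frames r \<Longrightarrow> x1 \<in> V1 \<inter> S1 \<Longrightarrow> x2 \<in> V2 \<inter> S2 \<Longrightarrow> scale_coord r \<phi> g \<in> J \<Longrightarrow>
       dehom (gvec r \<phi> 1 g) = m1 x1 \<Longrightarrow> dehom (gvec r \<phi> (-1) g) = m2 x2 \<Longrightarrow> frame_proj r g \<in> A"
    "base_point ` (R_set r \<phi> N1 N2 \<inter> A) = (\<lambda>e. hopf (Zmap r \<phi> m1 m2 e)) ` ((V1 \<times> V2 \<times> J) \<inter> T)"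
    by (rule frames_over_box[OF box V(6,7)]) (rule that)
  have "frame_proj r g \<in> A" using V(4) x by (intro A(2)[OF g _ _ _ d]) auto
  moreover have "hopf_hypersurface r (2 / r * sin \<phi>) (base_point ` (R_set r \<phi> N1 N2 \<inter> A))"
    unfolding A(3) by (rule hopf_hypersurface_box[OF box dim])
  ultimately show ?thesis using A(1) by blast
qed

end

theorem mainTheorem2:
  fixes r \<alpha> \<phi> :: real
    and N1 N2 :: "'n::{finite,linorder} frame set set"
    and n1 n2 :: "'n frame set \<Rightarrow> 'n cvec"
    and U :: "('n frame set \<times> 'n frame set) set"
    and \<tau> :: "'n frame set \<times> 'n frame set \<Rightarrow> complex"
    and R :: "'n frame set"
  assumes "r > 0"
    and "\<bar>\<alpha>\<bar> < 2 / r" "- pi / 2 < \<phi>" "\<phi> < pi / 2" "\<alpha> = (2 / r) * sin \<phi>"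
    and "legendrian r \<phi> 1 (CARD('n) - 1) N1"
    and "legendrian r \<phi> (-1) (CARD('n) - 1) N2"
    and "smooth_lift r \<phi> 1 (CARD('n) - 1) N1 n1"
    and "smooth_lift r \<phi> (-1) (CARD('n) - 1) N2 n2"
    and U: "U = {(p1, p2). p1 \<in> N1 \<and> p2 \<in> N2 \<and> herm (n1 p1) (n2 p2) \<noteq> 0}"
    and "smooth_on_product r \<phi> (CARD('n) - 1) N1 N2 U \<tau>"
    and "\<forall>(p1, p2)\<in>U. (\<tau> (p1, p2))\<^sup>2 = (1 - \<i> * of_real (tan \<phi>)) / (2 * herm (n1 p1) (n2 p2))"
    and R: "R = R_set r \<phi> N1 N2"
  shows "(\<forall>p\<in>U. \<forall>l>0. hopf_lift r n1 n2 \<tau> p l \<in> Q r) \<and>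
    {hopf (hopf_lift r n1 n2 \<tau> p l) | p l. p \<in> U \<and> l > 0} = base_point ` R \<and>
    (\<forall>g\<in>adapted_frames r. frame_proj r g \<in> R \<and> wedge_nonzero r R g \<longrightarrow>
       (\<exists>A. quot_open (adapted_frames r) (frame_proj r) A \<and> frame_proj r g \<in> A \<and>
            hopf_hypersurface r \<alpha> (base_point ` (R \<inter> A))))"
proof -
  have r: "r > 0" by fact
  have c: "cos \<phi> > 0" using assms(3,4) by (intro cos_gt_zero_pi) simp_all
  have N1: "N1 \<subseteq> leaf_space r \<phi> 1" and N2: "N2 \<subseteq> leaf_space r \<phi> (-1)"
    using assms(6,7) by (simp_all add: legendrian_def leaf_submanifold_def)
  have n1: "n1 l \<in> null_cone \<and> cline (n1 l) = gamma r \<phi> 1 l" if "l \<in> N1" for l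
    using assms(8) that by (simp add: smooth_lift_def)
  have n2: "n2 l \<in> null_cone \<and> cline (n2 l) = gamma r \<phi> (-1) l" if "l \<in> N2" for l
    using assms(9) that by (simp add: smooth_lift_def)
  have \<tau>: "(\<tau> (p1, p2))\<^sup>2 = (1 - \<i> * of_real (tan \<phi>)) / (2 * herm (n1 p1) (n2 p2))" if "(p1, p2) \<in> U" for p1 p2
    using assms(12) that by blast
  note image = hopf_lift_image[OF r c N1 n1 N2 n2 U \<tau>, folded R]
  have near: "\<exists>A. quot_open (adapted_frames r) (frame_proj r) A \<and> frame_proj r g \<in> A \<and>
      hopf_hypersurface r \<alpha> (base_point ` (R \<inter> A))"
    if g: "g \<in> adapted_frames r" and gR: "frame_proj r g \<in> R" and wedge: "wedge_nonzero r R g" for g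
  proof -
    have l: "leaf r \<phi> 1 (frame_proj r g) \<in> N1" "leaf r \<phi> (-1) (frame_proj r g) \<in> N2"
      using gR by (simp_all add: R R_set_def)
    obtain W1 S1 m1 x1 where c1: "null_chart r \<phi> 1 N1 W1 S1 m1" "dim S1 = CARD('n) - 1" "x1 \<in> W1 \<inter> S1"
      "dehom (gvec r \<phi> 1 g) = m1 x1"
      using null_chart_exists[OF r _ assms(6) l(1)] g by (metis one_power2)
    obtain W2 S2 m2 x2 where c2: "null_chart r \<phi> (-1) N2 W2 S2 m2" "dim S2 = CARD('n) - 1" "x2 \<in> W2 \<inter> S2"
      "dehom (gvec r \<phi> (-1) g) = m2 x2"
      using null_chart_exists[OF r _ assms(7) l(2)] g by (metis power2_minus one_power2)
    have "\<alpha> = 2 / r * sin \<phi>" by fact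
    then show ?thesis
      using hopf_hypersurface_near[OF r c c1(1) c2(1) refl refl refl g c1(3) c2(3) c1(4) c2(4) c1(2) c2(2)] wedge
      by (simp add: R)
  qed
  show ?thesis
  proof (intro conjI ballI allI impI)
    show "hopf_lift r n1 n2 \<tau> p l \<in> Q r" if "p \<in> U" "l > 0" for p l 
      by (rule image(1)) (use that in simp_all)
    show "{hopf (hopf_lift r n1 n2 \<tau> p l) | p l. p \<in> U \<and> l > 0} = base_point ` R" by (rule image(2))
    fix g assume "g \<in> adapted_frames r" "frame_proj r g \<in> R \<and> wedge_nonzero r R g"
    then show "\<exists>A. quot_open (adapted_frames r) (frame_proj r) A \<and> frame_proj r g \<in> A \<and>
        hopf_hypersurface r \<alpha> (base_point ` (R \<inter> A))"
      by (intro near) simp_all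
  qed
qed

end
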